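(* Let $W=(W_t)_{t\ge0}$ be a standard Brownian motion, let $n\ge1$ be an integer, and let $f:(0,\infty)\times\mathbb{R}\to\mathbb{R}$ be a continuous function such that $f(t,W_t)$ is integrable for every $t>0$. Put $g(t)=E f(t,W_t)$. Then the process $M_t=f(t,W_t)-g(t)$, $t>0$, is a martingale satisfying the condition (C) for some constant $C>0$ the process $\langle M\rangle_t-C\int_0^t(1+s+W_s^2)^{n-1}\,ds$ is non-increasing, if and only if $f(t,x)=P(t,x)+c(t)$ for all $t>0$, $x\in\mathbb{R}$, for some heat polynomial $P$ of degree at most $n$ and some deterministic function $c(t)$.
   Context: $W$ is a standard Brownian motion on a complete probability space $(\Omega,\mathcal{F},P)$, and $(\mathcal{F}_t)$ is the filtration generated by $W$; "martingale" means martingale with respect to this filtration. $\langle M\rangle$ denotes the quadratic variation process of the martingale $M$. A heat polynomial is a polynomial $P(t,x)$ in the two variables $t,x$ which solves the (backward) heat equation $\partial_t P+\tfrac12\partial_{xx}P=0$. *)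

theory Defs
  imports "HOL-Probability.Probability"
begin

definition brownian_motion :: "'a measure \<Rightarrow> (real \<Rightarrow> 'a \<Rightarrow> real) \<Rightarrow> bool" where
  "brownian_motion M W \<longleftrightarrow>
     prob_space M \<and>
     (\<forall>t\<ge>0. W t \<in> borel_measurable M) \<and>
     (AE \<omega> in M. W 0 \<omega> = 0 \<and> continuous_on {0..} (\<lambda>t. W t \<omega>)) \<and>
     (\<forall>s t. 0 \<le> s \<and> s < t \<longrightarrow>
        distributed M lborel (\<lambda>\<omega>. W t \<omega> - W s \<omega>) (\<lambda>x. ennreal (normal_density 0 (sqrt (t - s)) x))) \<and>
     (\<forall>(ts::nat \<Rightarrow> real) k. 0 \<le> ts 0 \<and> (\<forall>i<k. ts i < ts (Suc i)) \<longrightarrow>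
        prob_space.indep_vars M (\<lambda>_. borel) (\<lambda>i \<omega>. W (ts (Suc i)) \<omega> - W (ts i) \<omega>) {..<k})"

definition bm_filtration :: "'a measure \<Rightarrow> (real \<Rightarrow> 'a \<Rightarrow> real) \<Rightarrow> real \<Rightarrow> 'a measure" where
  "bm_filtration M W t =
     sigma (space M) (\<Union>s\<in>{0..t}. {W s -` B \<inter> space M | B. B \<in> sets borel})"

definition martingale_on ::
  "'a measure \<Rightarrow> (real \<Rightarrow> 'a measure) \<Rightarrow> real set \<Rightarrow> (real \<Rightarrow> 'a \<Rightarrow> real) \<Rightarrow> bool" where
  "martingale_on M F I X \<longleftrightarrow>
     (\<forall>t\<in>I. integrable M (X t) \<and> X t \<in> borel_measurable (F t)) \<and>
     (\<forall>s\<in>I. \<forall>t\<in>I. s \<le> t \<longrightarrow> (AE \<omega> in M. real_cond_exp M (F s) (X t) \<omega> = X s \<omega>))"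

definition partition_of :: "real \<Rightarrow> real \<Rightarrow> (nat \<Rightarrow> real) \<Rightarrow> nat \<Rightarrow> bool" where
  "partition_of s t p k \<longleftrightarrow> 0 < k \<and> p 0 = s \<and> p k = t \<and> (\<forall>i<k. p i < p (Suc i))"

definition mesh :: "(nat \<Rightarrow> real) \<Rightarrow> nat \<Rightarrow> real" where
  "mesh p k = Max ((\<lambda>i. p (Suc i) - p i) ` {..<k})"

definition qv_limit :: "'a measure \<Rightarrow> (real \<Rightarrow> 'a \<Rightarrow> real) \<Rightarrow> real \<Rightarrow> real \<Rightarrow> ('a \<Rightarrow> real) \<Rightarrow> bool" where
  "qv_limit M X s t Q \<longleftrightarrow>
     Q \<in> borel_measurable M \<and>
     (\<forall>\<epsilon>>0. \<forall>\<delta>>0. \<exists>\<eta>>0. \<forall>p k. partition_of s t p k \<and> mesh p k < \<eta> \<longrightarrow>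
        measure M {\<omega>\<in>space M. \<bar>(\<Sum>i<k. (X (p (Suc i)) \<omega> - X (p i) \<omega>)\<^sup>2) - Q \<omega>\<bar> > \<epsilon>} < \<delta>)"

definition qv_process :: "'a measure \<Rightarrow> (real \<Rightarrow> 'a \<Rightarrow> real) \<Rightarrow> (real \<Rightarrow> 'a \<Rightarrow> real) \<Rightarrow> bool" where
  "qv_process M X A \<longleftrightarrow>
     (\<forall>t>0. X t \<in> borel_measurable M \<and> A t \<in> borel_measurable M) \<and>
     (\<forall>s t. 0 < s \<and> s < t \<longrightarrow> qv_limit M X s t (\<lambda>\<omega>. A t \<omega> - A s \<omega>))"

definition heat_polynomial_deg :: "(real \<Rightarrow> real \<Rightarrow> real) \<Rightarrow> nat \<Rightarrow> bool" where
  "heat_polynomial_deg P n \<longleftrightarrow>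
     (\<exists>a :: nat \<Rightarrow> nat \<Rightarrow> real. \<forall>t x. P t x = (\<Sum>i\<le>n. \<Sum>j\<le>n - i. a i j * t ^ i * x ^ j)) \<and>
     (\<forall>t x. deriv (\<lambda>s. P s x) t + 1/2 * deriv (\<lambda>y. deriv (\<lambda>z. P t z) y) x = 0)"

end

theory Submission
  imports Defs "HOL-Computational_Algebra.Polynomial"
begin

text \<open>
  Write \<open>H\<^sub>k\<close> for the Hermite heat polynomials and \<open>h = f - g\<close>. If \<open>h (t, W\<^sub>t)\<close> is a martingale, then \<open>h\<close> at
  time \<open>s\<close> is the Gaussian average of \<open>h\<close> at time \<open>t\<close>; hence \<open>h\<close> is smooth and its quadratic variation
  is the integral of \<open>(\<partial>\<^sub>x h)\<^sup>2\<close> along the path. Condition (C) becomes the pointwise bound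
  \<open>(\<partial>\<^sub>x h)\<^sup>2 \<le> C (1 + t + x\<^sup>2)\<^bsup>n-1\<^esup>\<close>, because the law of \<open>W\<^sub>t\<close> has full support, and with \<open>E h (t, W\<^sub>t) = 0\<close>
  it gives \<open>\<bar>h\<bar> \<le> K (sqrt (1 + t) + \<bar>x\<bar>)\<^bsup>n\<^esup>\<close>. The Hermite coefficients \<open>c\<^sub>k (t) = E (h (t, W\<^sub>t) H\<^sub>k (t, W\<^sub>t))\<close> are
  homogeneous, \<open>c\<^sub>k (t) = t\<^bsup>k\<^esup> c\<^sub>k (1)\<close>, since the bridge from \<open>0\<close> to \<open>W\<^sub>t\<close> averages \<open>H\<^sub>k (s, W\<^sub>s)\<close> to
  \<open>(s / t)\<^bsup>k\<^esup> H\<^sub>k (t, W\<^sub>t)\<close>. The growth bound gives \<open>c\<^sub>k (t) = O (t\<^bsup>(n+k)/2\<^esup>)\<close> as \<open>t\<close> grows, so \<open>c\<^sub>k = 0\<close> for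
  \<open>k > n\<close>, and \<open>h\<close> is a combination of \<open>H\<^sub>0, \<dots>, H\<^sub>n\<close>.

  Conversely, every heat polynomial of degree at most \<open>n\<close> is such a combination, and
  \<open>\<partial>\<^sub>x H\<^sub>k = k H\<^sub>k\<^sub>-\<^sub>1\<close> has size at most a multiple of \<open>(1 + t + x\<^sup>2)\<^bsup>(k-1)/2\<^esup>\<close>.
\<close>

section \<open>Hermite heat polynomials and Gaussian integrals\<close>

text \<open>No stochastic calculus is used. Ito's formula is replaced by a Taylor estimate of
  \<open>h\<close>, first order in x, with error of size |t' - t| + (x' - x)^2: along a Brownian
  path both error terms are of the order of the time step, so only the gradient term contributes to
  the limit of the squared increments. Two mismatches shape the proof. The bracket is a limit in
  probability over all partitions, whereas the path argument gives almost sure convergence along one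
  sequence; meshes below 2^-m allow the passage in both directions. And almost sure identities
  concern \<open>W s\<close> only, which is why everything that is compared must be shown continuous
  in x. That vanishing Hermite coefficients force a function to be zero is not taken from
  completeness in L^2: the function is averaged from time 3 s down to s, and the kernel is expanded
  into polynomials. With T in place of 3 s, the quadratic exponent has leading coefficient s / (2 T
  (T - s)) in absolute value, which lies below the Gaussian rate 1 / (2 T) exactly when T > 2 s;
  hence the factor 3.\<close>

abbreviation gauss :: "real \<Rightarrow> real \<Rightarrow> real" where
  "gauss t \<equiv> normal_density 0 (sqrt t)"

lemma gauss_eq: "t > 0 \<Longrightarrow> gauss t y = exp (- y\<^sup>2 / (2 * t)) / sqrt (2 * pi * t)"
  by (simp add: normal_density_def)

lemma gauss_pos: "t > 0 \<Longrightarrow> gauss t y > 0"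
  by (simp add: normal_density_pos)

lemma integrable_gauss_abs_power:
  "t > 0 \<Longrightarrow> integrable lborel (\<lambda>y. \<bar>y\<bar> ^ k * gauss t y)"
  using integrable_normal_moment_abs[of "sqrt t" 0 k] by (simp add: mult.commute)

lemma integrable_gauss_power:
  "t > 0 \<Longrightarrow> integrable lborel (\<lambda>y. y ^ k * gauss t y)"
  using integrable_normal_moment[of "sqrt t" 0 k] by (simp add: mult.commute)

lemma integrable_gauss_poly:
  assumes "t > 0"
  shows "integrable lborel (\<lambda>y. poly q y * gauss t y)"
  unfolding poly_altdef sum_distrib_right
  using integrable_gauss_power[OF assms] by (auto simp: mult.assoc)

text \<open>Both parities are read off from the closed forms of the normal moments. The recursion is
  integration by parts for a single monomial, so that no boundary terms have to be discussed in
  \<open>gauss_stein\<close>.\<close>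

lemma integral_gauss_power_Suc_Suc:
  assumes "t > 0"
  shows "(LBINT y. y ^ (k + 2) * gauss t y) = real (k + 1) * t * (LBINT y. y ^ k * gauss t y)"
proof (cases "even k")
  case True
  then obtain m where m: "k = 2 * m" by (elim evenE)
  have *: "(LBINT y. y ^ (2 * j) * gauss t y) = fact (2 * j) / ((2 / t) ^ j * fact j)" for j
    using integral_normal_moment_even[of "sqrt t" 0 j] assms by (simp add: mult.commute)
  have "2 * m + 2 = 2 * (m + 1)" by simp
  then have "(LBINT y. y ^ (k + 2) * gauss t y) = fact (2 * (m + 1)) / ((2 / t) ^ (m + 1) * fact (m + 1))"
    unfolding m using *[of "m+1"] by metis
  also have "\<dots> = real (k + 1) * t * (fact (2 * m) / ((2 / t) ^ m * fact m))"
    using assms by (simp add: m divide_simps)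
  finally show ?thesis using * m by simp
next
  case False
  then obtain m where m: "k = 2 * m + 1" by (elim oddE)
  have *: "(LBINT y. y ^ (2 * j + 1) * gauss t y) = 0" for j
    using integral_normal_moment_odd[of "sqrt t" 0 j] assms by (simp add: mult.commute)
  have "2 * m + 1 + 2 = 2 * (m + 1) + 1" by simp
  then show ?thesis unfolding m using *[of m] *[of "m+1"] by (metis mult_zero_right)
qed

lemma integral_gauss_id: "t > 0 \<Longrightarrow> (LBINT y. y * gauss t y) = 0"
  using integral_normal_moment_odd[of "sqrt t" 0 0] by (simp add: mult.commute)

lemma gauss_stein_monom:
  assumes "t > 0"
  shows "(LBINT y. y * y ^ k * gauss t y) = t * (LBINT y. poly (pderiv (monom 1 k)) y * gauss t y)"
proof (cases k)
  case 0
  then show ?thesis using integral_gauss_id[OF assms] by (simp add: pderiv_monom)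
next
  case (Suc j)
  have "(LBINT y. y * y ^ k * gauss t y) = real (j + 1) * t * (LBINT y. y ^ j * gauss t y)"
    using integral_gauss_power_Suc_Suc[OF assms, of j] Suc by simp
  then show ?thesis using Suc by (simp add: pderiv_monom poly_monom mult.assoc del: of_nat_Suc)
qed

text \<open>Gaussian integration by parts, reduced by linearity to monomials. It is the main
  analytic input to both the averaging property and the orthogonality of the Hermite
  polynomials.\<close>

lemma gauss_stein:
  assumes t: "t > 0"
  shows "(LBINT y. y * poly q y * gauss t y) = t * (LBINT y. poly (pderiv q) y * gauss t y)"
proof -
  have q: "q = (\<Sum>i\<le>degree q. smult (coeff q i) (monom 1 i))"
    using poly_as_sum_of_monoms[of q] by (simp add: smult_monom)
  have i1: "integrable lborel (\<lambda>y. y * y ^ k * gauss t y)" for k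
    using integrable_gauss_power[OF t, of "Suc k"] by simp
  have "(LBINT y. y * poly q y * gauss t y) = (LBINT y. (\<Sum>i\<le>degree q. coeff q i * (y * y ^ i * gauss t y)))"
    by (simp add: poly_altdef sum_distrib_left sum_distrib_right mult_ac)
  also have "\<dots> = (\<Sum>i\<le>degree q. coeff q i * (LBINT y. y * y ^ i * gauss t y))"
    by (subst Bochner_Integration.integral_sum) (auto intro: i1)
  also have "\<dots> = t * (\<Sum>i\<le>degree q. coeff q i * (LBINT y. poly (pderiv (monom 1 i)) y * gauss t y))"
    unfolding gauss_stein_monom[OF t] sum_distrib_left by (simp add: mult.left_commute)
  also have "(\<Sum>i\<le>degree q. coeff q i * (LBINT y. poly (pderiv (monom 1 i)) y * gauss t y)) =
     (LBINT y. (\<Sum>i\<le>degree q. coeff q i * (poly (pderiv (monom 1 i)) y * gauss t y)))"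
    by (subst Bochner_Integration.integral_sum) (auto intro: integrable_gauss_poly[OF t])
  also have "\<dots> = (LBINT y. poly (pderiv q) y * gauss t y)"
  proof -
    have "pderiv q = (\<Sum>i\<le>degree q. smult (coeff q i) (pderiv (monom 1 i)))"
      by (subst q) (simp add: higher_pderiv_sum[where n=1, simplified] pderiv_smult)
    then show ?thesis
      by (simp add: poly_sum sum_distrib_right mult.assoc)
  qed
  finally show ?thesis .
qed

text \<open>In terms of the probabilists' Hermite polynomials, \<open>poly (hpoly k t) x = t\<^bsup>k/2\<^esup> He\<^sub>k (x / sqrt t)\<close>.\<close>

fun hpoly :: "nat \<Rightarrow> real \<Rightarrow> real poly" where
  "hpoly 0 t = 1"
| "hpoly (Suc 0) t = [:0, 1:]"
| "hpoly (Suc (Suc k)) t = [:0, 1:] * hpoly (Suc k) t - smult (real (Suc k) * t) (hpoly k t)"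

lemma pderiv_hpoly: "pderiv (hpoly (Suc k) t) = smult (real (Suc k)) (hpoly k t)"
proof (induction k t rule: hpoly.induct)
  case (1 t) then show ?case by (simp add: pderiv_pCons)
next
  case (2 t) then show ?case by (simp add: pderiv_pCons pderiv_diff pderiv_smult one_pCons)
next
  case (3 k t)
  have "pderiv (hpoly (Suc (Suc (Suc k))) t) = hpoly (Suc (Suc k)) t
      + [:0,1:] * smult (real (Suc (Suc k))) (hpoly (Suc k) t)
      - smult (real (Suc (Suc k)) * t) (smult (real (Suc k)) (hpoly k t))"
    unfolding hpoly.simps(3)[of "Suc k"] pderiv_diff pderiv_mult pderiv_smult 3
    by (simp add: pderiv_pCons)
  also have "\<dots> = smult (real (Suc (Suc (Suc k)))) (hpoly (Suc (Suc k)) t)"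
    by (subst poly_eq_poly_eq_iff[symmetric], rule ext) (simp add: algebra_simps)
  finally show ?case .
qed

lemma poly_hpoly_has_derivative_x:
  "((\<lambda>x. poly (hpoly (Suc k) t) x) has_real_derivative real (Suc k) * poly (hpoly k t) x) (at x)"
  using poly_DERIV[of "hpoly (Suc k) t" x] by (simp add: pderiv_hpoly del: of_nat_Suc hpoly.simps)

lemma poly_hpoly_Suc_Suc:
  "poly (hpoly (Suc (Suc k)) t) x = x * poly (hpoly (Suc k) t) x - real (Suc k) * t * poly (hpoly k t) x"
  by simp

text \<open>Together with \<open>pderiv_hpoly\<close> this is the backward heat equation: the right
  side is minus half the second x-derivative. For k < 2 the index \<open>k - 2\<close> truncates to
  0, but the factor k * (k - 1) then vanishes.\<close>

lemma poly_hpoly_has_derivative_t: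
  "((\<lambda>t. poly (hpoly k t) x) has_real_derivative - (1/2) * real (k * (k - 1)) * poly (hpoly (k - 2) t) x) (at t)"
proof (induction k t rule: hpoly.induct)
  case (1 t) then show ?case by simp
next
  case (2 t) then show ?case by simp
next
  case (3 k t)
  have "((\<lambda>t. x * poly (hpoly (Suc k) t) x - real (Suc k) * t * poly (hpoly k t) x) has_real_derivative
     x * (- (1/2) * real (Suc k * k) * poly (hpoly (Suc k - 2) t) x) -
     (real (Suc k) * poly (hpoly k t) x + real (Suc k) * t * (- (1/2) * real (k * (k - 1)) * poly (hpoly (k - 2) t) x))) (at t)"
    using 3 by (auto intro!: derivative_eq_intros simp: field_simps)
  moreover have "x * (- (1/2) * real (Suc k * k) * poly (hpoly (Suc k - 2) t) x) -
     (real (Suc k) * poly (hpoly k t) x + real (Suc k) * t * (- (1/2) * real (k * (k - 1)) * poly (hpoly (k - 2) t) x))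
     = - (1/2) * real (Suc (Suc k) * (Suc (Suc k) - 1)) * poly (hpoly (Suc (Suc k) - 2) t) x"
  proof -
    consider "k = 0" | "k = 1" | j where "k = Suc (Suc j)" by (metis One_nat_def not0_implies_Suc)
    then show ?thesis
    proof cases
      case 3
      have "poly (hpoly k t) x = x * poly (hpoly (Suc j) t) x - real (Suc j) * t * poly (hpoly j t) x"
        unfolding 3 by simp
      moreover have "Suc k - 2 = Suc j" "k - 2 = j" "k - 1 = Suc j" "Suc (Suc k) - 2 = k" "Suc (Suc k) - 1 = Suc k"
        "Suc k = Suc (Suc (Suc j))" using 3 by auto
      ultimately show ?thesis
        by (simp only: of_nat_mult) (simp add: 3 field_simps del: hpoly.simps)
    qed (auto simp: algebra_simps)
  qed
  ultimately show ?case unfolding poly_hpoly_Suc_Suc by simp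
qed

text \<open>Parabolic homogeneity, time scaling like the square of space. It produces the factor (s
  / t)^k in the bridge formula and reduces time t to time 1 in the estimate of the Hermite
  coefficients.\<close>

lemma hpoly_scale: "poly (hpoly k (c\<^sup>2 * t)) (c * x) = c ^ k * poly (hpoly k t) x"
proof (induction k t rule: hpoly.induct)
  case (3 k t)
  then show ?case by (simp add: algebra_simps power2_eq_square)
qed auto

text \<open>The side conditions place (t, x) in the parabolic ball of radius r, where a function
  homogeneous of degree k is of order r^k. The recursion respects this: a factor x costs r, a factor
  t costs r^2.\<close>

lemma hpoly_bound: "\<exists>K\<ge>0. \<forall>t\<ge>0. \<forall>x r. \<bar>x\<bar> \<le> r \<and> t \<le> r\<^sup>2 \<longrightarrow> \<bar>poly (hpoly k t) x\<bar> \<le> K * r ^ k"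
proof (induction k rule: induct_nat_012)
  case 0
  then show ?case by (auto intro!: exI[of _ 1])
next
  case 1
  then show ?case by (auto intro!: exI[of _ 1])
next
  case (ge2 k)
  obtain K where K: "K \<ge> 0" "\<And>t x r. t\<ge>0 \<Longrightarrow> \<bar>x\<bar> \<le> r \<Longrightarrow> t \<le> r\<^sup>2 \<Longrightarrow> \<bar>poly (hpoly k t) x\<bar> \<le> K * r ^ k"
    using ge2(1) by blast
  obtain L where L: "L \<ge> 0" "\<And>t x r. t\<ge>0 \<Longrightarrow> \<bar>x\<bar> \<le> r \<Longrightarrow> t \<le> r\<^sup>2 \<Longrightarrow> \<bar>poly (hpoly (Suc k) t) x\<bar> \<le> L * r ^ (Suc k)"
    using ge2(2) by blast
  show ?case
  proof (intro exI[of _ "L + real (Suc k) * K"] conjI allI impI)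
    show "0 \<le> L + real (Suc k) * K" using K L by simp
    fix t x r :: real assume t: "0 \<le> t" and a: "\<bar>x\<bar> \<le> r \<and> t \<le> r\<^sup>2"
    have r: "r \<ge> 0" using a by linarith
    have "\<bar>poly (hpoly (Suc (Suc k)) t) x\<bar> \<le> \<bar>x\<bar> * \<bar>poly (hpoly (Suc k) t) x\<bar> + real (Suc k) * t * \<bar>poly (hpoly k t) x\<bar>"
      unfolding poly_hpoly_Suc_Suc using t by (intro abs_triangle_ineq4[THEN order_trans]) (simp add: abs_mult)
    also have "\<dots> \<le> r * (L * r ^ Suc k) + real (Suc k) * r\<^sup>2 * (K * r ^ k)"
      using t a r K L by (intro add_mono mult_mono) (auto simp del: power_Suc)
    also have "\<dots> = (L + real (Suc k) * K) * r ^ Suc (Suc k)"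
      by (simp add: algebra_simps power2_eq_square)
    finally show "\<bar>poly (hpoly (Suc (Suc k)) t) x\<bar> \<le> (L + real (Suc k) * K) * r ^ Suc (Suc k)" .
  qed
qed

text \<open>Follows from the three-term recursion and integration by parts, without differentiating
  in time. The earlier time s is an arbitrary real; the case s = 0 is what computes means and starts
  the orthogonality proof.\<close>

lemma hpoly_convolution:
  assumes u: "u > 0"
  shows "(LBINT y. poly (hpoly k (s + u)) (x + y) * gauss u y) = poly (hpoly k s) x"
proof (induction k rule: induct_nat_012)
  case 0
  then show ?case using u by simp
next
  case 1
  then show ?case using integrable_gauss_power[OF u, of 1] u integral_gauss_id[OF u]
    by (simp add: algebra_simps)
next
  case (ge2 k)
  define T where "T = s + u"
  define p where "p = (\<lambda>j. pcompose (hpoly j T) [:x, 1:])"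
  have p: "poly (hpoly j T) (x + y) = poly (p j) y" for j y
    by (simp add: p_def poly_pcompose)
  have dp: "pderiv (p (Suc k)) = smult (real (Suc k)) (p k)"
    unfolding p_def pderiv_pcompose pderiv_hpoly by (simp add: pderiv_pCons pcompose_smult)
  have i: "integrable lborel (\<lambda>y. poly (p j) y * gauss u y)" for j by (rule integrable_gauss_poly[OF u])
  have i': "integrable lborel (\<lambda>y. y * poly (p j) y * gauss u y)" for j
    using integrable_gauss_poly[OF u, of "[:0,1:] * p j"] by simp
  have e: "poly (hpoly (Suc (Suc k)) T) (x + y) = (x + y) * poly (p (Suc k)) y - real (Suc k) * T * poly (p k) y" for y
    unfolding poly_hpoly_Suc_Suc unfolding p ..
  have "(LBINT y. poly (hpoly (Suc (Suc k)) T) (x + y) * gauss u y) =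
    (LBINT y. x * (poly (p (Suc k)) y * gauss u y) + y * poly (p (Suc k)) y * gauss u y - real (Suc k) * T * (poly (p k) y * gauss u y))"
    by (rule Bochner_Integration.integral_cong) (simp_all only: e, simp add: algebra_simps)
  also have "\<dots> = x * (LBINT y. poly (p (Suc k)) y * gauss u y) + (LBINT y. y * poly (p (Suc k)) y * gauss u y)
     - real (Suc k) * T * (LBINT y. poly (p k) y * gauss u y)"
    using i i' by simp
  also have "(LBINT y. y * poly (p (Suc k)) y * gauss u y) = u * real (Suc k) * (LBINT y. poly (p k) y * gauss u y)"
    unfolding gauss_stein[OF u] dp by (simp add: mult.assoc del: of_nat_Suc)
  \<comment> \<open>Integration by parts contributes u and the recursion subtracts T = s + u, so
    exactly the time s is left in the recursion.\<close>
  also have "x * (LBINT y. poly (p (Suc k)) y * gauss u y) + u * real (Suc k) * (LBINT y. poly (p k) y * gauss u y)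
     - real (Suc k) * T * (LBINT y. poly (p k) y * gauss u y) = poly (hpoly (Suc (Suc k)) s) x"
    using ge2 unfolding T_def[symmetric] p by (simp add: T_def algebra_simps)
  finally show ?case unfolding T_def .
qed

text \<open>Since H_(j+1) = x H_j - t H_j', raising the index is t times the adjoint of d/dx in the
  Gaussian inner product. The derivative thus moves onto H_k and lowers both indices, down to j = 0,
  where the integral is the value of H_k at the origin at time 0.\<close>

lemma hpoly_orthogonal:
  assumes t: "t > 0"
  shows "(LBINT x. poly (hpoly j t) x * poly (hpoly k t) x * gauss t x) = (if j = k then fact k * t ^ k else 0)"
proof (induction j arbitrary: k)
  case 0
  have "(LBINT y. poly (hpoly k (0 + t)) (0 + y) * gauss t y) = poly (hpoly k 0) 0"
    by (rule hpoly_convolution[OF t])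
  moreover have "poly (hpoly k 0) 0 = (if k = 0 then 1 else 0)"
    by (cases "(k, 0::real)" rule: hpoly.cases) auto
  ultimately show ?case by auto
next
  case (Suc j)
  have i: "integrable lborel (\<lambda>x. poly (hpoly m t) x * poly (hpoly l t) x * gauss t x)" for m l
    using integrable_gauss_poly[OF t, of "hpoly m t * hpoly l t"] by simp
  have Suc_eq: "poly (hpoly (Suc j) t) x = x * poly (hpoly j t) x - t * poly (pderiv (hpoly j t)) x" for x
    by (cases j) (auto simp: pderiv_hpoly one_pCons pderiv_pCons simp del: of_nat_Suc)
  define p where "p = hpoly j t"
  define q where "q = hpoly k t"
  have "(LBINT x. poly (hpoly (Suc j) t) x * poly q x * gauss t x)
     = (LBINT x. x * poly (p * q) x * gauss t x - t * (poly (pderiv p * q) x * gauss t x))"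
    unfolding Suc_eq p_def[symmetric] by (rule Bochner_Integration.integral_cong) (auto simp: algebra_simps)
  also have "\<dots> = (LBINT x. x * poly (p * q) x * gauss t x) - t * (LBINT x. poly (pderiv p * q) x * gauss t x)"
    using integrable_gauss_poly[OF t, of "[:0,1:] * (p * q)"] integrable_gauss_poly[OF t, of "pderiv p * q"]
    by simp
  also have "\<dots> = t * ((LBINT x. poly (pderiv p * q) x * gauss t x + poly (p * pderiv q) x * gauss t x) - (LBINT x. poly (pderiv p * q) x * gauss t x))"
    unfolding gauss_stein[OF t] by (simp add: pderiv_mult algebra_simps)
  also have "\<dots> = t * (LBINT x. poly (p * pderiv q) x * gauss t x)"
    using integrable_gauss_poly[OF t, of "p * pderiv q"] integrable_gauss_poly[OF t, of "pderiv p * q"] by simp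
  also have "\<dots> = (if Suc j = k then fact k * t ^ k else 0)"
  proof (cases k)
    case 0 then show ?thesis by (simp add: q_def)
  next
    case (Suc l)
    have eq: "t * (LBINT x. poly (p * pderiv q) x * gauss t x) = t * real (Suc l) * (LBINT x. poly (hpoly j t) x * poly (hpoly l t) x * gauss t x)"
      unfolding q_def Suc pderiv_hpoly p_def by (simp add: mult_ac del: of_nat_Suc)
    show ?thesis unfolding eq Suc.IH by (simp add: Suc del: of_nat_Suc)
  qed
  finally show ?case unfolding q_def .
qed

text \<open>The joint density of W_s and W_t, factored the other way round by completing the square
  in x. The normalising constants agree because s (t - s) is t times the bridge variance.\<close>

lemma gauss_bridge:
  assumes "0 < s" "s < t"
  shows "gauss s x * gauss (t - s) (w - x) = gauss t w * gauss (s * (t - s) / t) (x - s / t * w)"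
proof -
  have pos: "0 < s * (t - s) / t" "0 < t" "0 < t - s" using assms by auto
  have "- x\<^sup>2 / (2 * s) + - (w - x)\<^sup>2 / (2 * (t - s)) = - w\<^sup>2 / (2 * t) + - (x - s / t * w)\<^sup>2 / (2 * (s * (t - s) / t))"
    using assms by (simp add: divide_simps) (simp add: algebra_simps power2_eq_square)
  moreover have "sqrt (2 * pi * s) * sqrt (2 * pi * (t - s)) = sqrt (2 * pi * t) * sqrt (2 * pi * (s * (t - s) / t))"
    using assms by (simp add: real_sqrt_mult[symmetric] )
  ultimately show ?thesis
    unfolding gauss_eq[OF pos(1)] gauss_eq[OF pos(2)] gauss_eq[OF pos(3)] gauss_eq[OF assms(1)]
    by (simp add: exp_add[symmetric] del: real_sqrt_mult)
qed

text \<open>Conditioning \<open>W\<^sub>s\<close> on \<open>W\<^sub>t = w\<close> leaves a Gaussian with mean \<open>s w / t\<close> and variance \<open>s (t - s) / t\<close>.\<close>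

lemma hpoly_bridge:
  assumes st: "0 < s" "s < t"
  shows "(LBINT x. poly (hpoly k s) x * (gauss s x * gauss (t - s) (w - x))) = (s / t) ^ k * poly (hpoly k t) w * gauss t w"
proof -
  define u where "u = s * (t - s) / t"
  define a where "a = s / t * w"
  have u: "u > 0" using st by (simp add: u_def)
  have "(LBINT x. poly (hpoly k s) x * (gauss s x * gauss (t - s) (w - x))) =
    gauss t w * (LBINT x. poly (hpoly k s) x * gauss u (x - a))"
    unfolding gauss_bridge[OF st] u_def[symmetric] a_def[symmetric]
    by (subst integral_mult_right_zero[symmetric]) (simp add: mult_ac)
  also have "(LBINT x. poly (hpoly k s) x * gauss u (x - a)) = (LBINT x. poly (hpoly k ((s - u) + u)) (a + x) * gauss u x)"
    using lborel_integral_real_affine[of 1 "\<lambda>x. poly (hpoly k s) x * gauss u (x - a)" a] by simp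
  also have "\<dots> = poly (hpoly k (s - u)) a" by (rule hpoly_convolution[OF u])
  \<comment> \<open>Averaging with variance u lowers the time from s to s - u. This is again s / t
    squared times t, so that time and space are both scaled as homogeneity requires.\<close>
  also have "s - u = (s / t)\<^sup>2 * t" using st by (simp add: u_def field_simps power2_eq_square)
  finally show ?thesis unfolding a_def hpoly_scale by (simp add: mult_ac)
qed

lemma integral_gauss_scale:
  fixes \<phi> :: "real \<Rightarrow> real"
  assumes "t > 0"
  shows "(LBINT y. \<phi> y * gauss t y) = (LBINT z. \<phi> (sqrt t * z) * gauss 1 z)"
proof -
  have "sqrt t * gauss t (sqrt t * z) = gauss 1 z" for z
    unfolding gauss_eq[OF assms] gauss_eq[OF zero_less_one]
    using assms by (simp add: real_sqrt_mult power_mult_distrib)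
  then have eq: "\<phi> (sqrt t * z) * gauss 1 z = sqrt t * (\<phi> (sqrt t * z) * gauss t (sqrt t * z))" for z
    by (metis mult.left_commute)
  show ?thesis
    unfolding eq using lborel_integral_real_affine[of "sqrt t" "\<lambda>y. \<phi> y * gauss t y" 0] assms by simp
qed

section \<open>Regularity of Gaussian convolutions\<close>

lemma gauss_kernel_has_derivative_x:
  assumes "u > 0"
  shows "((\<lambda>x. gauss u (w - x)) has_real_derivative (w - x) / u * gauss u (w - x)) (at x within S)"
    and "((\<lambda>x. (w - x) / u * gauss u (w - x)) has_real_derivative ((w - x)\<^sup>2 / u\<^sup>2 - 1 / u) * gauss u (w - x)) (at x within S)"
proof -
  define r where "r = sqrt (2 * pi * u)"
  define g where "g = (\<lambda>x. gauss u (w - x))"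
  have g: "g = (\<lambda>x. exp (- (w - x)\<^sup>2 / (2 * u)) / r)" by (simp add: g_def gauss_eq[OF assms] r_def)
  have r: "r > 0" using assms by (simp add: r_def)
  have d: "(g has_real_derivative (w - x) / u * g x) (at x within S)"
    unfolding g using assms r by (auto intro!: derivative_eq_intros simp: divide_simps) (simp add: algebra_simps)
  then show "((\<lambda>x. gauss u (w - x)) has_real_derivative (w - x) / u * gauss u (w - x)) (at x within S)"
    by (simp add: g_def)
  have "((\<lambda>x. (w - x) / u * g x) has_real_derivative ((w - x)\<^sup>2 / u\<^sup>2 - 1 / u) * g x) (at x within S)"
    using assms by (auto intro!: derivative_eq_intros d simp: field_simps power2_eq_square)
  then show "((\<lambda>x. (w - x) / u * gauss u (w - x)) has_real_derivative ((w - x)\<^sup>2 / u\<^sup>2 - 1 / u) * gauss u (w - x)) (at x within S)"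
    by (simp add: g_def)
qed

text \<open>Minus half the second x-derivative of the kernel: as a function of its starting point
  (s, x) it solves the backward heat equation. The explicit formula requires positive variance,
  hence the detour through equality near s.\<close>

lemma gauss_kernel_has_derivative_t:
  assumes "s < T"
  shows "((\<lambda>s. gauss (T - s) y) has_real_derivative - (1/2) * (y\<^sup>2 / (T - s)\<^sup>2 - 1 / (T - s)) * gauss (T - s) y) (at s)"
proof -
  define u where "u = T - s"
  define E where "E = exp (- y\<^sup>2 / (2 * u))"
  define r where "r = sqrt (2 * pi * u)"
  have "u > 0" using assms by (simp add: u_def)
  moreover have "2 * pi * u > 0" using \<open>u > 0\<close> by (intro mult_pos_pos) auto
  ultimately have u: "u > 0" "r > 0" "r * r = 2 * pi * u"
    by (simp_all only: r_def real_sqrt_mult_self abs_of_pos real_sqrt_gt_zero)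
  have "((\<lambda>u. exp (- y\<^sup>2 / (2 * u)) / sqrt (2 * pi * u)) has_real_derivative
      (E * (y\<^sup>2 / (2 * u\<^sup>2)) * r - E * (pi / r)) / (r * r)) (at u)"
    using u(1,2) unfolding E_def r_def
    by (auto intro!: derivative_eq_intros simp: power2_eq_square divide_simps mult_less_0_iff)
  moreover have "(E * (y\<^sup>2 / (2 * u\<^sup>2)) * r - E * (pi / r)) / (r * r) = (1/2) * (y\<^sup>2 / u\<^sup>2 - 1 / u) * (E / r)"
  proof -
    have "(E * (y\<^sup>2 / (2 * u\<^sup>2)) * r - E * (pi / r)) / (r * r) = E / r * (y\<^sup>2 / (2 * u\<^sup>2) - pi / (r * r))"
      using u(2) by (simp add: field_simps)
    also have "\<dots> = (1/2) * (y\<^sup>2 / u\<^sup>2 - 1 / u) * (E / r)" unfolding u(3) using u(1,2) by (simp add: field_simps)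
    finally show ?thesis .
  qed
  ultimately have "((\<lambda>u. exp (- y\<^sup>2 / (2 * u)) / sqrt (2 * pi * u)) has_real_derivative (1/2) * (y\<^sup>2 / u\<^sup>2 - 1 / u) * (E / r)) (at u)"
    by simp
  note d = this[unfolded u_def]
  have "((\<lambda>s. T - s) has_real_derivative -1) (at s)" by (auto intro!: derivative_eq_intros)
  note DERIV_chain2[where f="\<lambda>u. exp (- y\<^sup>2 / (2 * u)) / sqrt (2 * pi * u)", OF d this]
  then have "((\<lambda>s. exp (- y\<^sup>2 / (2 * (T - s))) / sqrt (2 * pi * (T - s))) has_real_derivative
     - (1/2) * (y\<^sup>2 / (T - s)\<^sup>2 - 1 / (T - s)) * (exp (- y\<^sup>2 / (2 * (T - s))) / sqrt (2 * pi * (T - s)))) (at s)"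
    by (simp only: E_def r_def u_def mult_minus_right mult_minus_left mult_1_right)
  then have "((\<lambda>s. exp (- y\<^sup>2 / (2 * (T - s))) / sqrt (2 * pi * (T - s))) has_real_derivative
     - (1/2) * (y\<^sup>2 / (T - s)\<^sup>2 - 1 / (T - s)) * gauss (T - s) y) (at s)"
    using assms by (subst gauss_eq) auto
  then show ?thesis
  proof (rule DERIV_cong_ev[OF refl _ refl, THEN iffD1, rotated])
    have "\<forall>\<^sub>F s' in nhds s. s' < T" using assms by (rule eventually_nhds_in_open[of "{..<T}" s, simplified])
    then show "\<forall>\<^sub>F s' in nhds s. exp (- y\<^sup>2 / (2 * (T - s'))) / sqrt (2 * pi * (T - s')) = gauss (T - s') y"
      by eventually_elim (subst gauss_eq, auto)
  qed
qed

text \<open>The weight \<open>gauss T\<close> is the one against which \<open>h T\<close> is known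
  to be integrable, so it has to dominate the kernel and its derivatives uniformly on a box. This
  succeeds because the variance T - s stays at most T - a < T, and the strictly faster decay leaves
  room for a quadratic factor and a bounded shift.\<close>

lemma gauss_kernel_bound:
  assumes a: "0 < a" "a \<le> b" "b < T"
  shows "\<exists>K>0. \<forall>s\<in>{a..b}. \<forall>x\<in>{-R..R}. \<forall>w. (1 + (w - x)\<^sup>2) * gauss (T - s) (w - x) \<le> K * gauss T w"
proof -
  define A where "A = T - a"
  \<comment> \<open>An intermediate variance splits the surplus decay: the gap between A and B
    absorbs the factor 1 + y^2, the gap between B and T absorbs the shift by x.\<close>
  define B where "B = (A + T) / 2"
  define c where "c = 1 / (2 * A) - 1 / (2 * B)"
  have AB: "0 < A" "A < B" "B < T" using a by (auto simp: A_def B_def)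
  have c: "c > 0" using AB by (simp add: c_def frac_less2)
  define K where "K = (1 + 1 / c) * (exp (R\<^sup>2 / (2 * (T - B))) / sqrt (2 * pi * (T - b)))"
  have "(1 + (w - x)\<^sup>2) * gauss (T - s) (w - x) \<le> K * sqrt (2 * pi * T) * gauss T w"
    if s: "s \<in> {a..b}" and x: "x \<in> {-R..R}" for s x w
  proof -
    define y where "y = w - x"
    have s': "0 < T - s" "T - b \<le> T - s" "T - s \<le> A" using s a by (auto simp: A_def)
    have "gauss (T - s) y \<le> exp (- y\<^sup>2 / (2 * A)) / sqrt (2 * pi * (T - b))"
      unfolding gauss_eq[OF s'(1)] using s' a AB
      by (intro frac_le) (auto simp: frac_le)
    also have "- y\<^sup>2 / (2 * A) = - c * y\<^sup>2 + - y\<^sup>2 / (2 * B)"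
      using AB by (simp add: c_def field_simps)
    finally have 1: "gauss (T - s) y \<le> exp (- c * y\<^sup>2) * exp (- y\<^sup>2 / (2 * B)) / sqrt (2 * pi * (T - b))"
      by (simp add: mult_exp_exp)
    have 2: "(1 + y\<^sup>2) * exp (- c * y\<^sup>2) \<le> 1 + 1 / c"
    proof -
      have "1 + c * y\<^sup>2 \<le> exp (c * y\<^sup>2)" by (rule exp_ge_add_one_self)
      then have "c * y\<^sup>2 \<le> exp (c * y\<^sup>2)" by linarith
      then have "y\<^sup>2 \<le> exp (c * y\<^sup>2) / c" using c by (simp add: field_simps)
      moreover have "1 \<le> exp (c * y\<^sup>2)" using c by simp
      ultimately have "1 + y\<^sup>2 \<le> exp (c * y\<^sup>2) + exp (c * y\<^sup>2) / c" by linarith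
      then have "1 + y\<^sup>2 \<le> (1 + 1 / c) * exp (c * y\<^sup>2)" by (simp add: algebra_simps)
      then show ?thesis by (simp add: exp_minus divide_simps)
    qed
    have 3: "exp (- y\<^sup>2 / (2 * B)) \<le> exp (R\<^sup>2 / (2 * (T - B))) * exp (- w\<^sup>2 / (2 * T))"
    proof -
      \<comment> \<open>This square expresses that the maximum over w of w^2 / T - (w - x)^2 / B is
        x^2 / (T - B), attained at w = x T / (T - B).\<close>
      have "0 \<le> (w * (T - B) - x * T)\<^sup>2 / (B * T * (T - B))" using AB by simp
      also have "\<dots> = y\<^sup>2 / B - w\<^sup>2 / T + x\<^sup>2 / (T - B)"
        using AB by (simp add: y_def divide_simps) (simp add: algebra_simps power2_eq_square)
      also have "\<dots> \<le> y\<^sup>2 / B - w\<^sup>2 / T + R\<^sup>2 / (T - B)"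
        using AB x by (intro add_left_mono divide_right_mono) (auto simp: abs_le_square_iff[symmetric])
      finally have "- y\<^sup>2 / (2 * B) \<le> R\<^sup>2 / (2 * (T - B)) + - w\<^sup>2 / (2 * T)" using AB by (simp add: field_simps)
      then show ?thesis by (simp add: exp_add[symmetric])
    qed
    have "(1 + y\<^sup>2) * gauss (T - s) y \<le> (1 + y\<^sup>2) * (exp (- c * y\<^sup>2) * exp (- y\<^sup>2 / (2 * B)) / sqrt (2 * pi * (T - b)))"
      using 1 by (intro mult_left_mono) auto
    also have "\<dots> = ((1 + y\<^sup>2) * exp (- c * y\<^sup>2)) * (exp (- y\<^sup>2 / (2 * B)) / sqrt (2 * pi * (T - b)))" by simp
    also have "\<dots> \<le> (1 + 1 / c) * (exp (R\<^sup>2 / (2 * (T - B))) * exp (- w\<^sup>2 / (2 * T)) / sqrt (2 * pi * (T - b)))"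
      using 2 3 c a by (intro mult_mono divide_right_mono) auto
    also have "\<dots> = K * exp (- w\<^sup>2 / (2 * T))" by (simp add: K_def)
    also have "\<dots> = K * sqrt (2 * pi * T) * gauss T w" using AB by (simp add: gauss_eq)
    finally show ?thesis by (simp add: y_def)
  qed
  moreover have "0 < K * sqrt (2 * pi * T)" using c a unfolding K_def by (intro mult_pos_pos divide_pos_pos add_pos_pos) auto
  ultimately show ?thesis by blast
qed

text \<open>One constant bounds the kernel, its x-derivative and the parabolic Taylor remainder. The
  remainder is split into a move in time at fixed x' and a move in space at fixed s; the time
  derivative is of the size of a second space derivative, so a first-order term in time already
  belongs to the error.\<close>

lemma gauss_kernel_expansion:
  assumes a: "0 < a" "a \<le> b" "b < T"
  shows "\<exists>K>0. \<forall>s\<in>{a..b}. \<forall>x\<in>{-R..R}. \<forall>w.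
     \<bar>(w - x) / (T - s) * gauss (T - s) (w - x)\<bar> \<le> K * gauss T w \<and> gauss (T - s) (w - x) \<le> K * gauss T w \<and>
     (\<forall>s'\<in>{a..b}. \<forall>x'\<in>{-R..R}. \<bar>gauss (T - s') (w - x') - gauss (T - s) (w - x) - (w - x) / (T - s) * gauss (T - s) (w - x) * (x' - x)\<bar>
       \<le> K * gauss T w * (\<bar>s' - s\<bar> + (x' - x)\<^sup>2))"
proof -
  obtain K where K: "K > 0" "\<And>s x w. s\<in>{a..b} \<Longrightarrow> x\<in>{-R..R} \<Longrightarrow> (1 + (w - x)\<^sup>2) * gauss (T - s) (w - x) \<le> K * gauss T w"
    using gauss_kernel_bound[OF a, of R] by blast
  \<comment> \<open>With the cap at 1, the single quantity 1 / m^2 bounds both 1 / (T - s) and its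
    square.\<close>
  define m where "m = min 1 (T - b)"
  have m: "0 < m" "m \<le> 1" using a by (auto simp: m_def)
  define L where "L = 2 / m\<^sup>2 * K"
  have L: "L > 0" using K m by (simp add: L_def)
  have ms: "m \<le> T - s" if "s \<in> {a..b}" for s using that by (auto simp: m_def)
  have im: "1 / (T - s) \<le> 1 / m\<^sup>2" "1 / (T - s)\<^sup>2 \<le> 1 / m\<^sup>2" if "s \<in> {a..b}" for s
  proof -
    have "m\<^sup>2 \<le> m * 1" unfolding power2_eq_square using m by (intro mult_left_mono) auto
    then show "1 / (T - s) \<le> 1 / m\<^sup>2" using m ms[OF that] by (intro frac_le) auto
    show "1 / (T - s)\<^sup>2 \<le> 1 / m\<^sup>2" using m ms[OF that] by (intro frac_le power_mono) auto
  qed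
  have B: "\<bar>c * gauss (T - s) (w - x)\<bar> \<le> L * gauss T w"
    if s: "s \<in> {a..b}" and x: "x \<in> {-R..R}" and c: "\<bar>c\<bar> \<le> 2 / m\<^sup>2 * (1 + (w - x)\<^sup>2)" for s x w c
  proof -
    have "\<bar>c * gauss (T - s) (w - x)\<bar> \<le> 2 / m\<^sup>2 * (1 + (w - x)\<^sup>2) * gauss (T - s) (w - x)"
      using mult_right_mono[OF c, of "gauss (T - s) (w - x)"] by (simp add: abs_mult)
    also have "\<dots> \<le> 2 / m\<^sup>2 * (K * gauss T w)" 
      unfolding mult.assoc using K(2)[OF s x, of w] m by (intro mult_left_mono) auto
    finally show ?thesis by (simp add: L_def)
  qed
  have c2: "\<bar>(w - x)\<^sup>2 / (T - s)\<^sup>2 - 1 / (T - s)\<bar> \<le> 2 / m\<^sup>2 * (1 + (w - x)\<^sup>2)" if "s \<in> {a..b}" for w x s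
  proof -
    have "\<bar>(w - x)\<^sup>2 / (T - s)\<^sup>2 - 1 / (T - s)\<bar> \<le> (w - x)\<^sup>2 * (1 / (T - s)\<^sup>2) + 1 / (T - s)"
      using that a by (intro abs_triangle_ineq4[THEN order_trans]) (simp)
    also have "\<dots> \<le> (w - x)\<^sup>2 * (1 / m\<^sup>2) + 1 / m\<^sup>2"
      using im[OF that] by (intro add_mono mult_left_mono) auto
    also have "\<dots> \<le> 2 / m\<^sup>2 * (1 + (w - x)\<^sup>2)" using m by (simp add: field_simps)
    finally show ?thesis .
  qed
  have c1: "\<bar>(w - x) / (T - s)\<bar> \<le> 2 / m\<^sup>2 * (1 + (w - x)\<^sup>2)" if s: "s \<in> {a..b}" for w x s
  proof -
    have "2 * \<bar>w - x\<bar> \<le> 1 + (w - x)\<^sup>2" using sum_squares_bound[of 1 "\<bar>w - x\<bar>"] by simp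
    moreover have "\<bar>w - x\<bar> \<le> 2 * \<bar>w - x\<bar>" by simp
    ultimately have "\<bar>w - x\<bar> \<le> 1 + (w - x)\<^sup>2" by (rule order_trans[rotated])
    then have "\<bar>w - x\<bar> * (1 / (T - s)) \<le> (1 + (w - x)\<^sup>2) * (1 / m\<^sup>2)"
      using im[OF s] s a by (intro mult_mono) auto
    also have "\<dots> \<le> 2 / m\<^sup>2 * (1 + (w - x)\<^sup>2)" using m by (simp add: field_simps)
    finally show ?thesis using s a by simp
  qed
  have c0: "\<bar>1\<bar> \<le> 2 / m\<^sup>2 * (1 + (w - x)\<^sup>2)" for w x
  proof -
    have "1 * 1 \<le> 2 / m\<^sup>2 * (1 + (w - x)\<^sup>2)"
      using m power_le_one[of m 2] by (intro mult_mono) (auto simp: field_simps)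
    then show ?thesis by simp
  qed
  have "\<bar>gauss (T - s') (w - x') - gauss (T - s) (w - x) - (w - x) / (T - s) * gauss (T - s) (w - x) * (x' - x)\<bar>
       \<le> L * gauss T w * (\<bar>s' - s\<bar> + (x' - x)\<^sup>2)"
    if s: "s \<in> {a..b}" and x: "x \<in> {-R..R}" and s': "s' \<in> {a..b}" and x': "x' \<in> {-R..R}" for s x s' x' w
  proof -
    define G where "G = L * gauss T w"
    have G: "G \<ge> 0" using L by (simp add: G_def)
    have 1: "\<bar>gauss (T - s') (w - x') - gauss (T - s) (w - x')\<bar> \<le> G * \<bar>s' - s\<bar>"
    proof -
      have "norm (gauss (T - s') (w - x') - gauss (T - s) (w - x')) \<le> G * norm (s' - s)"
      proof (rule field_differentiable_bound[of "{a..b}"])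
        fix z assume z: "z \<in> {a..b}"
        show "((\<lambda>s. gauss (T - s) (w - x')) has_real_derivative
            - (1/2) * ((w - x')\<^sup>2 / (T - z)\<^sup>2 - 1 / (T - z)) * gauss (T - z) (w - x')) (at z within {a..b})"
          by (rule has_field_derivative_at_within[OF gauss_kernel_has_derivative_t]) (use z a in auto)
        have "\<bar>- (1/2) * ((w - x')\<^sup>2 / (T - z)\<^sup>2 - 1 / (T - z))\<bar> \<le> 2 / m\<^sup>2 * (1 + (w - x')\<^sup>2)"
          using c2[OF z, of w x'] by (rule order_trans[rotated]) simp
        then show "norm (- (1/2) * ((w - x')\<^sup>2 / (T - z)\<^sup>2 - 1 / (T - z)) * gauss (T - z) (w - x')) \<le> G"
          unfolding G_def real_norm_def by (rule B[OF z x'])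
      qed (use s s' in auto)
      then show ?thesis by simp
    qed
    define \<phi> where "\<phi> = (\<lambda>z. (w - z) / (T - s) * gauss (T - s) (w - z))"
    have Ts: "T - s > 0" using s a by auto
    have 2: "\<bar>\<phi> z - \<phi> x\<bar> \<le> G * \<bar>z - x\<bar>" if z: "z \<in> {-R..R}" for z
    proof -
      have "norm (\<phi> z - \<phi> x) \<le> G * norm (z - x)"
      proof (rule field_differentiable_bound[of "{-R..R}"])
        fix z assume z: "z \<in> {-R..R}"
        show "(\<phi> has_real_derivative ((w - z)\<^sup>2 / (T - s)\<^sup>2 - 1 / (T - s)) * gauss (T - s) (w - z)) (at z within {-R..R})"
          unfolding \<phi>_def by (rule gauss_kernel_has_derivative_x(2)[OF Ts])
        show "norm (((w - z)\<^sup>2 / (T - s)\<^sup>2 - 1 / (T - s)) * gauss (T - s) (w - z)) \<le> G"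
          unfolding G_def real_norm_def by (rule B[OF s z c2[OF s]])
      qed (use x z in auto)
      then show ?thesis by simp
    qed
    have 3: "\<bar>gauss (T - s) (w - x') - gauss (T - s) (w - x) - \<phi> x * (x' - x)\<bar> \<le> G * (x' - x)\<^sup>2"
    proof -
      have sub: "closed_segment x x' \<subseteq> {-R..R}" using x x' by (auto simp: closed_segment_eq_real_ivl split: if_splits)
      \<comment> \<open>The mean value inequality is applied to the kernel minus its tangent line.
        Its derivative is at most G * |x' - x| on the segment, which yields the square in the
        error.\<close>
      have "norm ((gauss (T - s) (w - x') - \<phi> x * x') - (gauss (T - s) (w - x) - \<phi> x * x)) \<le> (G * \<bar>x' - x\<bar>) * norm (x' - x)"
      proof (rule field_differentiable_bound[of "closed_segment x x'" "\<lambda>z. gauss (T - s) (w - z) - \<phi> x * z" "\<lambda>z. \<phi> z - \<phi> x"])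
        fix z assume z: "z \<in> closed_segment x x'"
        show "((\<lambda>z. gauss (T - s) (w - z) - \<phi> x * z) has_real_derivative \<phi> z - \<phi> x) (at z within closed_segment x x')"
          unfolding \<phi>_def
          by (rule derivative_eq_intros gauss_kernel_has_derivative_x(1)[OF Ts] refl)+ simp
        have "\<bar>z - x\<bar> \<le> \<bar>x' - x\<bar>" using z by (auto simp: closed_segment_eq_real_ivl split: if_splits)
        then have "G * \<bar>z - x\<bar> \<le> G * \<bar>x' - x\<bar>" using G by (intro mult_left_mono)
        then show "norm (\<phi> z - \<phi> x) \<le> G * \<bar>x' - x\<bar>" using 2[of z] z sub by auto
      qed auto
      then show ?thesis by (simp add: algebra_simps power2_eq_square abs_mult[symmetric])
    qed
    have "\<bar>gauss (T - s') (w - x') - gauss (T - s) (w - x) - \<phi> x * (x' - x)\<bar> \<le> G * \<bar>s' - s\<bar> + G * (x' - x)\<^sup>2"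
      using 1 3 by linarith
    then show ?thesis unfolding \<phi>_def G_def by (simp add: algebra_simps)
  qed
  moreover have "gauss (T - s) (w - x) \<le> L * gauss T w" if "s \<in> {a..b}" "x \<in> {-R..R}" for s x w
    using B[OF that c0, of w] by auto
  ultimately show ?thesis using L B[OF _ _ c1] by blast
qed

text \<open>The regularity that quadratic variation detects: time steps and squared space steps are
  of the same order along a Brownian path, so no time derivative needs to be named. Constants are
  uniform on boxes away from t = 0, since a continuous path over a compact time interval stays in
  such a box. The times t and t' may come in either order.\<close>

definition x_expansion :: "(real \<Rightarrow> real \<Rightarrow> real) \<Rightarrow> (real \<Rightarrow> real \<Rightarrow> real) \<Rightarrow> bool" where
  "x_expansion h h' \<longleftrightarrow> continuous_on ({0<..} \<times> UNIV) (\<lambda>(t, x). h' t x) \<and>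
     (\<forall>a b R. 0 < a \<and> a \<le> b \<longrightarrow> (\<exists>K>0. \<forall>t\<in>{a..b}. \<forall>t'\<in>{a..b}. \<forall>x\<in>{-R..R}. \<forall>x'\<in>{-R..R}.
        \<bar>h t' x' - h t x - h' t x * (x' - x)\<bar> \<le> K * (\<bar>t' - t\<bar> + (x' - x)\<^sup>2)))"

lemma x_expansionD:
  assumes "x_expansion h h'" "0 < a" "a \<le> b"
  obtains K where "K > 0" "\<And>t t' x x'. t\<in>{a..b} \<Longrightarrow> t'\<in>{a..b} \<Longrightarrow> x\<in>{-R..R} \<Longrightarrow> x'\<in>{-R..R} \<Longrightarrow>
      \<bar>h t' x' - h t x - h' t x * (x' - x)\<bar> \<le> K * (\<bar>t' - t\<bar> + (x' - x)\<^sup>2)"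
  using assms unfolding x_expansion_def by meson

lemma has_derivative_of_quadratic_error:
  fixes f :: "real \<Rightarrow> real"
  assumes K: "\<And>y. \<bar>y - x\<bar> \<le> 1 \<Longrightarrow> \<bar>f y - f x - d * (y - x)\<bar> \<le> K * (y - x)\<^sup>2"
  shows "(f has_real_derivative d) (at x)"
proof -
  have "((\<lambda>y. (f y - f x) / (y - x) - d) \<longlongrightarrow> 0) (at x)"
  proof (rule Lim_null_comparison)
    have "\<forall>\<^sub>F y in at x. dist y x < 1 \<and> y \<noteq> x" 
      by (auto simp: eventually_at intro!: exI[of _ 1])
    then show "\<forall>\<^sub>F y in at x. norm ((f y - f x) / (y - x) - d) \<le> K * \<bar>y - x\<bar>"
    proof eventually_elim
      case (elim y)
      then have "\<bar>f y - f x - d * (y - x)\<bar> \<le> (K * \<bar>y - x\<bar>) * \<bar>y - x\<bar>"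
        using K[of y] by (auto simp: dist_real_def power2_eq_square mult.assoc)
      then have "\<bar>f y - f x - d * (y - x)\<bar> / \<bar>y - x\<bar> \<le> K * \<bar>y - x\<bar>" using elim by (simp add: field_simps)
      also have "\<bar>f y - f x - d * (y - x)\<bar> / \<bar>y - x\<bar> = \<bar>(f y - f x) / (y - x) - d\<bar>"
        using elim unfolding abs_divide[symmetric] by (simp add: diff_divide_distrib)
      finally show ?case by simp
    qed
    show "((\<lambda>y. K * \<bar>y - x\<bar>) \<longlongrightarrow> 0) (at x)"
      by (auto intro!: tendsto_eq_intros)
  qed
  then show ?thesis
    unfolding has_field_derivative_iff using Lim_null by blast
qed

lemma x_expansion_has_derivative:
  assumes e: "x_expansion h h'" and t: "t > 0"
  shows "(h t has_real_derivative h' t x) (at x)"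
proof -
  obtain K where K: "K > 0" "\<And>s s' x' y. s\<in>{t..t} \<Longrightarrow> s'\<in>{t..t} \<Longrightarrow> x'\<in>{-(\<bar>x\<bar>+1)..\<bar>x\<bar>+1} \<Longrightarrow> y\<in>{-(\<bar>x\<bar>+1)..\<bar>x\<bar>+1} \<Longrightarrow>
      \<bar>h s' y - h s x' - h' s x' * (y - x')\<bar> \<le> K * (\<bar>s' - s\<bar> + (y - x')\<^sup>2)"
    using x_expansionD[OF e t, of t "\<bar>x\<bar>+1"] by auto
  show ?thesis
  proof (rule has_derivative_of_quadratic_error)
    fix y assume "\<bar>y - x\<bar> \<le> 1"
    then have "y \<in> {-(\<bar>x\<bar>+1)..\<bar>x\<bar>+1}" "x \<in> {-(\<bar>x\<bar>+1)..\<bar>x\<bar>+1}" by (auto simp: abs_if split: if_splits)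
    then show "\<bar>h t y - h t x - h' t x * (y - x)\<bar> \<le> K * (y - x)\<^sup>2" using K(2)[of t t x y] by auto
  qed
qed

text \<open>All derivatives fall on the Gaussian kernel under the integral sign.\<close>

lemma caloric_x_expansion:
  assumes m[measurable]: "\<And>t. t > 0 \<Longrightarrow> h t \<in> borel_measurable borel"
    and int: "\<And>t. t > 0 \<Longrightarrow> integrable lborel (\<lambda>w. h t w * gauss t w)"
    and conv: "\<And>s t x. 0 < s \<Longrightarrow> s < t \<Longrightarrow> h s x = (LBINT w. h t w * gauss (t - s) (w - x))"
  shows "x_expansion h (\<lambda>s x. deriv (h s) x)"
proof -
  have main: "(\<exists>K>0. \<forall>t\<in>{a..b}. \<forall>t'\<in>{a..b}. \<forall>x\<in>{-R..R}. \<forall>x'\<in>{-R..R}.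
        \<bar>h t' x' - h t x - D t x * (x' - x)\<bar> \<le> K * (\<bar>t' - t\<bar> + (x' - x)\<^sup>2)) \<and>
     continuous_on ({a..b} \<times> {-R..R}) (\<lambda>(t, x). D t x)"
    if ab: "0 < a" "a \<le> b" and D: "D = (\<lambda>s x. LBINT w. h (b + 1) w * ((w - x) / (b + 1 - s) * gauss (b + 1 - s) (w - x)))" for a b R D
  proof -
    \<comment> \<open>Any time beyond b would do: on the whole strip, h is an average of the single
      slice at time T. The apparent dependence of D on b is removed in \<open>eqD\<close>, where D
      is identified with the derivative.\<close>
    define T where "T = b + 1"
    have T: "0 < T" "b < T" using ab by (auto simp: T_def)
    note [measurable] = m[OF T(1)]
    obtain K where K: "K > 0" "\<And>s x w. s\<in>{a..b} \<Longrightarrow> x\<in>{-R..R} \<Longrightarrow> \<bar>(w - x) / (T - s) * gauss (T - s) (w - x)\<bar> \<le> K * gauss T w"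
      "\<And>s x w. s\<in>{a..b} \<Longrightarrow> x\<in>{-R..R} \<Longrightarrow> gauss (T - s) (w - x) \<le> K * gauss T w"
      "\<And>s x w s' x'. s\<in>{a..b} \<Longrightarrow> x\<in>{-R..R} \<Longrightarrow> s'\<in>{a..b} \<Longrightarrow> x'\<in>{-R..R} \<Longrightarrow>
        \<bar>gauss (T - s') (w - x') - gauss (T - s) (w - x) - (w - x) / (T - s) * gauss (T - s) (w - x) * (x' - x)\<bar>
       \<le> K * gauss T w * (\<bar>s' - s\<bar> + (x' - x)\<^sup>2)"
      using gauss_kernel_expansion[OF ab T(2), of R] by blast
    have iT: "integrable lborel (\<lambda>w. K * (\<bar>h T w\<bar> * gauss T w))"
      using integrable_abs[OF int[OF T(1)]] by (simp add: abs_mult)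
    have bnd: "\<bar>h T w * g\<bar> \<le> K * (\<bar>h T w\<bar> * gauss T w)" if "\<bar>g\<bar> \<le> K * gauss T w" for w g
      using mult_left_mono[OF that, of "\<bar>h T w\<bar>"] by (simp add: abs_mult mult_ac)
    have i1: "integrable lborel (\<lambda>w. h T w * gauss (T - s) (w - x))" if "s\<in>{a..b}" "x\<in>{-R..R}" for s x
      by (rule Bochner_Integration.integrable_bound[OF iT]) (use bnd K(3)[OF that] K(1) in auto)
    have i2: "integrable lborel (\<lambda>w. h T w * ((w - x) / (T - s) * gauss (T - s) (w - x)))" if "s\<in>{a..b}" "x\<in>{-R..R}" for s x
      by (rule Bochner_Integration.integrable_bound[OF iT]) (use bnd[OF K(2)[OF that]] K(1) in auto)
    define L where "L = (LBINT w. K * (\<bar>h T w\<bar> * gauss T w))"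
    have "\<bar>h t' x' - h t x - D t x * (x' - x)\<bar> \<le> (L + 1) * (\<bar>t' - t\<bar> + (x' - x)\<^sup>2)"
      if t: "t \<in> {a..b}" "t' \<in> {a..b}" and x: "x \<in> {-R..R}" "x' \<in> {-R..R}" for t t' x x'
    proof -
      have eq: "h t' x' - h t x - D t x * (x' - x) =
        (LBINT w. h T w * (gauss (T - t') (w - x') - gauss (T - t) (w - x) - (w - x) / (T - t) * gauss (T - t) (w - x) * (x' - x)))"
      proof -
        have "(LBINT w. h T w * (gauss (T - t') (w - x') - gauss (T - t) (w - x) - (w - x) / (T - t) * gauss (T - t) (w - x) * (x' - x)))
         = (LBINT w. h T w * gauss (T - t') (w - x') - h T w * gauss (T - t) (w - x) - h T w * ((w - x) / (T - t) * gauss (T - t) (w - x)) * (x' - x))"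
          by (rule Bochner_Integration.integral_cong) (auto simp: algebra_simps)
        also have "\<dots> = (LBINT w. h T w * gauss (T - t') (w - x')) - (LBINT w. h T w * gauss (T - t) (w - x)) - D t x * (x' - x)"
        proof -
          define F where "F = (\<lambda>w. h T w * ((w - x) / (T - t) * gauss (T - t) (w - x)))"
          have F: "integrable lborel F" "D t x = integral\<^sup>L lborel F"
            using i2[OF t(1) x(1)] by (simp_all only: F_def D T_def)
          show ?thesis
            unfolding F_def[symmetric, THEN fun_cong] F(2)
            using i1[OF t(1) x(1)] i1[OF t(2) x(2)] F(1) by simp
        qed
        also have "\<dots> = h t' x' - h t x - D t x * (x' - x)"
          using conv[of t T x] conv[of t' T x'] t ab T by auto
        finally show ?thesis by simp
      qed
      have "\<bar>h t' x' - h t x - D t x * (x' - x)\<bar> \<le> (LBINT w. \<bar>h T w * (gauss (T - t') (w - x') - gauss (T - t) (w - x) - (w - x) / (T - t) * gauss (T - t) (w - x) * (x' - x))\<bar>)"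
        unfolding eq by (rule integral_abs_bound)
      also have "\<dots> \<le> (LBINT w. K * (\<bar>h T w\<bar> * gauss T w) * (\<bar>t' - t\<bar> + (x' - x)\<^sup>2))"
      proof (rule integral_mono')
        show "integrable lborel (\<lambda>w. K * (\<bar>h T w\<bar> * gauss T w) * (\<bar>t' - t\<bar> + (x' - x)\<^sup>2))"
          using iT by (rule integrable_mult_left)
        show "\<bar>h T w * (gauss (T - t') (w - x') - gauss (T - t) (w - x) - (w - x) / (T - t) * gauss (T - t) (w - x) * (x' - x))\<bar>
          \<le> K * (\<bar>h T w\<bar> * gauss T w) * (\<bar>t' - t\<bar> + (x' - x)\<^sup>2)" for w
          using mult_left_mono[OF K(4)[OF t(1) x(1) t(2) x(2), of w], of "\<bar>h T w\<bar>"] by (simp add: abs_mult mult_ac)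
      qed (use K in auto)
      also have "\<dots> = L * (\<bar>t' - t\<bar> + (x' - x)\<^sup>2)" unfolding L_def by simp
      \<comment> \<open>L may vanish, whereas the constant in \<open>x_expansion\<close> has to be
        positive.\<close>
      also have "\<dots> \<le> (L + 1) * (\<bar>t' - t\<bar> + (x' - x)\<^sup>2)" by (intro mult_right_mono) auto
      finally show ?thesis .
    qed
    moreover have "L \<ge> 0" unfolding L_def using K by (intro Bochner_Integration.integral_nonneg) auto
    then have "L + 1 > 0" by simp
    moreover have "continuous_on ({a..b} \<times> {-R..R}) (\<lambda>(t, x). D t x)"
      unfolding continuous_on_sequentially
    proof (intro allI ballI impI)
      fix X and p assume p: "p \<in> {a..b} \<times> {-R..R}" and X: "(\<forall>n. X n \<in> {a..b} \<times> {-R..R}) \<and> X \<longlonglongrightarrow> p"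
      define s where "s = fst p"
      define x where "x = snd p"
      define S where "S = fst \<circ> X"
      define Y where "Y = snd \<circ> X"
      have lim: "S \<longlonglongrightarrow> s" "Y \<longlonglongrightarrow> x"
        using X tendsto_fst[of X p] tendsto_snd[of X p] by (auto simp: S_def Y_def s_def x_def comp_def)
      have in1: "S n \<in> {a..b}" "Y n \<in> {-R..R}" for n using X by (auto simp: S_def Y_def mem_Times_iff)
      have in2: "s \<in> {a..b}" "x \<in> {-R..R}" using p by (auto simp: s_def x_def mem_Times_iff)
      have pos: "T - s > 0" "\<And>n. T - S n > 0" using in1 in2 T by (auto) (smt (verit) atLeastAtMost_iff in1)
      have "(\<lambda>n. LBINT w. h T w * ((w - Y n) / (T - S n) * gauss (T - S n) (w - Y n))) \<longlonglongrightarrow>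
         (LBINT w. h T w * ((w - x) / (T - s) * gauss (T - s) (w - x)))"
      proof (rule integral_dominated_convergence[OF _ _ iT])
        show "AE w in lborel. (\<lambda>n. h T w * ((w - Y n) / (T - S n) * gauss (T - S n) (w - Y n))) \<longlonglongrightarrow>
            h T w * ((w - x) / (T - s) * gauss (T - s) (w - x))"
          unfolding gauss_eq[OF pos(1)] gauss_eq[OF pos(2)]
          by (intro AE_I2 tendsto_intros lim) (use pos in auto)
        show "AE w in lborel. norm (h T w * ((w - Y n) / (T - S n) * gauss (T - S n) (w - Y n))) \<le> K * (\<bar>h T w\<bar> * gauss T w)" for n
          using bnd[OF K(2)[OF in1]] by auto
      qed measurable
      then show "((\<lambda>(t, x). D t x) \<circ> X) \<longlonglongrightarrow> (case p of (t, x) \<Rightarrow> D t x)"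
        by (simp add: D T_def S_def Y_def s_def x_def comp_def case_prod_unfold)
    qed
    ultimately show ?thesis by blast
  qed
  have eqD: "deriv (h s) x = (LBINT w. h (b + 1) w * ((w - x) / (b + 1 - s) * gauss (b + 1 - s) (w - x)))"
    if s: "0 < s" "s \<le> b" for s x b
  proof -
    define D where D: "D = (\<lambda>s x. LBINT w. h (b + 1) w * ((w - x) / (b + 1 - s) * gauss (b + 1 - s) (w - x)))"
    obtain K where K: "K>0" "\<forall>t\<in>{s..b}. \<forall>t'\<in>{s..b}. \<forall>z\<in>{-(\<bar>x\<bar>+1)..\<bar>x\<bar>+1}. \<forall>x'\<in>{-(\<bar>x\<bar>+1)..\<bar>x\<bar>+1}.
        \<bar>h t' x' - h t z - D t z * (x' - z)\<bar> \<le> K * (\<bar>t' - t\<bar> + (x' - z)\<^sup>2)"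
      using main[OF s D] by blast
    have "(h s has_real_derivative D s x) (at x)"
    proof (rule has_derivative_of_quadratic_error)
      fix y assume "\<bar>y - x\<bar> \<le> 1"
      then have "y \<in> {-(\<bar>x\<bar>+1)..\<bar>x\<bar>+1}" "x \<in> {-(\<bar>x\<bar>+1)..\<bar>x\<bar>+1}" by (auto simp: abs_if split: if_splits)
      then have "\<bar>h s y - h s x - D s x * (y - x)\<bar> \<le> K * (\<bar>s - s\<bar> + (y - x)\<^sup>2)"
        using s by (intro K(2)[rule_format]) auto
      then show "\<bar>h s y - h s x - D s x * (y - x)\<bar> \<le> K * (y - x)\<^sup>2" by simp
    qed
    then show ?thesis unfolding D by (rule DERIV_imp_deriv)
  qed
  have "continuous_on ({0<..} \<times> UNIV) (\<lambda>(t, x). deriv (h t) x)"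
  proof (rule continuous_at_imp_continuous_on, rule ballI)
    fix p :: "real \<times> real" assume p: "p \<in> {0<..} \<times> UNIV"
    define a where "a = fst p / 2"
    define b where "b = fst p + 1"
    define R where "R = \<bar>snd p\<bar> + 1"
    have ab: "0 < a" "a \<le> b" using p by (auto simp: a_def b_def)
    have "continuous_on ({a..b} \<times> {-R..R}) (\<lambda>(t, x). deriv (h t) x)"
      using conjunct2[OF main[OF ab refl, of R]]
      by (rule continuous_on_cong[THEN iffD1, OF refl, rotated]) (use ab in \<open>auto simp: eqD[of _ b]\<close>)
    moreover have "p \<in> interior ({a..b} \<times> {-R..R})"
      using p by (auto simp: interior_Times a_def b_def R_def mem_Times_iff)
    ultimately show "isCont (\<lambda>(t, x). deriv (h t) x) p" by (rule continuous_on_interior)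
  qed
  moreover have "\<exists>K>0. \<forall>t\<in>{a..b}. \<forall>t'\<in>{a..b}. \<forall>x\<in>{-R..R}. \<forall>x'\<in>{-R..R}.
        \<bar>h t' x' - h t x - deriv (h t) x * (x' - x)\<bar> \<le> K * (\<bar>t' - t\<bar> + (x' - x)\<^sup>2)" if ab: "0 < a" "a \<le> b" for a b R
    using conjunct1[OF main[OF ab refl, of R]] ab by (simp add: eqD[of _ b])
  ultimately show ?thesis unfolding x_expansion_def by blast
qed

section \<open>Quadratic variation along partitions\<close>

lemma partition_of_mono:
  assumes "partition_of s t p k" "i \<le> j" "j \<le> k"
  shows "p i \<le> p j"
  using assms(2,3)
proof (induction j rule: dec_induct)
  case (step m)
  then have "p m < p (Suc m)" using assms(1) by (auto simp: partition_of_def)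
  then show ?case using step by simp
qed simp

lemma partition_of_range:
  assumes "partition_of s t p k" "i \<le> k"
  shows "p i \<in> {s..t}"
  using partition_of_mono[OF assms(1), of 0 i] partition_of_mono[OF assms(1), of i k] assms
  by (auto simp: partition_of_def)

lemma partition_of_sum:
  assumes "partition_of s t p k"
  shows "(\<Sum>i<k. p (Suc i) - p i) = t - s"
  using assms by (simp add: sum_lessThan_telescope partition_of_def)

lemma partition_of_less: "partition_of s t p k \<Longrightarrow> i < k \<Longrightarrow> p i < p (Suc i)"
  by (simp add: partition_of_def)

lemma partition_of_mesh: "i < k \<Longrightarrow> p (Suc i) - p i \<le> mesh p k"
  unfolding mesh_def by (intro Max_ge) auto

lemma partition_integral_split:
  fixes \<phi> :: "real \<Rightarrow> real"
  assumes p: "partition_of s t p k" and c: "continuous_on {s..t} \<phi>" and j: "j \<le> k"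
  shows "integral {s..p j} \<phi> = (\<Sum>i<j. integral {p i..p (Suc i)} \<phi>)"
  using j
proof (induction j)
  case 0
  then show ?case using p by (simp add: partition_of_def)
next
  case (Suc j)
  have r: "p j \<in> {s..t}" "p (Suc j) \<in> {s..t}" "p j < p (Suc j)"
    using partition_of_range[OF p, of j] partition_of_range[OF p, of "Suc j"] partition_of_less[OF p, of j] Suc by auto
  have "integral {s..p (Suc j)} \<phi> = integral {s..p j} \<phi> + integral {p j..p (Suc j)} \<phi>"
    using r by (intro Henstock_Kurzweil_Integration.integral_combine[symmetric] integrable_continuous_interval continuous_on_subset[OF c]) auto
  then show ?case using Suc by simp
qed

lemma riemann_sums_tendsto:
  fixes \<phi> :: "real \<Rightarrow> real"
  assumes c: "continuous_on {s..t} \<phi>"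
    and p: "\<And>m. partition_of s t (p m) (k m)" and mesh: "(\<lambda>m. mesh (p m) (k m)) \<longlonglongrightarrow> 0"
  shows "(\<lambda>m. \<Sum>i<k m. \<phi> (p m i) * (p m (Suc i) - p m i)) \<longlonglongrightarrow> integral {s..t} \<phi>"
proof (rule LIMSEQ_I)
  fix e :: real assume e: "e > 0"
  have st: "s < t"
  proof -
    have "k 0 > 0" "p 0 0 = s" "p 0 (k 0) = t" "p 0 0 < p 0 (Suc 0)" using p[of 0] by (auto simp: partition_of_def)
    then show ?thesis using partition_of_mono[OF p[of 0], of "Suc 0" "k 0"] by simp
  qed
  define e' where "e' = e / (2 * (t - s))"
  have e': "e' > 0" using e st by (simp add: e'_def)
  have "uniformly_continuous_on {s..t} \<phi>" using c by (intro compact_uniformly_continuous) auto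
  then obtain d where d: "d > 0" "\<And>x y. x \<in> {s..t} \<Longrightarrow> y \<in> {s..t} \<Longrightarrow> dist y x < d \<Longrightarrow> dist (\<phi> y) (\<phi> x) < e'"
    using e' unfolding uniformly_continuous_on_def by metis
  obtain N where N: "\<And>m. m \<ge> N \<Longrightarrow> norm (mesh (p m) (k m) - 0) < d" using LIMSEQ_D[OF mesh d(1)] by blast
  show "\<exists>N. \<forall>m\<ge>N. norm ((\<Sum>i<k m. \<phi> (p m i) * (p m (Suc i) - p m i)) - integral {s..t} \<phi>) < e"
  proof (intro exI[of _ N] allI impI)
    fix m assume m: "m \<ge> N"
    define q where "q = p m"
    define l where "l = k m"
    have q: "partition_of s t q l" using p[of m] by (simp add: q_def l_def)
    have less: "mesh q l < d" using N[OF m] by (auto simp: q_def l_def)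
    have "(\<Sum>i<l. \<phi> (q i) * (q (Suc i) - q i)) - integral {s..t} \<phi> = (\<Sum>i<l. \<phi> (q i) * (q (Suc i) - q i) - integral {q i..q (Suc i)} \<phi>)"
      using partition_integral_split[OF q c, of l] q by (simp add: sum_subtractf partition_of_def)
    then have "norm ((\<Sum>i<l. \<phi> (q i) * (q (Suc i) - q i)) - integral {s..t} \<phi>) \<le> (\<Sum>i<l. norm (\<phi> (q i) * (q (Suc i) - q i) - integral {q i..q (Suc i)} \<phi>))"
      by (simp add: norm_sum del: real_norm_def)
    also have "\<dots> \<le> (\<Sum>i<l. e' * (q (Suc i) - q i))"
    proof (rule sum_mono)
      fix i assume "i \<in> {..<l}"
      then have i: "i < l" by simp
      have r: "q i \<in> {s..t}" "q (Suc i) \<in> {s..t}" "q i < q (Suc i)"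
        using partition_of_range[OF q, of i] partition_of_range[OF q, of "Suc i"] partition_of_less[OF q i] i by auto
      have sub: "{q i..q (Suc i)} \<subseteq> {s..t}" using r by auto
      have ii: "\<phi> integrable_on {q i..q (Suc i)}"
        by (intro integrable_continuous_interval continuous_on_subset[OF c sub])
      have "norm (integral {q i..q (Suc i)} (\<lambda>x. \<phi> x - \<phi> (q i))) \<le> e' * (q (Suc i) - q i)"
      proof (rule integral_bound)
        show "continuous_on {q i..q (Suc i)} (\<lambda>x. \<phi> x - \<phi> (q i))"
          by (intro continuous_intros continuous_on_subset[OF c sub])
        fix x assume x: "x \<in> {q i..q (Suc i)}"
        have "dist x (q i) < d" using x less partition_of_mesh[OF i, of q] by (auto simp: dist_real_def)
        then show "norm (\<phi> x - \<phi> (q i)) \<le> e'" using d(2)[of "q i" x] x sub r by (auto simp: dist_real_def)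
      qed (use r in auto)
      moreover have "integral {q i..q (Suc i)} (\<lambda>x. \<phi> x - \<phi> (q i)) = integral {q i..q (Suc i)} \<phi> - \<phi> (q i) * (q (Suc i) - q i)"
        using ii r by (subst Henstock_Kurzweil_Integration.integral_diff) (auto simp: integrable_const_ivl mult.commute)
      ultimately show "norm (\<phi> (q i) * (q (Suc i) - q i) - integral {q i..q (Suc i)} \<phi>) \<le> e' * (q (Suc i) - q i)"
        by (metis norm_minus_commute)
    qed
    also have "\<dots> = e' * (t - s)" by (simp add: sum_distrib_left[symmetric] partition_of_sum[OF q])
    also have "e' * (t - s) = e / 2" using st by (simp add: e'_def divide_simps)
    also have "\<dots> < e" using e by simp
    finally show "norm ((\<Sum>i<k m. \<phi> (p m i) * (p m (Suc i) - p m i)) - integral {s..t} \<phi>) < e"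
      by (simp add: q_def l_def)
  qed
qed

text \<open>By Weierstrass, monomial weights suffice; for these, deterministic, weights the convergence is a
  statement about countably many random variables only.\<close>

lemma weighted_sums_tendsto:
  fixes \<phi> :: "real \<Rightarrow> real"
  assumes st: "s < t" and c: "continuous_on {s..t} \<phi>"
    and p: "\<And>m. partition_of s t (p m) (k m)"
    and v: "\<And>m i. v m i \<ge> 0"
    and lim: "\<And>j. (\<lambda>m. \<Sum>i<k m. (p m i) ^ j * (v m i - (p m (Suc i) - p m i))) \<longlonglongrightarrow> 0"
  shows "(\<lambda>m. \<Sum>i<k m. \<phi> (p m i) * (v m i - (p m (Suc i) - p m i))) \<longlonglongrightarrow> 0"
proof (rule LIMSEQ_I)
  fix e :: real assume e: "e > 0"
  \<comment> \<open>The case j = 0 bounds the sum of the v by t - s + 1 eventually. The signed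
    weights then have total mass at most 2 (t - s) + 1, and approximating \<phi> within e' costs at
    most e / 2.\<close>
  define e' where "e' = e / (2 * (2 * (t - s) + 1))"
  have e': "e' > 0" using e st by (simp add: e'_def)
  obtain g where g: "real_polynomial_function g" "\<And>x. x \<in> {s..t} \<Longrightarrow> \<bar>\<phi> x - g x\<bar> < e'"
    using Stone_Weierstrass_real_polynomial_function[of "{s..t}" \<phi> e'] c e' by auto
  obtain a n where g_eq: "g = (\<lambda>x. \<Sum>i\<le>n. a i * x ^ i)"
    using g(1) unfolding real_polynomial_function_iff_sum by blast
  define x where "x = (\<lambda>m i. v m i - (p m (Suc i) - p m i))"
  have gl: "(\<lambda>m. \<Sum>i<k m. g (p m i) * x m i) \<longlonglongrightarrow> 0"
  proof -
    have "(\<Sum>i<k m. g (p m i) * x m i) = (\<Sum>j\<le>n. a j * (\<Sum>i<k m. (p m i) ^ j * x m i))" for m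
    proof -
      have "(\<Sum>i<k m. g (p m i) * x m i) = (\<Sum>i<k m. \<Sum>j\<le>n. a j * ((p m i) ^ j * x m i))"
        by (simp add: g_eq sum_distrib_right mult.assoc)
      also have "\<dots> = (\<Sum>j\<le>n. \<Sum>i<k m. a j * ((p m i) ^ j * x m i))" by (rule sum.swap)
      finally show ?thesis by (simp add: sum_distrib_left)
    qed
    moreover have "(\<lambda>m. \<Sum>j\<le>n. a j * (\<Sum>i<k m. (p m i) ^ j * x m i)) \<longlonglongrightarrow> (\<Sum>j\<le>n. a j * 0)"
      using lim unfolding x_def by (intro tendsto_intros) auto
    ultimately show ?thesis by simp
  qed
  obtain N1 where N1: "\<And>m. m \<ge> N1 \<Longrightarrow> \<bar>\<Sum>i<k m. g (p m i) * x m i\<bar> < e / 2"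
    using LIMSEQ_D[OF gl, of "e/2"] e by auto
  obtain N2 where N2: "\<And>m. m \<ge> N2 \<Longrightarrow> \<bar>\<Sum>i<k m. x m i\<bar> < 1"
    using LIMSEQ_D[OF lim[of 0], of 1] by (auto simp: x_def)
  show "\<exists>N. \<forall>m\<ge>N. norm ((\<Sum>i<k m. \<phi> (p m i) * (v m i - (p m (Suc i) - p m i))) - 0) < e"
  proof (intro exI[of _ "max N1 N2"] allI impI)
    fix m assume m: "m \<ge> max N1 N2"
    have "\<bar>(\<Sum>i<k m. \<phi> (p m i) * x m i) - (\<Sum>i<k m. g (p m i) * x m i)\<bar> \<le> (\<Sum>i<k m. \<bar>(\<phi> (p m i) - g (p m i)) * x m i\<bar>)"
      unfolding sum_subtractf[symmetric] left_diff_distrib[symmetric] by (rule sum_abs)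
    also have "\<dots> \<le> (\<Sum>i<k m. e' * (v m i + (p m (Suc i) - p m i)))"
    proof (rule sum_mono)
      fix i assume i: "i \<in> {..<k m}"
      have "\<bar>x m i\<bar> \<le> v m i + (p m (Suc i) - p m i)"
        using v[of m i] partition_of_less[OF p[of m], of i] i by (auto simp: x_def abs_le_iff)
      moreover have "\<bar>\<phi> (p m i) - g (p m i)\<bar> \<le> e'"
        using g(2)[OF partition_of_range[OF p, of i]] i by (auto intro: less_imp_le)
      ultimately show "\<bar>(\<phi> (p m i) - g (p m i)) * x m i\<bar> \<le> e' * (v m i + (p m (Suc i) - p m i))"
        unfolding abs_mult using e' by (intro mult_mono) auto
    qed
    also have "\<dots> = e' * ((\<Sum>i<k m. x m i) + 2 * (\<Sum>i<k m. p m (Suc i) - p m i))"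
      unfolding sum_distrib_left sum.distrib[symmetric] by (intro sum.cong) (auto simp: x_def algebra_simps)
    also have "\<dots> \<le> e' * (1 + 2 * (t - s))"
      using N2[of m] m e' unfolding partition_of_sum[OF p] by (intro mult_left_mono) auto
    also have "\<dots> = e / 2" using st by (simp add: e'_def divide_simps)
    finally have "\<bar>(\<Sum>i<k m. \<phi> (p m i) * x m i) - (\<Sum>i<k m. g (p m i) * x m i)\<bar> \<le> e / 2" .
    then have "\<bar>\<Sum>i<k m. \<phi> (p m i) * x m i\<bar> < e" using N1[of m] m by linarith
    then show "norm ((\<Sum>i<k m. \<phi> (p m i) * (v m i - (p m (Suc i) - p m i))) - 0) < e"
      unfolding x_def by simp
  qed
qed

text \<open>All randomness is in the hypothesis \<open>lim\<close>. With X the increment of h along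
  the path and A its linear part, X^2 - A^2 = (X - A)(X + A): the first factor is at most K times
  the squared path step plus the time step, which has bounded sum, and the second is uniformly small
  by uniform continuity. What remains are weighted squares of path increments, which converge like
  Riemann sums.\<close>

lemma qv_pathwise:
  fixes w :: "real \<Rightarrow> real"
  assumes st: "0 < s" "s < t" and e: "x_expansion h h'"
    and w: "continuous_on {s..t} w"
    and p: "\<And>m. partition_of s t (p m) (k m)" and mesh: "(\<lambda>m. mesh (p m) (k m)) \<longlonglongrightarrow> 0"
    and lim: "\<And>j. (\<lambda>m. \<Sum>i<k m. (p m i) ^ j * ((w (p m (Suc i)) - w (p m i))\<^sup>2 - (p m (Suc i) - p m i))) \<longlonglongrightarrow> 0"
  shows "(\<lambda>m. \<Sum>i<k m. (h (p m (Suc i)) (w (p m (Suc i))) - h (p m i) (w (p m i)))\<^sup>2)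
     \<longlonglongrightarrow> integral {s..t} (\<lambda>u. (h' u (w u))\<^sup>2)"
proof -
  define v where "v = (\<lambda>m i. (w (p m (Suc i)) - w (p m i))\<^sup>2)"
  define D where "D = (\<lambda>m i. p m (Suc i) - p m i)"
  have cp: "continuous_on {s..t} (\<lambda>u. h' u (w u))"
  proof -
    have "continuous_on {s..t} (\<lambda>u. (\<lambda>(t, x). h' t x) (u, w u))"
      by (rule continuous_on_compose2[of "{0<..} \<times> UNIV"])
         (use e st w in \<open>auto simp: x_expansion_def intro!: continuous_intros\<close>)
    then show ?thesis by simp
  qed
  have c2: "continuous_on {s..t} (\<lambda>u. (h' u (w u))\<^sup>2)" using cp by (intro continuous_intros)
  have L1: "(\<lambda>m. \<Sum>i<k m. (h' (p m i) (w (p m i)))\<^sup>2 * (v m i - D m i)) \<longlonglongrightarrow> 0"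
    using weighted_sums_tendsto[OF st(2) c2 p, of v] lim by (simp add: v_def D_def)
  have L2: "(\<lambda>m. \<Sum>i<k m. (h' (p m i) (w (p m i)))\<^sup>2 * D m i) \<longlonglongrightarrow> integral {s..t} (\<lambda>u. (h' u (w u))\<^sup>2)"
    using riemann_sums_tendsto[OF c2 p mesh] by (simp add: D_def)
  have L: "(\<lambda>m. \<Sum>i<k m. (h' (p m i) (w (p m i)))\<^sup>2 * v m i) \<longlonglongrightarrow> integral {s..t} (\<lambda>u. (h' u (w u))\<^sup>2)"
    using tendsto_add[OF L1 L2] by (simp add: sum.distrib[symmetric] distrib_left[symmetric])
  obtain R0 where R0: "\<And>u. u \<in> {s..t} \<Longrightarrow> norm (w u) \<le> R0"
    using compact_imp_bounded[OF compact_continuous_image[OF w]] unfolding bounded_iff by (metis compact_Icc imageI)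
  obtain B where B: "\<And>u. u \<in> {s..t} \<Longrightarrow> norm (h' u (w u)) \<le> B"
    using compact_imp_bounded[OF compact_continuous_image[OF cp]] unfolding bounded_iff by (metis (no_types, lifting) compact_Icc imageI)
  have B0: "B \<ge> 0" using B[of s] st norm_ge_zero[of "h' s (w s)"] by auto
  obtain K where K: "K > 0" "\<And>u u' x x'. u\<in>{s..t} \<Longrightarrow> u'\<in>{s..t} \<Longrightarrow> x\<in>{-R0..R0} \<Longrightarrow> x'\<in>{-R0..R0} \<Longrightarrow>
      \<bar>h u' x' - h u x - h' u x * (x' - x)\<bar> \<le> K * (\<bar>u' - u\<bar> + (x' - x)\<^sup>2)"
    using x_expansionD[OF e st(1), of t R0] st(2) by auto
  have S1: "(\<lambda>m. \<Sum>i<k m. v m i - D m i) \<longlonglongrightarrow> 0" using lim[of 0] by (simp add: v_def D_def)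
  have "(\<lambda>m. (\<Sum>i<k m. (h (p m (Suc i)) (w (p m (Suc i))) - h (p m i) (w (p m i)))\<^sup>2) - (\<Sum>i<k m. (h' (p m i) (w (p m i)))\<^sup>2 * v m i)) \<longlonglongrightarrow> 0"
  proof (rule LIMSEQ_I)
    fix e :: real assume e: "e > 0"
    define C where "C = K * (2 * B + 2 * K) * (2 * (t - s) + 1)"
    have C: "C > 0" using K B0 st unfolding C_def by (intro mult_pos_pos) auto
    \<comment> \<open>Because d is at most 1, path steps below d also have squares below d, so both
      parts of the Taylor error are controlled by d.\<close>
    define d where "d = min 1 (e / (2 * C))"
    have d: "0 < d" "d \<le> 1" "C * d < e" using e C by (auto simp: d_def min_def field_simps)
    have "uniformly_continuous_on {s..t} w" using w by (intro compact_uniformly_continuous) auto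
    then obtain r where r: "r > 0" "\<And>x y. x \<in> {s..t} \<Longrightarrow> y \<in> {s..t} \<Longrightarrow> dist y x < r \<Longrightarrow> dist (w y) (w x) < d"
      using d unfolding uniformly_continuous_on_def by metis
    obtain N1 where N1: "\<And>m. m \<ge> N1 \<Longrightarrow> norm (mesh (p m) (k m) - 0) < min r d" using LIMSEQ_D[OF mesh, of "min r d"] r d by auto
    obtain N2 where N2: "\<And>m. m \<ge> N2 \<Longrightarrow> \<bar>\<Sum>i<k m. v m i - D m i\<bar> < 1" using LIMSEQ_D[OF S1, of 1] by auto
    show "\<exists>N. \<forall>m\<ge>N. norm ((\<Sum>i<k m. (h (p m (Suc i)) (w (p m (Suc i))) - h (p m i) (w (p m i)))\<^sup>2) - (\<Sum>i<k m. (h' (p m i) (w (p m i)))\<^sup>2 * v m i) - 0) < e"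
    proof (intro exI[of _ "max N1 N2"] allI impI)
      fix m assume m: "m \<ge> max N1 N2"
      have "norm ((\<Sum>i<k m. (h (p m (Suc i)) (w (p m (Suc i))) - h (p m i) (w (p m i)))\<^sup>2) - (\<Sum>i<k m. (h' (p m i) (w (p m i)))\<^sup>2 * v m i) - 0)
        \<le> (\<Sum>i<k m. \<bar>(h (p m (Suc i)) (w (p m (Suc i))) - h (p m i) (w (p m i)))\<^sup>2 - (h' (p m i) (w (p m i)))\<^sup>2 * v m i\<bar>)"
        unfolding sum_subtractf[symmetric] real_norm_def diff_0_right by (rule sum_abs)
      also have "\<dots> \<le> (\<Sum>i<k m. K * (2 * B + 2 * K) * d * (v m i + D m i))"
      proof (rule sum_mono)
        fix i assume "i \<in> {..<k m}"
        then have i: "i < k m" by simp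
        have rg: "p m i \<in> {s..t}" "p m (Suc i) \<in> {s..t}" using partition_of_range[OF p] i by auto
        have D: "D m i > 0" using partition_of_less[OF p i] by (simp add: D_def)
        have D': "D m i < min r d" using partition_of_mesh[OF i, of "p m"] N1[of m] m by (auto simp: D_def)
        define \<Delta> where "\<Delta> = w (p m (Suc i)) - w (p m i)"
        define A where "A = h' (p m i) (w (p m i)) * \<Delta>"
        define X where "X = h (p m (Suc i)) (w (p m (Suc i))) - h (p m i) (w (p m i))"
        have v: "v m i = \<Delta>\<^sup>2" by (simp add: v_def \<Delta>_def)
        have \<Delta>: "\<bar>\<Delta>\<bar> \<le> d" using r(2)[OF rg] D D' unfolding \<Delta>_def dist_real_def D_def by auto
        have XA: "\<bar>X - A\<bar> \<le> K * (v m i + D m i)"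
          using K(2)[OF rg, of "w (p m i)" "w (p m (Suc i))"] R0[OF rg(1)] R0[OF rg(2)] D
          unfolding X_def A_def v \<Delta>_def D_def by (auto simp: abs_le_iff add.commute)
        have "\<bar>A\<bar> \<le> B * d" unfolding A_def abs_mult using B[OF rg(1)] \<Delta> B0 by (intro mult_mono) auto
        moreover have "K * (v m i + D m i) \<le> 2 * K * d"
        proof -
          have "\<Delta>\<^sup>2 = \<bar>\<Delta>\<bar> * \<bar>\<Delta>\<bar>" by (simp add: power2_eq_square)
          also have "\<dots> \<le> d * 1" using \<Delta> d by (intro mult_mono) auto
          finally have "v m i + D m i \<le> 2 * d" using D' v by auto
          then have "K * (v m i + D m i) \<le> K * (2 * d)" using K by (intro mult_left_mono) auto
          then show ?thesis by simp
        qed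
        ultimately have "\<bar>X + A\<bar> \<le> (2 * B + 2 * K) * d" using XA by (simp add: algebra_simps)
        have "X\<^sup>2 - A\<^sup>2 = (X - A) * (X + A)" by (simp add: algebra_simps power2_eq_square)
        then have "\<bar>X\<^sup>2 - A\<^sup>2\<bar> = \<bar>X - A\<bar> * \<bar>X + A\<bar>" by (simp add: abs_mult)
        also have "\<dots> \<le> (K * (v m i + D m i)) * ((2 * B + 2 * K) * d)"
          using XA \<open>\<bar>X + A\<bar> \<le> (2 * B + 2 * K) * d\<close> D K v by (intro mult_mono) auto
        finally show "\<bar>(h (p m (Suc i)) (w (p m (Suc i))) - h (p m i) (w (p m i)))\<^sup>2 - (h' (p m i) (w (p m i)))\<^sup>2 * v m i\<bar>
           \<le> K * (2 * B + 2 * K) * d * (v m i + D m i)"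
          unfolding X_def[symmetric] v A_def power_mult_distrib by (simp add: mult_ac)
      qed
      also have "\<dots> = K * (2 * B + 2 * K) * d * ((\<Sum>i<k m. v m i - D m i) + 2 * (\<Sum>i<k m. D m i))"
        unfolding sum_distrib_left sum.distrib[symmetric] by (intro sum.cong) (auto simp: algebra_simps)
      also have "(\<Sum>i<k m. D m i) = t - s" unfolding D_def by (rule partition_of_sum[OF p])
      also have "K * (2 * B + 2 * K) * d * ((\<Sum>i<k m. v m i - D m i) + 2 * (t - s)) \<le> K * (2 * B + 2 * K) * d * (1 + 2 * (t - s))"
        using N2[of m] m K B0 d by (intro mult_left_mono) auto
      also have "\<dots> = C * d" by (simp add: C_def algebra_simps)
      also have "\<dots> < e" by (rule d(3))
      finally show "norm ((\<Sum>i<k m. (h (p m (Suc i)) (w (p m (Suc i))) - h (p m i) (w (p m i)))\<^sup>2) - (\<Sum>i<k m. (h' (p m i) (w (p m i)))\<^sup>2 * v m i) - 0) < e" .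
    qed
  qed
  from tendsto_add[OF this L] show ?thesis by simp
qed

text \<open>The sum of all squares has finite expectation by monotone convergence, hence is almost
  surely finite, and the terms of a convergent series tend to 0.\<close>

lemma (in prob_space) AE_tendsto_0_of_square_summable:
  fixes X :: "nat \<Rightarrow> 'a \<Rightarrow> real"
  assumes X[measurable]: "\<And>m. X m \<in> borel_measurable M"
    and i: "\<And>m. integrable M (\<lambda>\<omega>. (X m \<omega>)\<^sup>2)"
    and b: "\<And>m. expectation (\<lambda>\<omega>. (X m \<omega>)\<^sup>2) \<le> c m" and c: "summable c"
  shows "AE \<omega> in M. (\<lambda>m. X m \<omega>) \<longlonglongrightarrow> 0"
proof -
  have c0: "c m \<ge> 0" for m
  proof -
    have "0 \<le> expectation (\<lambda>\<omega>. (X m \<omega>)\<^sup>2)" by (rule Bochner_Integration.integral_nonneg) simp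
    then show ?thesis using b[of m] by linarith
  qed
  have "(\<integral>\<^sup>+\<omega>. (\<Sum>m. ennreal ((X m \<omega>)\<^sup>2)) \<partial>M) = (\<Sum>m. \<integral>\<^sup>+\<omega>. ennreal ((X m \<omega>)\<^sup>2) \<partial>M)"
    by (rule nn_integral_suminf) measurable
  also have "\<dots> = (\<Sum>m. ennreal (expectation (\<lambda>\<omega>. (X m \<omega>)\<^sup>2)))"
    by (simp add: nn_integral_eq_integral[OF i])
  also have "\<dots> \<le> (\<Sum>m. ennreal (c m))" by (intro suminf_le ennreal_leI b) auto
  also have "\<dots> < \<infinity>" by (simp add: suminf_ennreal_eq[OF c0 summable_sums[OF c]])
  finally have "AE \<omega> in M. (\<Sum>m. ennreal ((X m \<omega>)\<^sup>2)) \<noteq> \<infinity>"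
    by (intro nn_integral_PInf_AE) auto
  then show ?thesis
  proof eventually_elim
    case (elim \<omega>)
    then have "summable (\<lambda>m. (X m \<omega>)\<^sup>2)" by (intro summable_suminf_not_top) auto
    then have "(\<lambda>m. sqrt ((X m \<omega>)\<^sup>2)) \<longlonglongrightarrow> sqrt 0" by (intro tendsto_real_sqrt summable_LIMSEQ_zero)
    then show ?case by (simp add: tendsto_rabs_zero_iff)
  qed
qed

section \<open>Moments of weighted sums of squared Brownian increments\<close>

locale brownian = prob_space M for M :: "'a measure" +
  fixes W :: "real \<Rightarrow> 'a \<Rightarrow> real"
  assumes bm: "brownian_motion M W"
begin

lemma W_measurable[measurable]: "t \<ge> 0 \<Longrightarrow> W t \<in> borel_measurable M"
  using bm by (simp add: brownian_motion_def)

lemma AE_path: "AE \<omega> in M. W 0 \<omega> = 0 \<and> continuous_on {0..} (\<lambda>t. W t \<omega>)"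
  using bm by (simp add: brownian_motion_def)

lemma increment_distributed:
  "0 \<le> s \<Longrightarrow> s < t \<Longrightarrow> distributed M lborel (\<lambda>\<omega>. W t \<omega> - W s \<omega>) (\<lambda>x. ennreal (gauss (t - s) x))"
  using bm by (simp add: brownian_motion_def)

lemma increments_indep:
  "0 \<le> ts 0 \<Longrightarrow> (\<And>i. i < k \<Longrightarrow> ts i < ts (Suc i)) \<Longrightarrow> indep_vars (\<lambda>_. borel) (\<lambda>i \<omega>. W (ts (Suc i)) \<omega> - W (ts i) \<omega>) {..<k}"
  using bm by (simp add: brownian_motion_def)

lemma increment_integral:
  fixes \<phi> :: "real \<Rightarrow> real"
  assumes "0 \<le> s" "s < t" and [measurable]: "\<phi> \<in> borel_measurable borel"
  shows "expectation (\<lambda>\<omega>. \<phi> (W t \<omega> - W s \<omega>)) = (LBINT y. \<phi> y * gauss (t - s) y)"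
    and "integrable M (\<lambda>\<omega>. \<phi> (W t \<omega> - W s \<omega>)) \<longleftrightarrow> integrable lborel (\<lambda>y. \<phi> y * gauss (t - s) y)"
  using distributed_integral[OF increment_distributed[OF assms(1,2)], of \<phi>]
    distributed_integrable[OF increment_distributed[OF assms(1,2)], of \<phi>]
  by (simp_all add: mult.commute)

lemma square_increment_moments:
  assumes st: "0 \<le> s" "s < t"
  defines "\<xi> \<equiv> (\<lambda>\<omega>. (W t \<omega> - W s \<omega>)\<^sup>2 - (t - s))"
  shows "integrable M \<xi>" "expectation \<xi> = 0" "integrable M (\<lambda>\<omega>. (\<xi> \<omega>)\<^sup>2)" "expectation (\<lambda>\<omega>. (\<xi> \<omega>)\<^sup>2) = 2 * (t - s)\<^sup>2"
proof -
  define u where "u = t - s"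
  have u: "u > 0" using st by (simp add: u_def)
  have i2: "integrable lborel (\<lambda>y. y\<^sup>2 * gauss u y)" and i4: "integrable lborel (\<lambda>y. y ^ 4 * gauss u y)"
    and i0: "integrable lborel (\<lambda>y. gauss u y)"
    using integrable_gauss_power[OF u, of 2] integrable_gauss_power[OF u, of 4] u by auto
  have m2: "(LBINT y. y\<^sup>2 * gauss u y) = u" 
    using integral_gauss_power_Suc_Suc[OF u, of 0] u by (simp add: numeral_2_eq_2)
  have m4: "(LBINT y. y ^ 4 * gauss u y) = 3 * u\<^sup>2"
    using integral_gauss_power_Suc_Suc[OF u, of 2] m2 by (simp add: power2_eq_square)
  have e1: "(\<lambda>y. (y\<^sup>2 - u) * gauss u y) = (\<lambda>y. y\<^sup>2 * gauss u y - u * gauss u y)"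
    by (simp add: algebra_simps)
  have e2: "(\<lambda>y. (y\<^sup>2 - u)\<^sup>2 * gauss u y) = (\<lambda>y. y ^ 4 * gauss u y - 2 * u * (y\<^sup>2 * gauss u y) + u\<^sup>2 * gauss u y)"
    by (rule ext) (simp add: algebra_simps power2_eq_square eval_nat_numeral)
  have I1: "integrable lborel (\<lambda>y. (y\<^sup>2 - u) * gauss u y)" "(LBINT y. (y\<^sup>2 - u) * gauss u y) = 0"
    unfolding e1 using i2 i0 m2 u by simp_all
  have I2: "integrable lborel (\<lambda>y. (y\<^sup>2 - u)\<^sup>2 * gauss u y)" "(LBINT y. (y\<^sup>2 - u)\<^sup>2 * gauss u y) = 2 * u\<^sup>2"
    unfolding e2 using i2 i0 i4 m2 m4 u by (simp_all add: power2_eq_square)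
  show "integrable M \<xi>" "expectation \<xi> = 0"
    using increment_integral[OF st, of "\<lambda>y. y\<^sup>2 - u"] I1 by (simp_all add: \<xi>_def u_def)
  show "integrable M (\<lambda>\<omega>. (\<xi> \<omega>)\<^sup>2)" "expectation (\<lambda>\<omega>. (\<xi> \<omega>)\<^sup>2) = 2 * (t - s)\<^sup>2"
    using increment_integral[OF st, of "\<lambda>y. (y\<^sup>2 - u)\<^sup>2"] I2 by (simp_all add: \<xi>_def u_def)
qed

text \<open>Deterministic weights keep the centred squared increments independent with mean zero, so
  cross terms vanish and second moments add up. The induction uses that the partial sum
  \<open>S j\<close> is independent of the next summand.\<close>

lemma weighted_square_increments:
  fixes c :: "nat \<Rightarrow> real"
  assumes s: "0 \<le> s" and p: "partition_of s t p k"
  defines "S \<equiv> (\<lambda>j \<omega>. \<Sum>i<j. c i * ((W (p (Suc i)) \<omega> - W (p i) \<omega>)\<^sup>2 - (p (Suc i) - p i)))"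
  shows "S k \<in> borel_measurable M" "integrable M (\<lambda>\<omega>. (S k \<omega>)\<^sup>2)"
    "expectation (\<lambda>\<omega>. (S k \<omega>)\<^sup>2) = (\<Sum>i<k. (c i)\<^sup>2 * (2 * (p (Suc i) - p i)\<^sup>2))"
proof -
  define \<xi> where "\<xi> = (\<lambda>i \<omega>. (W (p (Suc i)) \<omega> - W (p i) \<omega>)\<^sup>2 - (p (Suc i) - p i))"
  have S: "S j = (\<lambda>\<omega>. \<Sum>i<j. c i * \<xi> i \<omega>)" for j by (simp add: S_def \<xi>_def)
  have p0: "p i \<ge> 0" if "i \<le> k" for i using partition_of_range[OF p that] s by auto
  have mom': "integrable M (\<xi> i)" "expectation (\<xi> i) = 0" "integrable M (\<lambda>\<omega>. (\<xi> i \<omega>)\<^sup>2)"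
     "expectation (\<lambda>\<omega>. (\<xi> i \<omega>)\<^sup>2) = 2 * (p (Suc i) - p i)\<^sup>2" if "i < k" for i
    using square_increment_moments[OF p0[of i] partition_of_less[OF p that]] that by (auto simp: \<xi>_def)
  have meas: "\<xi> i \<in> borel_measurable M" if "i < k" for i using mom'(1)[OF that] by simp
  have ind: "indep_vars (\<lambda>_. borel) (\<lambda>i \<omega>. c i * \<xi> i \<omega>) {..<k}"
    unfolding \<xi>_def
    by (rule indep_vars_compose2[OF increments_indep[of p k], where Y="\<lambda>i y. c i * (y\<^sup>2 - (p (Suc i) - p i))"])
       (use p0[of 0] partition_of_less[OF p] in auto)
  have "S j \<in> borel_measurable M \<and> integrable M (S j) \<and> expectation (S j) = 0 \<and> integrable M (\<lambda>\<omega>. (S j \<omega>)\<^sup>2) \<and>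
    expectation (\<lambda>\<omega>. (S j \<omega>)\<^sup>2) = (\<Sum>i<j. (c i)\<^sup>2 * (2 * (p (Suc i) - p i)\<^sup>2))" if "j \<le> k" for j
    using that
  proof (induction j)
    case 0 then show ?case by (simp add: S)
  next
    case (Suc j)
    then have j: "j < k" by simp
    note [measurable] = meas[OF j]
    have IH: "S j \<in> borel_measurable M" "integrable M (S j)" "expectation (S j) = 0" "integrable M (\<lambda>\<omega>. (S j \<omega>)\<^sup>2)"
      "expectation (\<lambda>\<omega>. (S j \<omega>)\<^sup>2) = (\<Sum>i<j. (c i)\<^sup>2 * (2 * (p (Suc i) - p i)\<^sup>2))" using Suc by auto
    note [measurable] = IH(1)
    have "indep_vars (\<lambda>_. borel) (\<lambda>i \<omega>. c i * \<xi> i \<omega>) (insert j {..<j})"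
      by (rule indep_vars_subset[OF ind]) (use j in auto)
    then have iv: "indep_var borel (\<lambda>\<omega>. c j * \<xi> j \<omega>) borel (S j)"
      unfolding S by (intro indep_vars_sum) auto
    have ij: "integrable M (\<lambda>\<omega>. c j * \<xi> j \<omega>)" using mom'(1)[OF j] by simp
    have cr: "integrable M (\<lambda>\<omega>. c j * \<xi> j \<omega> * S j \<omega>)" "expectation (\<lambda>\<omega>. c j * \<xi> j \<omega> * S j \<omega>) = 0"
      using indep_var_integrable[OF iv ij IH(2)] indep_var_lebesgue_integral[OF iv ij IH(2)] mom'(2)[OF j] by auto
    have eq: "S (Suc j) = (\<lambda>\<omega>. S j \<omega> + c j * \<xi> j \<omega>)" by (simp add: S)
    have sq: "(\<lambda>\<omega>. (S (Suc j) \<omega>)\<^sup>2) = (\<lambda>\<omega>. (S j \<omega>)\<^sup>2 + 2 * (c j * \<xi> j \<omega> * S j \<omega>) + (c j)\<^sup>2 * (\<xi> j \<omega>)\<^sup>2)"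
      by (rule ext) (simp add: eq power2_eq_square algebra_simps)
    have "S (Suc j) \<in> borel_measurable M" unfolding eq by measurable
    moreover have "integrable M (S (Suc j))" "expectation (S (Suc j)) = 0" unfolding eq using IH ij mom'(1,2)[OF j] by simp_all
    moreover have "integrable M (\<lambda>\<omega>. (S (Suc j) \<omega>)\<^sup>2)" unfolding sq using IH cr mom'(3)[OF j] by simp
    moreover have "expectation (\<lambda>\<omega>. (S (Suc j) \<omega>)\<^sup>2) = (\<Sum>i<Suc j. (c i)\<^sup>2 * (2 * (p (Suc i) - p i)\<^sup>2))"
      unfolding sq using IH cr mom'(3,4)[OF j] by simp
    ultimately show ?case by blast
  qed
  from this[OF order_refl] show "S k \<in> borel_measurable M" "integrable M (\<lambda>\<omega>. (S k \<omega>)\<^sup>2)"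
    "expectation (\<lambda>\<omega>. (S k \<omega>)\<^sup>2) = (\<Sum>i<k. (c i)\<^sup>2 * (2 * (p (Suc i) - p i)\<^sup>2))" by auto
qed

text \<open>Meshes below 2^-m make the second moments of the weighted sums geometrically summable.
  There are countably many monomial weights, so one null set serves them all, and outside it the
  pathwise statement applies. The null set may depend on the sequence of partitions.\<close>

theorem quadratic_variation_AE:
  assumes st: "0 < s" "s < t" and e: "x_expansion h h'"
    and p: "\<And>m. partition_of s t (p m) (k m)" and mesh: "\<And>m. mesh (p m) (k m) < (1/2) ^ m"
  shows "AE \<omega> in M. (\<lambda>m. \<Sum>i<k m. (h (p m (Suc i)) (W (p m (Suc i)) \<omega>) - h (p m i) (W (p m i) \<omega>))\<^sup>2)
     \<longlonglongrightarrow> integral {s..t} (\<lambda>u. (h' u (W u \<omega>))\<^sup>2)"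
proof -
  have "AE \<omega> in M. (\<lambda>m. \<Sum>i<k m. (p m i) ^ j * ((W (p m (Suc i)) \<omega> - W (p m i) \<omega>)\<^sup>2 - (p m (Suc i) - p m i))) \<longlonglongrightarrow> 0" for j
  proof (rule AE_tendsto_0_of_square_summable)
    note w = weighted_square_increments[OF less_imp_le[OF st(1)] p]
    show "(\<lambda>\<omega>. \<Sum>i<k m. (p m i) ^ j * ((W (p m (Suc i)) \<omega> - W (p m i) \<omega>)\<^sup>2 - (p m (Suc i) - p m i))) \<in> borel_measurable M" for m
      by (rule w(1))
    show "integrable M (\<lambda>\<omega>. (\<Sum>i<k m. (p m i) ^ j * ((W (p m (Suc i)) \<omega> - W (p m i) \<omega>)\<^sup>2 - (p m (Suc i) - p m i)))\<^sup>2)" for m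
      by (rule w(2))
    show "expectation (\<lambda>\<omega>. (\<Sum>i<k m. (p m i) ^ j * ((W (p m (Suc i)) \<omega> - W (p m i) \<omega>)\<^sup>2 - (p m (Suc i) - p m i)))\<^sup>2)
       \<le> (2 * t ^ (2 * j) * (t - s)) * (1/2) ^ m" for m
    proof -
      have "expectation (\<lambda>\<omega>. (\<Sum>i<k m. (p m i) ^ j * ((W (p m (Suc i)) \<omega> - W (p m i) \<omega>)\<^sup>2 - (p m (Suc i) - p m i)))\<^sup>2)
        = (\<Sum>i<k m. ((p m i) ^ j)\<^sup>2 * (2 * (p m (Suc i) - p m i)\<^sup>2))"
        by (rule w(3))
      also have "\<dots> \<le> (\<Sum>i<k m. (2 * t ^ (2 * j) * (1/2) ^ m) * (p m (Suc i) - p m i))"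
      proof (rule sum_mono)
        fix i assume "i \<in> {..<k m}"
        then have i: "i < k m" by simp
        have "p m i \<in> {s..t}" using partition_of_range[OF p, of i m] i by simp
        then have "((p m i) ^ j)\<^sup>2 \<le> t ^ (2 * j)" unfolding power_mult[symmetric] mult.commute[of j] using st by (intro power_mono) auto
        moreover have "(p m (Suc i) - p m i)\<^sup>2 \<le> (1/2) ^ m * (p m (Suc i) - p m i)"
          unfolding power2_eq_square using partition_of_less[OF p i] partition_of_mesh[OF i, of "p m"] mesh[of m]
          by (intro mult_right_mono) auto
        ultimately have "((p m i) ^ j)\<^sup>2 * (p m (Suc i) - p m i)\<^sup>2 \<le> t ^ (2 * j) * ((1/2) ^ m * (p m (Suc i) - p m i))"
          by (intro mult_mono) (use st in auto)
        then show "((p m i) ^ j)\<^sup>2 * (2 * (p m (Suc i) - p m i)\<^sup>2) \<le> (2 * t ^ (2 * j) * (1/2) ^ m) * (p m (Suc i) - p m i)"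
          by (simp add: mult_ac)
      qed
      also have "\<dots> = (2 * t ^ (2 * j) * (t - s)) * (1/2) ^ m"
        unfolding sum_distrib_left[symmetric] partition_of_sum[OF p] by simp
      finally show ?thesis .
    qed
    show "summable (\<lambda>m. (2 * t ^ (2 * j) * (t - s)) * (1/2) ^ m)" by (intro summable_mult summable_geometric) simp
  qed
  then have "AE \<omega> in M. \<forall>j. (\<lambda>m. \<Sum>i<k m. (p m i) ^ j * ((W (p m (Suc i)) \<omega> - W (p m i) \<omega>)\<^sup>2 - (p m (Suc i) - p m i))) \<longlonglongrightarrow> 0"
    by (simp add: AE_all_countable)
  with AE_path show ?thesis
  proof eventually_elim
    case (elim \<omega>)
    have "(\<lambda>m. mesh (p m) (k m)) \<longlonglongrightarrow> 0"
    proof (rule tendsto_sandwich[of "\<lambda>_. 0"])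
      show "\<forall>\<^sub>F m in sequentially. 0 \<le> mesh (p m) (k m)"
      proof (intro always_eventually allI)
        fix m
        have "0 < k m" using p[of m] by (simp add: partition_of_def)
        then show "0 \<le> mesh (p m) (k m)" using partition_of_less[OF p, of 0 m] partition_of_mesh[of 0 "k m" "p m"] by simp
      qed
      show "\<forall>\<^sub>F m in sequentially. mesh (p m) (k m) \<le> (1/2) ^ m" using mesh by (intro always_eventually allI less_imp_le)
    qed (auto intro!: LIMSEQ_realpow_zero)
    moreover have "continuous_on {s..t} (\<lambda>t. W t \<omega>)" using elim(1) st by (auto elim: continuous_on_subset)
    ultimately show ?case using elim(2) by (intro qv_pathwise[OF st e _ p]) auto
  qed
qed

end

section \<open>The Markov property\<close>

text \<open>Integrability is available only against the wider Gaussian at time T. This suffices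
  because the narrower kernel, shifted by bounded amounts, stays below a multiple of it. Continuity
  makes the set of x where the averaging identity holds closed.\<close>

lemma gauss_convolution_continuous:
  fixes \<phi> :: "real \<Rightarrow> real"
  assumes [measurable]: "\<phi> \<in> borel_measurable borel"
    and i: "integrable lborel (\<lambda>w. \<phi> w * gauss T w)" and s: "0 < s" "s < T"
  shows "continuous_on UNIV (\<lambda>x. LBINT w. \<phi> w * gauss (T - s) (w - x))"
  unfolding continuous_on_sequentially
proof (intro allI ballI impI)
  fix Y :: "nat \<Rightarrow> real" and x assume "(\<forall>n. Y n \<in> UNIV) \<and> Y \<longlonglongrightarrow> x"
  then have Y: "Y \<longlonglongrightarrow> x" by simp
  obtain R where R: "\<And>n. norm (Y n) \<le> R"
    using Bseq_def[of Y] convergent_imp_Bseq[of Y] Y by (auto simp: convergent_def)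
  \<comment> \<open>The expansion is used on the one-point time interval a = b = s.\<close>
  obtain K where K: "K > 0" "\<And>y w. y \<in> {-R..R} \<Longrightarrow> gauss (T - s) (w - y) \<le> K * gauss T w"
    using gauss_kernel_expansion[OF s(1) order_refl s(2), of R] by auto
  have u: "T - s > 0" using s by simp
  have dom: "integrable lborel (\<lambda>w. K * (\<bar>\<phi> w\<bar> * gauss T w))"
    using integrable_abs[OF i] by (simp add: abs_mult)
  have "(\<lambda>n. LBINT w. \<phi> w * gauss (T - s) (w - Y n)) \<longlonglongrightarrow> (LBINT w. \<phi> w * gauss (T - s) (w - x))"
  proof (rule integral_dominated_convergence[OF _ _ dom])
    show "AE w in lborel. (\<lambda>n. \<phi> w * gauss (T - s) (w - Y n)) \<longlonglongrightarrow> \<phi> w * gauss (T - s) (w - x)"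
      unfolding gauss_eq[OF u] by (intro AE_I2 tendsto_intros Y) (use u in auto)
    show "AE w in lborel. norm (\<phi> w * gauss (T - s) (w - Y n)) \<le> K * (\<bar>\<phi> w\<bar> * gauss T w)" for n
    proof (rule AE_I2)
      fix w
      have "\<bar>\<phi> w\<bar> * gauss (T - s) (w - Y n) \<le> \<bar>\<phi> w\<bar> * (K * gauss T w)"
        using K(2)[of "Y n" w] R[of n] by (intro mult_left_mono) (auto simp: abs_le_iff)
      then show "norm (\<phi> w * gauss (T - s) (w - Y n)) \<le> K * (\<bar>\<phi> w\<bar> * gauss T w)"
        by (simp add: abs_mult mult_ac)
    qed
  qed measurable
  then show "((\<lambda>x. LBINT w. \<phi> w * gauss (T - s) (w - x)) \<circ> Y) \<longlonglongrightarrow> (LBINT w. \<phi> w * gauss (T - s) (w - x))"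
    by (simp add: comp_def)
qed

lemma gauss_convolution_shift:
  fixes \<phi> :: "real \<Rightarrow> real"
  shows "(LBINT y. \<phi> (x + y) * gauss u y) = (LBINT w. \<phi> w * gauss u (w - x))"
  using lborel_integral_real_affine[of 1 "\<lambda>w. \<phi> w * gauss u (w - x)" x] by simp

lemma closed_AE_lborel_UNIV:
  assumes "closed S" and "AE x in lborel. (x::real) \<in> S"
  shows "S = UNIV"
proof (rule ccontr)
  assume "S \<noteq> UNIV"
  then have "- S \<noteq> {}" "open (- S)" using assms(1) by (auto simp: open_Compl)
  then have "\<not> negligible (- S)" by (rule open_not_negligible[rotated])
  moreover have "- S \<in> null_sets lborel"
    using assms by (intro AE_iff_null_sets[THEN iffD2]) auto
  then have "negligible (- S)"
    unfolding negligible_iff_null_sets by (rule null_sets_completionI)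
  ultimately show False by simp
qed

lemma sets_Collect_mem: "g \<in> measurable N L \<Longrightarrow> B \<in> sets L \<Longrightarrow> {x \<in> space N. g x \<in> B} \<in> sets N"
  using measurable_sets[of g N L B] by (simp add: vimage_def Int_def conj_commute)

lemma Int_stable_vimage: "Int_stable {f -` A \<inter> \<Omega> | A. A \<in> sets N}"
proof (rule Int_stableI)
  fix a b assume "a \<in> {f -` A \<inter> \<Omega> | A. A \<in> sets N}" "b \<in> {f -` A \<inter> \<Omega> | A. A \<in> sets N}"
  then obtain A B where "a = f -` A \<inter> \<Omega>" "b = f -` B \<inter> \<Omega>" "A \<in> sets N" "B \<in> sets N" by blast
  then show "a \<inter> b \<in> {f -` A \<inter> \<Omega> | A. A \<in> sets N}" by (intro CollectI exI[of _ "A \<inter> B"]) auto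
qed

section \<open>The law of W_t, its filtration, and the independence of later increments\<close>

context brownian
begin

text \<open>Only increments have a prescribed law and \<open>W 0\<close> vanishes almost surely
  rather than everywhere, so the distributions of \<open>W t\<close> and of the increment from 0 are
  compared up to a null set.\<close>

lemma W_distributed:
  assumes t: "t > 0"
  shows "distributed M lborel (W t) (\<lambda>x. ennreal (gauss t x))"
proof -
  note D = increment_distributed[OF order_refl t]
  have [measurable]: "W t \<in> borel_measurable M" "W 0 \<in> borel_measurable M" using t by auto
  have "distr M lborel (W t) = distr M lborel (\<lambda>\<omega>. W t \<omega> - W 0 \<omega>)"
  proof (rule measure_eqI)
    fix A assume "A \<in> sets (distr M lborel (W t))"
    then have [measurable]: "A \<in> sets borel" by simp
    show "emeasure (distr M lborel (W t)) A = emeasure (distr M lborel (\<lambda>\<omega>. W t \<omega> - W 0 \<omega>)) A"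
      using AE_path by (subst (1 2) emeasure_distr) (auto intro!: emeasure_eq_AE elim!: eventually_mono)
  qed simp
  then show ?thesis using D t by (simp add: distributed_def)
qed

lemma W_integral:
  fixes \<phi> :: "real \<Rightarrow> real"
  assumes "t > 0" and [measurable]: "\<phi> \<in> borel_measurable borel"
  shows "expectation (\<lambda>\<omega>. \<phi> (W t \<omega>)) = (LBINT y. \<phi> y * gauss t y)"
    and "integrable M (\<lambda>\<omega>. \<phi> (W t \<omega>)) \<longleftrightarrow> integrable lborel (\<lambda>y. \<phi> y * gauss t y)"
  using distributed_integral[OF W_distributed[OF assms(1)], of \<phi>]
    distributed_integrable[OF W_distributed[OF assms(1)], of \<phi>]
  by (simp_all add: mult.commute)

text \<open>The device that turns almost sure statements about W_t into statements about every x: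
  the density is positive everywhere, so the complement of S would be an open Lebesgue null set,
  hence empty.\<close>

lemma closed_AE_W_UNIV:
  assumes t: "t > 0" and S: "closed S" and ae: "AE \<omega> in M. W t \<omega> \<in> S"
  shows "S = UNIV"
proof (rule closed_AE_lborel_UNIV[OF S])
  have [measurable]: "W t \<in> borel_measurable M" "S \<in> sets borel" using t S by auto
  have "AE x in distr M lborel (W t). x \<in> S"
    using ae by (subst AE_distr_iff) auto
  moreover have "distr M lborel (W t) = density lborel (\<lambda>x. ennreal (gauss t x))"
    using W_distributed[OF t] by (simp add: distributed_def)
  ultimately have "AE x in density lborel (\<lambda>x. ennreal (gauss t x)). x \<in> S"
    by (simp only:)
  then show "AE x in lborel. x \<in> S"
    using gauss_pos[OF t] by (simp add: AE_density)
qed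

lemma space_bm_filtration[simp]: "space (bm_filtration M W t) = space M"
  unfolding bm_filtration_def by (rule space_measure_of) auto

lemma sets_bm_filtration:
  "sets (bm_filtration M W t) = sigma_sets (space M) (\<Union>s\<in>{0..t}. {W s -` B \<inter> space M | B. B \<in> sets borel})"
  unfolding bm_filtration_def by (rule sets_measure_of) auto

lemma subalgebra_bm_filtration: "subalgebra M (bm_filtration M W t)"
proof -
  have "sets (bm_filtration M W t) \<subseteq> sets M"
    unfolding sets_bm_filtration
    by (rule sets.sigma_sets_subset) (auto intro!: measurable_sets[OF W_measurable])
  then show ?thesis by (simp add: subalgebra_def)
qed

lemma W_adapted: "0 \<le> s \<Longrightarrow> s \<le> t \<Longrightarrow> W s \<in> borel_measurable (bm_filtration M W t)"
proof (rule measurableI)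
  fix B assume "0 \<le> s" "s \<le> t" "B \<in> sets (borel :: real measure)"
  then show "W s -` B \<inter> space (bm_filtration M W t) \<in> sets (bm_filtration M W t)"
    unfolding sets_bm_filtration by (intro sigma_sets.Basic UN_I[of s]) auto
qed auto

text \<open>Independence is given only for increments over an increasing chain of times. Off the
  null set where W_0 is nonzero, the values at the times in U are partial sums of the increments
  over the sorted times, while the increment from s to t is the last link of the same chain.\<close>

lemma cylinder_indep_increment:
  assumes st: "0 \<le> s" "s < t" and U: "finite U" "U \<subseteq> {0..s}"
    and B: "\<And>u. Bs u \<in> sets borel" and C: "C \<in> sets borel"
  shows "prob ({\<omega>\<in>space M. \<forall>u\<in>U. W u \<omega> \<in> Bs u} \<inter> ((\<lambda>\<omega>. W t \<omega> - W s \<omega>) -` C \<inter> space M)) =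
    prob {\<omega>\<in>space M. \<forall>u\<in>U. W u \<omega> \<in> Bs u} * prob ((\<lambda>\<omega>. W t \<omega> - W s \<omega>) -` C \<inter> space M)"
proof -
  \<comment> \<open>The time 0 is added so that partial sums of increments give values of W, the
    time s so that the last link starts exactly there.\<close>
  define V where "V = U \<union> {0, s}"
  define l where "l = sorted_list_of_set V"
  define n where "n = length l - 1"
  have V: "finite V" "V \<noteq> {}" "V \<subseteq> {0..s}" using U st by (auto simp: V_def)
  have l: "set l = V" "sorted_wrt (<) l" "distinct l" using V by (auto simp: l_def)
  have "l \<noteq> []" using V(2) l(1) by (metis set_empty)
  then have len: "length l = Suc n" unfolding n_def by (cases l) auto
  have lmem: "l ! i \<in> {0..s}" if "i \<le> n" for i
  proof -
    have "l ! i \<in> set l" using that len by (intro nth_mem) simp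
    then show ?thesis using V(3) l(1) by blast
  qed
  have lmono: "l ! i < l ! j" if "i < j" "j \<le> n" for i j
    by (rule sorted_wrt_nth_less[OF l(2) that(1)]) (use that len in simp)
  have l0: "l ! 0 = 0"
  proof -
    have "0 \<in> set l" using l V_def by auto
    then obtain i where "i \<le> n" "l ! i = 0" using len by (metis in_set_conv_nth less_Suc_eq_le)
    then show ?thesis using lmono[of 0 i] lmem[of 0] by (cases "i = 0") auto
  qed
  have ln: "l ! n = s"
  proof -
    have "s \<in> set l" using l V_def by auto
    then obtain i where "i \<le> n" "l ! i = s" using len by (metis in_set_conv_nth less_Suc_eq_le)
    then show ?thesis using lmono[of i n] lmem[of n] by (cases "i = n") auto
  qed
  \<comment> \<open>The n + 1 sorted times occupy the indices 0 to n and t follows. Hence the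
    increments below n build the past, and the increment with index n is the one from s to
    t.\<close>
  define ts where "ts = (\<lambda>i. if i \<le> n then l ! i else t)"
  define X where "X = (\<lambda>i \<omega>. W (ts (Suc i)) \<omega> - W (ts i) \<omega>)"
  have "indep_vars (\<lambda>_. borel) X {..<Suc n}"
    unfolding X_def
  proof (rule increments_indep)
    show "0 \<le> ts 0" by (simp add: ts_def l0)
    fix i assume "i < Suc n"
    then consider "i = n" | "i < n" by linarith
    then show "ts i < ts (Suc i)"
    proof cases
      case 1 then show ?thesis using ln st by (simp add: ts_def)
    next
      case 2 then show ?thesis using lmono[of i "Suc i"] by (simp add: ts_def)
    qed
  qed
  then have iv: "indep_var (PiM {..<n} (\<lambda>_. borel)) (\<lambda>\<omega>. restrict (\<lambda>i. X i \<omega>) {..<n}) (PiM {n} (\<lambda>_. borel)) (\<lambda>\<omega>. restrict (\<lambda>i. X i \<omega>) {n})"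
    by (rule indep_var_restrict) auto
  define S where "S = {f \<in> space (PiM {..<n} (\<lambda>_. borel :: real measure)). \<forall>j\<in>{..n}. l ! j \<in> U \<longrightarrow> (\<Sum>i<j. f i) \<in> Bs (l ! j)}"
  define T where "T = {f \<in> space (PiM {n} (\<lambda>_. borel :: real measure)). f n \<in> C}"
  have S: "S \<in> sets (PiM {..<n} (\<lambda>_. borel))"
  proof -
    have m: "(\<lambda>f. \<Sum>i<j. f i) \<in> borel_measurable (PiM {..<n} (\<lambda>_. borel :: real measure))" if "j \<le> n" for j
      using that by (intro borel_measurable_sum measurable_component_singleton) auto
    have "{f \<in> space (PiM {..<n} (\<lambda>_. borel :: real measure)). (\<Sum>i<j. f i) \<in> Bs (l ! j)} \<in> sets (PiM {..<n} (\<lambda>_. borel))" if "j \<le> n" for j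
      by (rule sets_Collect_mem[OF m[OF that] B])
    then show ?thesis unfolding S_def
      by (intro sets.sets_Collect_finite_All sets.sets_Collect_imp sets.sets_Collect_const) auto
  qed
  have T: "T \<in> sets (PiM {n} (\<lambda>_. borel))"
    unfolding T_def by (rule sets_Collect_mem[where L=borel]) (auto intro: measurable_component_singleton C)
  have ts1: "ts i \<ge> 0" for i using lmem st by (auto simp: ts_def)
  have Xm: "random_variable borel (X i)" for i unfolding X_def using ts1 by auto
  define R1 where "R1 = (\<lambda>\<omega>. restrict (\<lambda>i. X i \<omega>) {..<n})"
  define R2 where "R2 = (\<lambda>\<omega>. restrict (\<lambda>i. X i \<omega>) {n})"
  have D: "X n = (\<lambda>\<omega>. W t \<omega> - W s \<omega>)" by (simp add: X_def ts_def ln)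
  have e2: "R2 -` T \<inter> space M = (\<lambda>\<omega>. W t \<omega> - W s \<omega>) -` C \<inter> space M"
    by (auto simp: R2_def T_def D space_PiM)
  have prod: "prob ((R1 -` S \<inter> space M) \<inter> (R2 -` T \<inter> space M)) = prob (R1 -` S \<inter> space M) * prob (R2 -` T \<inter> space M)"
  proof -
    have "(\<lambda>x. (R1 x, R2 x)) -` (S \<times> T) \<inter> space M = (R1 -` S \<inter> space M) \<inter> (R2 -` T \<inter> space M)" by auto
    then show ?thesis using indep_varD[OF iv[folded R1_def R2_def] S T] by simp
  qed
  have R1m: "R1 -` S \<inter> space M \<in> events"
    using indep_var_rv1[OF iv[folded R1_def R2_def]] S by (rule measurable_sets)
  have Cm: "(\<lambda>\<omega>. W t \<omega> - W s \<omega>) -` C \<inter> space M \<in> events" 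
    using Xm[of n] C unfolding D by (rule measurable_sets)
  have Em: "{\<omega>\<in>space M. \<forall>u\<in>U. W u \<omega> \<in> Bs u} \<in> events"
  proof (rule sets.sets_Collect_finite_All[OF _ U(1)])
    fix u assume "u \<in> U"
    then have [measurable]: "W u \<in> borel_measurable M" using U by auto
    show "{\<omega>\<in>space M. W u \<omega> \<in> Bs u} \<in> events" using B[of u] by measurable
  qed
  have ae: "AE \<omega> in M. \<omega> \<in> R1 -` S \<inter> space M \<longleftrightarrow> \<omega> \<in> {\<omega>\<in>space M. \<forall>u\<in>U. W u \<omega> \<in> Bs u}"
    using AE_path AE_space
  proof eventually_elim
    case (elim \<omega>)
    have sum: "(\<Sum>i<j. R1 \<omega> i) = W (l ! j) \<omega>" if "j \<le> n" for j
    proof -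
      have "(\<Sum>i<j. R1 \<omega> i) = (\<Sum>i<j. W (ts (Suc i)) \<omega> - W (ts i) \<omega>)"
        using that by (intro sum.cong) (auto simp: R1_def X_def)
      also have "\<dots> = W (ts j) \<omega> - W (ts 0) \<omega>" by (rule sum_lessThan_telescope)
      finally show ?thesis using that elim(1) by (simp add: ts_def l0)
    qed
    have "\<omega> \<in> R1 -` S \<inter> space M \<longleftrightarrow> (\<forall>j\<in>{..n}. l ! j \<in> U \<longrightarrow> W (l ! j) \<omega> \<in> Bs (l ! j))"
      using elim(2) sum by (auto simp: S_def R1_def space_PiM)
    also have "\<dots> \<longleftrightarrow> (\<forall>u\<in>U. W u \<omega> \<in> Bs u)"
    proof
      assume a: "\<forall>j\<in>{..n}. l ! j \<in> U \<longrightarrow> W (l ! j) \<omega> \<in> Bs (l ! j)"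
      show "\<forall>u\<in>U. W u \<omega> \<in> Bs u"
      proof
        fix u assume "u \<in> U"
        then have "u \<in> set l" using l by (simp add: V_def)
        then obtain j where "j \<le> n" "l ! j = u" using len by (metis in_set_conv_nth less_Suc_eq_le)
        then show "W u \<omega> \<in> Bs u" using a \<open>u \<in> U\<close> by auto
      qed
    qed auto
    finally show ?case using elim(2) by auto
  qed
  have p1: "prob (R1 -` S \<inter> space M) = prob {\<omega>\<in>space M. \<forall>u\<in>U. W u \<omega> \<in> Bs u}"
    using emeasure_eq_AE[OF ae R1m Em] by (simp add: measure_def)
  have p2: "prob ((R1 -` S \<inter> space M) \<inter> (R2 -` T \<inter> space M)) = prob ({\<omega>\<in>space M. \<forall>u\<in>U. W u \<omega> \<in> Bs u} \<inter> ((\<lambda>\<omega>. W t \<omega> - W s \<omega>) -` C \<inter> space M))"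
  proof -
    have "emeasure M ((R1 -` S \<inter> space M) \<inter> (R2 -` T \<inter> space M)) = emeasure M ({\<omega>\<in>space M. \<forall>u\<in>U. W u \<omega> \<in> Bs u} \<inter> ((\<lambda>\<omega>. W t \<omega> - W s \<omega>) -` C \<inter> space M))"
    proof (rule emeasure_eq_AE)
      show "AE \<omega> in M. \<omega> \<in> (R1 -` S \<inter> space M) \<inter> (R2 -` T \<inter> space M) \<longleftrightarrow>
          \<omega> \<in> {\<omega>\<in>space M. \<forall>u\<in>U. W u \<omega> \<in> Bs u} \<inter> ((\<lambda>\<omega>. W t \<omega> - W s \<omega>) -` C \<inter> space M)"
        unfolding e2 using ae by eventually_elim auto
    qed (use R1m Cm Em e2 in auto)
    then show ?thesis by (simp add: measure_def)
  qed
  from prod show ?thesis unfolding p2 unfolding p1 e2 .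
qed

text \<open>Cylinder sets over finitely many times up to s are stable under intersection and
  generate the filtration, so the independence of the increment passes from them to the whole
  sigma-algebra.\<close>

lemma filtration_indep_increment:
  assumes st: "0 \<le> s" "s < t" and A: "A \<in> sets (bm_filtration M W s)" and C: "C \<in> sets borel"
  shows "prob (A \<inter> ((\<lambda>\<omega>. W t \<omega> - W s \<omega>) -` C \<inter> space M)) = prob A * prob ((\<lambda>\<omega>. W t \<omega> - W s \<omega>) -` C \<inter> space M)"
proof -
  define G where "G = {{\<omega>\<in>space M. \<forall>u\<in>U. W u \<omega> \<in> Bs u} | U Bs. finite U \<and> U \<subseteq> {0..s} \<and> (\<forall>u. Bs u \<in> sets (borel :: real measure))}"
  define E where "E = (\<lambda>\<omega>. W t \<omega> - W s \<omega>) -` C \<inter> space M"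
  have [measurable]: "W t \<in> borel_measurable M" "W s \<in> borel_measurable M" using st by auto
  have Em: "E \<in> events" unfolding E_def using C by measurable
  have Gm: "G \<subseteq> events"
  proof
    fix x assume "x \<in> G"
    then obtain U Bs where x: "x = {\<omega>\<in>space M. \<forall>u\<in>U. W u \<omega> \<in> Bs u}" and U: "finite U" "U \<subseteq> {0..s}" and B: "\<And>u. Bs u \<in> sets borel"
      unfolding G_def by blast
    show "x \<in> events" unfolding x
    proof (rule sets.sets_Collect_finite_All[OF _ U(1)])
      fix u assume "u \<in> U"
      then have [measurable]: "W u \<in> borel_measurable M" using U by auto
      show "{\<omega>\<in>space M. W u \<omega> \<in> Bs u} \<in> events" using B[of u] by measurable
    qed
  qed
  have "Int_stable G"
  proof (rule Int_stableI)
    fix a b assume "a \<in> G" "b \<in> G"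
    then obtain U Bs V Cs where a: "a = {\<omega>\<in>space M. \<forall>u\<in>U. W u \<omega> \<in> Bs u}" "finite U" "U \<subseteq> {0..s}" "\<And>u. Bs u \<in> sets borel"
      and b: "b = {\<omega>\<in>space M. \<forall>u\<in>V. W u \<omega> \<in> Cs u}" "finite V" "V \<subseteq> {0..s}" "\<And>u. Cs u \<in> sets borel"
      unfolding G_def by blast
    \<comment> \<open>A time that occurs in only one of the two sets carries the trivial constraint
      \<open>UNIV\<close> from the other.\<close>
    have "a \<inter> b = {\<omega>\<in>space M. \<forall>u\<in>U \<union> V. W u \<omega> \<in> (if u \<in> U then Bs u else UNIV) \<inter> (if u \<in> V then Cs u else UNIV)}"
      unfolding a(1) b(1) by auto
    then show "a \<inter> b \<in> G" unfolding G_def using a b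
      by (intro CollectI exI[of _ "U \<union> V"] exI[of _ "\<lambda>u. (if u \<in> U then Bs u else UNIV) \<inter> (if u \<in> V then Cs u else UNIV)"]) auto
  qed
  moreover have "Int_stable {E}" by (simp add: Int_stable_def)
  moreover have "indep_set G {E}"
    unfolding indep_sets2_eq
  proof (intro conjI ballI)
    fix a b assume "a \<in> G" "b \<in> {E}"
    then obtain U Bs where a: "a = {\<omega>\<in>space M. \<forall>u\<in>U. W u \<omega> \<in> Bs u}" "finite U" "U \<subseteq> {0..s}" "\<And>u. Bs u \<in> sets borel" and b: "b = E"
      unfolding G_def by blast
    show "prob (a \<inter> b) = prob a * prob b"
      unfolding a(1) b E_def by (rule cylinder_indep_increment[OF st a(2,3,4) C])
  qed (use Gm Em in auto)
  ultimately have "indep_set (sigma_sets (space M) G) (sigma_sets (space M) {E})"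
    by (intro indep_set_sigma_sets)
  moreover have "sets (bm_filtration M W s) \<subseteq> sigma_sets (space M) G"
    unfolding sets_bm_filtration
  proof (rule sigma_sets_mono)
    show "(\<Union>u\<in>{0..s}. {W u -` B \<inter> space M | B. B \<in> sets borel}) \<subseteq> sigma_sets (space M) G"
    proof safe
      fix u B assume u: "u \<in> {0..s}" and B: "B \<in> sets (borel :: real measure)"
      have "W u -` B \<inter> space M = {\<omega>\<in>space M. \<forall>v\<in>{u}. W v \<omega> \<in> (\<lambda>_. B) v}" by auto
      then have "W u -` B \<inter> space M \<in> G" unfolding G_def using u B
        by (intro CollectI exI[of _ "{u}"] exI[of _ "\<lambda>_. B"]) auto
      then show "W u -` B \<inter> space M \<in> sigma_sets (space M) G" by (rule sigma_sets.Basic)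
    qed
  qed
  ultimately show ?thesis using A unfolding indep_sets2_eq E_def[symmetric]
    by (auto intro: sigma_sets.Basic)
qed

text \<open>The event A enters through its indicator, paired with \<open>W s\<close> into one random
  vector Z that is independent of the increment. The expectation is then an integral over a product
  law, and Fubini integrates out the increment first.\<close>

theorem markov_property:
  fixes \<phi> :: "real \<Rightarrow> real"
  assumes st: "0 \<le> s" "s < t" and A: "A \<in> sets (bm_filtration M W s)"
    and \<phi>[measurable]: "\<phi> \<in> borel_measurable borel" and int: "integrable M (\<lambda>\<omega>. \<phi> (W t \<omega>))"
  defines "\<psi> \<equiv> \<lambda>x. LBINT y. \<phi> (x + y) * gauss (t - s) y"
  shows "\<psi> \<in> borel_measurable borel" "integrable M (\<lambda>\<omega>. indicator A \<omega> * \<psi> (W s \<omega>))"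
    "expectation (\<lambda>\<omega>. indicator A \<omega> * \<phi> (W t \<omega>)) = expectation (\<lambda>\<omega>. indicator A \<omega> * \<psi> (W s \<omega>))"
proof -
  have [measurable]: "W t \<in> borel_measurable M" "W s \<in> borel_measurable M" using st by auto
  have AM[measurable]: "A \<in> events" using A subalgebra_bm_filtration[of s] by (auto simp: subalgebra_def)
  show m\<psi>[measurable]: "\<psi> \<in> borel_measurable borel" unfolding \<psi>_def by measurable
  \<comment> \<open>\<open>indep_var\<close> wants both variables of the same type, hence the dummy component of \<open>D\<close>.\<close>
  define D where "D = (\<lambda>\<omega>. (W t \<omega> - W s \<omega>, 0 :: real))"
  define Z where "Z = (\<lambda>\<omega>. (indicator A \<omega> :: real, W s \<omega>))"
  have Dm[measurable]: "D \<in> measurable M (borel \<Otimes>\<^sub>M borel)" unfolding D_def by measurable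
  have Zm[measurable]: "Z \<in> measurable M (borel \<Otimes>\<^sub>M borel)" unfolding Z_def by measurable
  have ZF: "Z \<in> measurable (bm_filtration M W s) (borel \<Otimes>\<^sub>M borel)"
    unfolding Z_def using A W_adapted[OF st(1) order_refl] by (intro measurable_Pair borel_measurable_indicator)
  have "indep_var (borel \<Otimes>\<^sub>M borel) Z (borel \<Otimes>\<^sub>M borel) D"
    unfolding indep_var_eq
  proof (intro conjI)
    have 1: "{Z -` A \<inter> space M |A. A \<in> sets (borel \<Otimes>\<^sub>M borel)} \<subseteq> sets (bm_filtration M W s)"
      using measurable_sets[OF ZF] by auto
    have "indep_set {Z -` A \<inter> space M |A. A \<in> sets (borel \<Otimes>\<^sub>M borel)} {D -` A \<inter> space M |A. A \<in> sets (borel \<Otimes>\<^sub>M borel)}"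
      unfolding indep_sets2_eq
    proof (intro conjI ballI)
      fix a b assume "a \<in> {Z -` A \<inter> space M |A. A \<in> sets (borel \<Otimes>\<^sub>M borel)}" "b \<in> {D -` A \<inter> space M |A. A \<in> sets (borel \<Otimes>\<^sub>M borel)}"
      then obtain C where a: "a \<in> sets (bm_filtration M W s)" and b: "b = D -` C \<inter> space M" "C \<in> sets (borel \<Otimes>\<^sub>M borel)" using 1 by auto
      have "(\<lambda>x. (x, 0 :: real)) -` C \<inter> space borel \<in> sets (borel :: real measure)"
        using b(2) by (intro measurable_sets[of _ _ "borel \<Otimes>\<^sub>M borel"]) auto
      then have "(\<lambda>x. (x, 0 :: real)) -` C \<in> sets (borel :: real measure)" by simp
      moreover have "b = (\<lambda>\<omega>. W t \<omega> - W s \<omega>) -` ((\<lambda>x. (x, 0 :: real)) -` C) \<inter> space M" by (auto simp: b D_def)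
      ultimately show "prob (a \<inter> b) = prob a * prob b"
        using filtration_indep_increment[OF st a] by simp
    qed (use measurable_sets[OF Zm] measurable_sets[OF Dm] in auto)
    then show "indep_set (sigma_sets (space M) {Z -` A \<inter> space M |A. A \<in> sets (borel \<Otimes>\<^sub>M borel)}) (sigma_sets (space M) {D -` A \<inter> space M |A. A \<in> sets (borel \<Otimes>\<^sub>M borel)})"
    proof (rule indep_set_sigma_sets)
      show "Int_stable {Z -` A \<inter> space M |A. A \<in> sets (borel \<Otimes>\<^sub>M borel)}"
        by (rule Int_stable_vimage)
      show "Int_stable {D -` A \<inter> space M |A. A \<in> sets (borel \<Otimes>\<^sub>M borel)}"
        by (rule Int_stable_vimage)
    qed
  qed (rule Zm Dm)+
  then have joint: "distr M (borel \<Otimes>\<^sub>M borel) Z \<Otimes>\<^sub>M distr M (borel \<Otimes>\<^sub>M borel) D = distr M ((borel \<Otimes>\<^sub>M borel) \<Otimes>\<^sub>M (borel \<Otimes>\<^sub>M borel)) (\<lambda>\<omega>. (Z \<omega>, D \<omega>))"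
    by (simp add: indep_var_distribution_eq)
  interpret PZ: prob_space "distr M (borel \<Otimes>\<^sub>M borel) Z" by (rule prob_space_distr) measurable
  interpret PD: prob_space "distr M (borel \<Otimes>\<^sub>M borel) D" by (rule prob_space_distr) measurable
  interpret P: pair_prob_space "distr M (borel \<Otimes>\<^sub>M borel) Z" "distr M (borel \<Otimes>\<^sub>M borel) D" ..
  define F where "F = (\<lambda>q :: (real \<times> real) \<times> (real \<times> real). fst (fst q) * \<phi> (snd (fst q) + fst (snd q)))"
  have Fm[measurable]: "F \<in> borel_measurable ((borel \<Otimes>\<^sub>M borel) \<Otimes>\<^sub>M (borel \<Otimes>\<^sub>M borel))" unfolding F_def by measurable
  have FZ: "F (Z \<omega>, D \<omega>) = indicator A \<omega> * \<phi> (W t \<omega>)" for \<omega> by (simp add: F_def Z_def D_def)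
  have "integrable M (\<lambda>\<omega>. indicator A \<omega> * \<phi> (W t \<omega>))"
    using integrable_mult_indicator[OF AM int] by simp
  then have iF: "integrable (distr M (borel \<Otimes>\<^sub>M borel) Z \<Otimes>\<^sub>M distr M (borel \<Otimes>\<^sub>M borel) D) F"
    unfolding joint by (subst integrable_distr_eq) (simp_all add: FZ)
  have inner: "(\<integral>y. F (z, y) \<partial>distr M (borel \<Otimes>\<^sub>M borel) D) = fst z * \<psi> (snd z)" for z
  proof -
    have "(\<integral>y. F (z, y) \<partial>distr M (borel \<Otimes>\<^sub>M borel) D) = expectation (\<lambda>\<omega>. F (z, D \<omega>))"
      by (subst integral_distr) (auto simp: F_def)
    also have "\<dots> = (LBINT y. F (z, (y, 0)) * gauss (t - s) y)"
      unfolding D_def by (rule increment_integral(1)[OF st, of "\<lambda>y. F (z, (y, 0))"]) (simp add: F_def)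
    finally show ?thesis by (simp add: F_def \<psi>_def mult.assoc)
  qed
  have "integrable (distr M (borel \<Otimes>\<^sub>M borel) Z) (\<lambda>z. fst z * \<psi> (snd z))"
    using P.integrable_fst'[OF iF] by (simp add: inner)
  then show "integrable M (\<lambda>\<omega>. indicator A \<omega> * \<psi> (W s \<omega>))"
    by (subst (asm) integrable_distr_eq) (auto simp: Z_def)
  have "expectation (\<lambda>\<omega>. indicator A \<omega> * \<phi> (W t \<omega>)) = integral\<^sup>L (distr M (borel \<Otimes>\<^sub>M borel) Z \<Otimes>\<^sub>M distr M (borel \<Otimes>\<^sub>M borel) D) F"
    unfolding joint by (subst integral_distr) (auto simp: FZ)
  also have "\<dots> = (\<integral>z. fst z * \<psi> (snd z) \<partial>distr M (borel \<Otimes>\<^sub>M borel) Z)"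
    using P.integral_fst'[OF iF] by (simp add: inner)
  also have "\<dots> = expectation (\<lambda>\<omega>. indicator A \<omega> * \<psi> (W s \<omega>))"
    by (subst integral_distr) (auto simp: Z_def)
  finally show "expectation (\<lambda>\<omega>. indicator A \<omega> * \<phi> (W t \<omega>)) = expectation (\<lambda>\<omega>. indicator A \<omega> * \<psi> (W s \<omega>))" .
qed

corollary cond_exp_markov:
  fixes \<phi> :: "real \<Rightarrow> real"
  assumes st: "0 \<le> s" "s < t" and \<phi>[measurable]: "\<phi> \<in> borel_measurable borel"
    and int: "integrable M (\<lambda>\<omega>. \<phi> (W t \<omega>))"
  shows "AE \<omega> in M. real_cond_exp M (bm_filtration M W s) (\<lambda>\<omega>. \<phi> (W t \<omega>)) \<omega> = (LBINT y. \<phi> (W s \<omega> + y) * gauss (t - s) y)"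
proof -
  interpret F: finite_measure_subalgebra M "bm_filtration M W s"
    by unfold_locales (rule subalgebra_bm_filtration)
  define \<psi> where "\<psi> = (\<lambda>x. LBINT y. \<phi> (x + y) * gauss (t - s) y)"
  note mp = markov_property[OF st _ \<phi> int, folded \<psi>_def]
  have sp: "space M \<in> sets (bm_filtration M W s)" using sets.top[of "bm_filtration M W s"] by simp
  have [measurable]: "\<psi> \<in> borel_measurable borel" by (rule mp(1)[OF sp])
  have "AE \<omega> in M. real_cond_exp M (bm_filtration M W s) (\<lambda>\<omega>. \<phi> (W t \<omega>)) \<omega> = \<psi> (W s \<omega>)"
  proof (rule F.real_cond_exp_charact)
    \<comment> \<open>The whole space is a legitimate choice of A, which turns the localised
      integrability into the full one.\<close>
    show "integrable M (\<lambda>\<omega>. \<psi> (W s \<omega>))"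
      by (rule Bochner_Integration.integrable_cong[THEN iffD1, OF refl _ mp(2)[OF sp]]) (simp add: \<psi>_def)
    show "(\<lambda>\<omega>. \<psi> (W s \<omega>)) \<in> borel_measurable (bm_filtration M W s)"
      using W_adapted[OF st(1) order_refl] by measurable
    fix A assume "A \<in> sets (bm_filtration M W s)"
    from mp(3)[OF this] show "(\<integral>\<omega>\<in>A. \<phi> (W t \<omega>) \<partial>M) = (\<integral>\<omega>\<in>A. \<psi> (W s \<omega>) \<partial>M)"
      by (simp add: set_lebesgue_integral_def \<psi>_def)
  qed (rule int)
  then show ?thesis by (simp add: \<psi>_def)
qed

end

section \<open>Heat polynomials as Hermite sums\<close>

lemma lborel_integral_Icc_eq_integral:
  fixes \<phi> :: "real \<Rightarrow> real"
  shows "continuous_on {a..b} \<phi> \<Longrightarrow> (LBINT u:{a..b}. \<phi> u) = integral {a..b} \<phi>"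
  by (intro set_borel_integral_eq_integral borel_integrable_atLeastAtMost')

lemma continuous_on_poly_hpoly: "continuous_on UNIV (\<lambda>(t, x). poly (hpoly k t) x)"
proof (induction k rule: induct_nat_012)
  case (ge2 k)
  then show ?case
    unfolding case_prod_unfold poly_hpoly_Suc_Suc by (intro continuous_intros) auto
qed (auto simp: case_prod_unfold intro!: continuous_intros)

definition heat_sum :: "(nat \<Rightarrow> real) \<Rightarrow> nat \<Rightarrow> real \<Rightarrow> real \<Rightarrow> real" where
  "heat_sum a n t x = (\<Sum>k\<le>n. a k * poly (hpoly k t) x)"

text \<open>The x-derivative of \<open>heat_sum\<close>, reindexed by H_(k+1)' = (k + 1) H_k so that
  the range of summation shows the degree n - 1.\<close>

definition heat_sum_dx :: "(nat \<Rightarrow> real) \<Rightarrow> nat \<Rightarrow> real \<Rightarrow> real \<Rightarrow> real" where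
  "heat_sum_dx a n t x = (\<Sum>k<n. a (Suc k) * real (Suc k) * poly (hpoly k t) x)"

lemma heat_sum_has_derivative: "(heat_sum a n t has_real_derivative heat_sum_dx a n t x) (at x)"
proof -
  have "((\<lambda>x. a 0 * 1 + (\<Sum>k<n. a (Suc k) * poly (hpoly (Suc k) t) x)) has_real_derivative
     0 + (\<Sum>k<n. a (Suc k) * (real (Suc k) * poly (hpoly k t) x))) (at x)"
    by (intro DERIV_add DERIV_const DERIV_sum DERIV_cmult poly_hpoly_has_derivative_x)
  moreover have "heat_sum a n t = (\<lambda>x. a 0 * 1 + (\<Sum>k<n. a (Suc k) * poly (hpoly (Suc k) t) x))"
    by (rule ext) (simp add: heat_sum_def sum.atMost_shift del: hpoly.simps(2,3))
  ultimately show ?thesis by (simp add: heat_sum_dx_def mult.assoc del: of_nat_Suc)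
qed

lemma heat_sum_poly: "heat_sum a n t x = poly (\<Sum>k\<le>n. smult (a k) (hpoly k t)) x"
  by (simp add: heat_sum_def poly_sum)

lemma heat_sum_measurable[measurable]: "heat_sum a n t \<in> borel_measurable borel"
proof -
  have "continuous_on UNIV (heat_sum a n t)" unfolding heat_sum_poly[abs_def] by (intro continuous_intros)
  then show ?thesis by (rule borel_measurable_continuous_onI)
qed

lemma integrable_heat_sum: "t > 0 \<Longrightarrow> integrable lborel (\<lambda>x. heat_sum a n t x * gauss t x)"
  unfolding heat_sum_poly by (rule integrable_gauss_poly)

lemma heat_sum_convolution:
  assumes u: "u > 0"
  shows "(LBINT y. heat_sum a n (s + u) (x + y) * gauss u y) = heat_sum a n s x"
proof -
  have i: "integrable lborel (\<lambda>y. poly (hpoly k (s + u)) (x + y) * gauss u y)" for k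
    using integrable_gauss_poly[OF u, of "pcompose (hpoly k (s + u)) [:x, 1:]"] by (simp add: poly_pcompose)
  have "(LBINT y. heat_sum a n (s + u) (x + y) * gauss u y) = (LBINT y. (\<Sum>k\<le>n. a k * (poly (hpoly k (s + u)) (x + y) * gauss u y)))"
    by (simp add: heat_sum_def sum_distrib_right mult.assoc)
  also have "\<dots> = (\<Sum>k\<le>n. a k * (LBINT y. poly (hpoly k (s + u)) (x + y) * gauss u y))"
    by (subst Bochner_Integration.integral_sum) (auto intro: i)
  finally show ?thesis by (simp add: hpoly_convolution[OF u] heat_sum_def)
qed

lemma heat_sum_caloric:
  assumes "s < t"
  shows "heat_sum a n s x = (LBINT w. heat_sum a n t w * gauss (t - s) (w - x))"
  using heat_sum_convolution[of "t - s" a n s x] assms by (simp add: gauss_convolution_shift)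

lemma x_expansion_heat_sum: "x_expansion (heat_sum a n) (heat_sum_dx a n)"
proof -
  have "x_expansion (heat_sum a n) (\<lambda>s x. deriv (heat_sum a n s) x)"
    by (rule caloric_x_expansion) (auto intro: integrable_heat_sum heat_sum_caloric)
  moreover have "(\<lambda>s x. deriv (heat_sum a n s) x) = heat_sum_dx a n"
    by (intro ext DERIV_imp_deriv heat_sum_has_derivative)
  ultimately show ?thesis by simp
qed

text \<open>With r^2 = 1 + t + x^2, the point (t, x) lies in the parabolic ball of radius r, so each
  Hermite polynomial of index k is of order r^k, and the indices that occur are at most n -
  1.\<close>

lemma heat_sum_dx_bound:
  "\<exists>C>0. \<forall>t\<ge>0. \<forall>x. (heat_sum_dx a n t x)\<^sup>2 \<le> C * (1 + t + x\<^sup>2) ^ (n - 1)"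
proof -
  have "\<exists>K\<ge>0. \<forall>t\<ge>0. \<forall>x r. \<bar>x\<bar> \<le> r \<and> t \<le> r\<^sup>2 \<longrightarrow> \<bar>poly (hpoly k t) x\<bar> \<le> K * r ^ k" for k
    by (rule hpoly_bound)
  then obtain K where K: "\<And>k. K k \<ge> 0" "\<And>k t x r. t\<ge>0 \<Longrightarrow> \<bar>x\<bar> \<le> r \<Longrightarrow> t \<le> r\<^sup>2 \<Longrightarrow> \<bar>poly (hpoly k t) x\<bar> \<le> K k * r ^ k"
    by metis
  define L where "L = (\<Sum>k<n. \<bar>a (Suc k) * real (Suc k)\<bar> * K k)"
  have L0: "L \<ge> 0" unfolding L_def using K by (intro sum_nonneg) auto
  have "(heat_sum_dx a n t x)\<^sup>2 \<le> (L\<^sup>2 + 1) * (1 + t + x\<^sup>2) ^ (n - 1)" if t: "t \<ge> 0" for t x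
  proof -
    define r where "r = sqrt (1 + t + x\<^sup>2)"
    have r2: "r\<^sup>2 = 1 + t + x\<^sup>2" unfolding r_def using t by (intro real_sqrt_pow2) (auto intro!: add_nonneg_nonneg)
    \<comment> \<open>The summand 1 in the weight enters here: r at least 1 lets the highest power
      dominate all lower ones.\<close>
    have r1: "r \<ge> 1" unfolding r_def using t by (auto simp: real_sqrt_ge_1_iff)
    have xr: "\<bar>x\<bar> \<le> r" unfolding r_def using t by (intro real_le_rsqrt) auto
    have "\<bar>heat_sum_dx a n t x\<bar> \<le> (\<Sum>k<n. \<bar>a (Suc k) * real (Suc k)\<bar> * \<bar>poly (hpoly k t) x\<bar>)"
      unfolding heat_sum_dx_def abs_mult[symmetric] by (rule sum_abs)
    also have "\<dots> \<le> (\<Sum>k<n. \<bar>a (Suc k) * real (Suc k)\<bar> * (K k * r ^ (n - 1)))"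
    proof (intro sum_mono mult_left_mono)
      fix k assume k: "k \<in> {..<n}"
      have "\<bar>poly (hpoly k t) x\<bar> \<le> K k * r ^ k" using K(2)[OF t xr] r2 by auto
      also have "\<dots> \<le> K k * r ^ (n - 1)" using K(1) r1 k by (intro mult_left_mono power_increasing) auto
      finally show "\<bar>poly (hpoly k t) x\<bar> \<le> K k * r ^ (n - 1)" .
    qed auto
    also have "\<dots> = L * r ^ (n - 1)" by (simp add: L_def sum_distrib_right mult.assoc)
    finally have "\<bar>heat_sum_dx a n t x\<bar>\<^sup>2 \<le> (L * r ^ (n - 1))\<^sup>2" by (intro power_mono) auto
    also have "\<dots> = L\<^sup>2 * (1 + t + x\<^sup>2) ^ (n - 1)" by (simp add: power_mult_distrib r2[symmetric] power_mult[symmetric] mult.commute)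
    also have "\<dots> \<le> (L\<^sup>2 + 1) * (1 + t + x\<^sup>2) ^ (n - 1)" using t by (intro mult_right_mono zero_le_power) (auto intro!: add_nonneg_nonneg)
    finally show ?thesis by simp
  qed
  then show ?thesis by (intro exI[of _ "L\<^sup>2 + 1"]) (auto intro: add_nonneg_pos)
qed

section \<open>Caloric polynomials are determined by their values at time 0\<close>

lemma coeff_hpoly_differentiable: "\<exists>d. ((\<lambda>t. coeff (hpoly k t) j) has_real_derivative d) (at t)"
proof (induction k arbitrary: j rule: induct_nat_012)
  case (ge2 k)
  obtain d1 where d1: "((\<lambda>t. coeff (hpoly k t) j) has_real_derivative d1) (at t)" using ge2(1) by blast
  obtain d2 where d2: "((\<lambda>t. coeff (hpoly (Suc k) t) (j - 1)) has_real_derivative d2) (at t)" using ge2(2) by blast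
  have "coeff (hpoly (Suc (Suc k)) t) j = (if j = 0 then 0 else coeff (hpoly (Suc k) t) (j - 1)) - real (Suc k) * t * coeff (hpoly k t) j" for t
    by (simp add: coeff_pCons split: nat.split)
  moreover have "\<exists>d. ((\<lambda>t. (if j = 0 then 0 else coeff (hpoly (Suc k) t) (j - 1)) - real (Suc k) * t * coeff (hpoly k t) j) has_real_derivative d) (at t)"
  proof -
    have "\<exists>e. ((\<lambda>t. if j = 0 then 0 else coeff (hpoly (Suc k) t) (j - 1)) has_real_derivative e) (at t)"
      using d2 DERIV_const[of 0] by (cases "j = 0") (simp_all only: if_True if_False simp_thms, blast+)
    then obtain e where e: "((\<lambda>t. if j = 0 then 0 else coeff (hpoly (Suc k) t) (j - 1)) has_real_derivative e) (at t)" ..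
    show ?thesis
      by (rule exI, rule DERIV_diff[OF e DERIV_mult[OF DERIV_cmult[OF DERIV_ident] d1]])
  qed
  ultimately show ?case by simp
qed (auto intro!: exI[of _ 0])

text \<open>Comparing coefficients in \<open>x\<close>, the heat equation expresses \<open>q\<^sub>j'\<close> through \<open>q\<^sub>j\<^sub>+\<^sub>2\<close>,
  so the \<open>q\<^sub>j\<close> vanish from the top degree downwards.\<close>

lemma caloric_poly_zero:
  fixes R :: "real \<Rightarrow> real poly"
  assumes deg: "\<And>t. degree (R t) \<le> N"
    and diff: "\<And>t j. \<exists>d. ((\<lambda>t. coeff (R t) j) has_real_derivative d) (at t)"
    and heat: "\<And>t x. ((\<lambda>t. poly (R t) x) has_real_derivative - (1/2) * poly (pderiv (pderiv (R t))) x) (at t)"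
    and init: "R 0 = 0"
  shows "R t = 0"
proof -
  define d where "d = (\<lambda>t j. deriv (\<lambda>t. coeff (R t) j) t)"
  have d: "((\<lambda>t. coeff (R t) j) has_real_derivative d t j) (at t)" for t j
  proof -
    obtain e where e: "((\<lambda>t. coeff (R t) j) has_real_derivative e) (at t)" using diff by blast
    then show ?thesis unfolding d_def by (simp add: DERIV_imp_deriv[OF e])
  qed
  have Rsum: "poly (R t) x = (\<Sum>j\<le>N. coeff (R t) j * x ^ j)" for t x
    unfolding poly_altdef using deg[of t] by (intro sum.mono_neutral_left) (auto simp: coeff_eq_0)
  have eq: "d t j = - (1/2) * coeff (pderiv (pderiv (R t))) j" if j: "j \<le> N" for t j
  proof -
    have "poly (\<Sum>j\<le>N. monom (d t j) j) x = poly (smult (- (1/2)) (pderiv (pderiv (R t)))) x" for x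
    proof -
      have "((\<lambda>t. poly (R t) x) has_real_derivative (\<Sum>j\<le>N. d t j * x ^ j)) (at t)"
        unfolding Rsum by (intro DERIV_sum DERIV_cmult_right d)
      from DERIV_unique[OF this heat] show ?thesis by (simp add: poly_sum poly_monom)
    qed
    then have "(\<Sum>j\<le>N. monom (d t j) j) = smult (- (1/2)) (pderiv (pderiv (R t)))"
      by (simp add: poly_eq_poly_eq_iff[symmetric] fun_eq_iff)
    then have "coeff (\<Sum>j\<le>N. monom (d t j) j) j = coeff (smult (- (1/2)) (pderiv (pderiv (R t)))) j" by simp
    then show ?thesis using j by (simp add: coeff_sum)
  qed
  have zero: "\<forall>t. coeff (R t) j = 0" for j
  proof (induction "Suc N - j" arbitrary: j rule: less_induct)
    case less
    show ?case
    proof (cases "j \<le> N")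
      case False
      then have "degree (R t) < j" for t using deg[of t] by linarith
      then show ?thesis by (simp add: coeff_eq_0)
    next
      case True
      have "\<forall>t. coeff (R t) (Suc (Suc j)) = 0" using True by (intro less) auto
      then have "d t j = 0" for t using eq[OF True] by (simp add: coeff_pderiv)
      then have "((\<lambda>t. coeff (R t) j) has_real_derivative 0) (at t)" for t using d[of j t] by simp
      then have "coeff (R t) j = coeff (R 0) j" for t using DERIV_isconst_all[of "\<lambda>t. coeff (R t) j" t 0] by simp
      then show ?thesis by (simp add: init)
    qed
  qed
  then show ?thesis by (simp add: poly_eq_iff)
qed

lemma poly_hpoly_0: "hpoly k 0 = monom 1 k"
  by (induction k rule: induct_nat_012) (auto simp: monom_Suc one_pCons monom_0)

lemma hpoly_sum_heat_equation:
  "((\<lambda>t. poly (\<Sum>k\<le>n. smult (a k) (hpoly k t)) x) has_real_derivative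
     - (1/2) * poly (pderiv (pderiv (\<Sum>k\<le>n. smult (a k) (hpoly k t)))) x) (at t)"
proof -
  have pp: "pderiv (pderiv (hpoly k t)) = smult (real (k * (k - 1))) (hpoly (k - 2) t)" for k
  proof -
    consider "k = 0" | "k = 1" | l where "k = Suc (Suc l)" by (metis One_nat_def not0_implies_Suc)
    then show ?thesis
    proof cases
      case 3
      have "real (k * (k - 1)) = real (Suc (Suc l)) * real (Suc l)"
        unfolding 3 of_nat_mult[symmetric] by simp
      then show ?thesis by (simp add: 3 pderiv_hpoly pderiv_smult del: hpoly.simps(3) of_nat_Suc of_nat_mult mult_Suc)
    qed (auto simp: pderiv_pCons)
  qed
  have "((\<lambda>t. \<Sum>k\<le>n. a k * poly (hpoly k t) x) has_real_derivative (\<Sum>k\<le>n. a k * (- (1/2) * real (k * (k - 1)) * poly (hpoly (k - 2) t) x))) (at t)"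
    by (intro DERIV_sum DERIV_cmult poly_hpoly_has_derivative_t)
  moreover have "pderiv (pderiv (\<Sum>k\<le>n. smult (a k) (hpoly k t))) = (\<Sum>k\<le>n. smult (a k) (smult (real (k * (k - 1))) (hpoly (k - 2) t)))"
    by (simp add: higher_pderiv_sum[where n=1, simplified] pderiv_smult pp del: of_nat_mult)
  ultimately show ?thesis by (simp add: poly_sum sum_distrib_left mult_ac sum_divide_distrib sum_negf)
qed

text \<open>At time 0 the k-th Hermite polynomial is x^k. Hence the only candidate has the
  coefficients \<open>c 0 k\<close> of P(0, x), and its difference from P is caloric with zero
  initial values, so it vanishes.\<close>

lemma heat_polynomial_eq_heat_sum:
  assumes "heat_polynomial_deg P n"
  shows "\<exists>a. P = heat_sum a n"
proof -
  obtain c where c: "\<And>t x. P t x = (\<Sum>i\<le>n. \<Sum>j\<le>n - i. c i j * t ^ i * x ^ j)"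
    and heat: "\<And>t x. deriv (\<lambda>s. P s x) t + 1/2 * deriv (\<lambda>y. deriv (\<lambda>z. P t z) y) x = 0"
    using assms unfolding heat_polynomial_deg_def by blast
  define R where "R = (\<lambda>t. \<Sum>i\<le>n. \<Sum>j\<le>n - i. monom (c i j * t ^ i) j)"
  define S where "S = (\<lambda>t. \<Sum>k\<le>n. smult (c 0 k) (hpoly k t))"
  have PR: "P t x = poly (R t) x" for t x by (simp add: c R_def poly_sum poly_monom)
  have S: "heat_sum (c 0) n t x = poly (S t) x" for t x by (simp add: heat_sum_poly S_def)
  have dR: "\<exists>d. ((\<lambda>t. coeff (R t) j) has_real_derivative d) (at t)" for t j
  proof -
    have "coeff (R t) j = (\<Sum>i\<le>n. \<Sum>l\<le>n - i. c i l * t ^ i * of_bool (l = j))" for t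
      unfolding R_def coeff_sum coeff_monom by (intro sum.cong) auto
    then show ?thesis unfolding real_differentiable_def[symmetric] by (auto intro!: derivative_intros)
  qed
  have dS: "\<exists>d. ((\<lambda>t. coeff (S t) j) has_real_derivative d) (at t)" for t j
  proof -
    obtain d where "\<And>k. ((\<lambda>t. coeff (hpoly k t) j) has_real_derivative d k) (at t)" using coeff_hpoly_differentiable[of _ j t] by metis
    then have "((\<lambda>t. \<Sum>k\<le>n. c 0 k * coeff (hpoly k t) j) has_real_derivative (\<Sum>k\<le>n. c 0 k * d k)) (at t)"
      by (intro DERIV_sum DERIV_cmult)
    then show ?thesis by (auto simp: S_def coeff_sum)
  qed
  have hS: "((\<lambda>t. poly (S t) x) has_real_derivative - (1/2) * poly (pderiv (pderiv (S t))) x) (at t)" for t x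
    unfolding S_def by (rule hpoly_sum_heat_equation)
  have hR: "((\<lambda>t. poly (R t) x) has_real_derivative - (1/2) * poly (pderiv (pderiv (R t))) x) (at t)" for t x
  proof -
    have d1: "deriv (\<lambda>z. P t z) = (\<lambda>y. poly (pderiv (R t)) y)" for t
      unfolding PR by (rule ext) (rule DERIV_imp_deriv[OF poly_DERIV])
    have d2: "deriv (\<lambda>y. deriv (\<lambda>z. P t z) y) x = poly (pderiv (pderiv (R t))) x"
      unfolding d1 by (rule DERIV_imp_deriv[OF poly_DERIV])
    \<comment> \<open>The equation in terms of \<open>deriv\<close> does not by itself assert
      differentiability in time; that comes from the polynomial form of P.\<close>
    have "(\<lambda>s. P s x) differentiable (at t)"
      unfolding c by (auto intro!: derivative_intros)
    then have "((\<lambda>s. P s x) has_real_derivative deriv (\<lambda>s. P s x) t) (at t)"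
      using DERIV_deriv_iff_real_differentiable by blast
    moreover have "deriv (\<lambda>s. P s x) t = - (1/2) * poly (pderiv (pderiv (R t))) x"
      using heat[of x t] d2 by simp
    ultimately show ?thesis by (simp add: PR)
  qed
  have "R t - S t = 0" for t
  proof (rule caloric_poly_zero[where R="\<lambda>t. R t - S t" and N=n])
    show "degree (R t - S t) \<le> n" for t
    proof (rule degree_diff_le)
      show "degree (R t) \<le> n" unfolding R_def
        by (intro degree_sum_le finite_atMost) (auto intro!: order_trans[OF degree_monom_le])
      have dh: "degree (hpoly k t) \<le> k" for k
        by (induction k t rule: hpoly.induct)
           (auto intro!: degree_diff_le order_trans[OF degree_mult_le] order_trans[OF degree_smult_le])
      then show "degree (S t) \<le> n" unfolding S_def
        by (intro degree_sum_le finite_atMost order_trans[OF degree_smult_le])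
           (auto intro: order_trans[OF dh])
    qed
    show "\<exists>d. ((\<lambda>t. coeff (R t - S t) j) has_real_derivative d) (at t)" for t j
      using dR[where t=t and j=j] dS[where t=t and j=j] by (auto intro!: DERIV_diff)
    show "((\<lambda>t. poly (R t - S t) x) has_real_derivative - (1/2) * poly (pderiv (pderiv (R t - S t))) x) (at t)" for t x
      using DERIV_diff[OF hR[of x t] hS[of x t]] by (simp add: pderiv_diff algebra_simps)
    \<comment> \<open>At time 0 only the terms with i = 0 survive, because 0 ^ 0 = 1.\<close>
    have "R 0 = (\<Sum>i\<le>n. if i = 0 then \<Sum>j\<le>n. monom (c 0 j) j else 0)"
      unfolding R_def by (intro sum.cong) (auto simp: power_0_left monom_0)
    then show "R 0 - S 0 = 0" by (simp add: S_def poly_hpoly_0 smult_monom)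
  qed
  then have "P = heat_sum (c 0) n" by (simp add: fun_eq_iff PR S)
  then show ?thesis by blast
qed

section \<open>Heat polynomials of Brownian motion\<close>

text \<open>The last argument is the exponent itself, so condition (C) is the instance n - 1. One
  null set serves all pairs s, t.\<close>

abbreviation (in brownian) variation_growth :: "(real \<Rightarrow> 'a \<Rightarrow> real) \<Rightarrow> real \<Rightarrow> nat \<Rightarrow> bool" where
  "variation_growth A C n \<equiv> AE \<omega> in M. \<forall>s t. 0 < s \<longrightarrow> s \<le> t \<longrightarrow>
     A t \<omega> - C * (LBINT u:{0..t}. (1 + u + (W u \<omega>)\<^sup>2) ^ n)
     \<le> A s \<omega> - C * (LBINT u:{0..s}. (1 + u + (W u \<omega>)\<^sup>2) ^ n)"

context brownian
begin

text \<open>If convergence in probability failed, there would be partitions with meshes below 2^-m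
  whose exceptional events all have probability at least d. Almost sure convergence along this very
  sequence forces the probabilities to 0 by dominated convergence.\<close>

lemma qv_limitI_AE:
  assumes X: "\<And>u. u \<in> {s..t} \<Longrightarrow> X u \<in> borel_measurable M" and Q: "Q \<in> borel_measurable M"
    and ae: "\<And>p k. (\<And>m. partition_of s t (p m) (k m)) \<Longrightarrow> (\<And>m. mesh (p m) (k m) < (1/2) ^ m) \<Longrightarrow>
      AE \<omega> in M. (\<lambda>m. \<Sum>i<k m. (X (p m (Suc i)) \<omega> - X (p m i) \<omega>)\<^sup>2) \<longlonglongrightarrow> Q \<omega>"
  shows "qv_limit M X s t Q"
  unfolding qv_limit_def
proof (intro conjI allI impI Q)
  fix e d :: real assume e: "0 < e" and d: "0 < d"
  define bad where "bad = (\<lambda>p k. {\<omega>\<in>space M. \<bar>(\<Sum>i<k. (X (p (Suc i)) \<omega> - X (p i) \<omega>)\<^sup>2) - Q \<omega>\<bar> > e})"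
  show "\<exists>\<eta>>0. \<forall>p k. partition_of s t p k \<and> mesh p k < \<eta> \<longrightarrow>
        measure M {\<omega>\<in>space M. \<bar>(\<Sum>i<k. (X (p (Suc i)) \<omega> - X (p i) \<omega>)\<^sup>2) - Q \<omega>\<bar> > e} < d"
  proof (rule ccontr)
    assume "\<not> ?thesis"
    then have "\<forall>\<eta>>0. \<exists>p k. partition_of s t p k \<and> mesh p k < \<eta> \<and> d \<le> measure M (bad p k)"
      unfolding bad_def by (meson not_less)
    then have "\<forall>m. \<exists>p k. partition_of s t p k \<and> mesh p k < (1/2) ^ m \<and> d \<le> measure M (bad p k)" by simp
    then obtain p k where p: "\<And>m :: nat. partition_of s t (p m) (k m)" and mesh: "\<And>m. mesh (p m) (k m) < (1/2) ^ m"
      and bad: "\<And>m. d \<le> measure M (bad (p m) (k m))"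
      by metis
    note [measurable] = Q
    have Xm: "X (p m i) \<in> borel_measurable M" if "i \<le> k m" for m i
      using X[OF partition_of_range[OF p that]] .
    have Sm: "(\<lambda>\<omega>. \<Sum>i<k m. (X (p m (Suc i)) \<omega> - X (p m i) \<omega>)\<^sup>2) \<in> borel_measurable M" for m
      using Xm[of _ m] by (intro borel_measurable_sum borel_measurable_power borel_measurable_diff) auto
    have bm: "bad (p m) (k m) \<in> events" for m
      unfolding bad_def using Sm[of m] by measurable
    have "(\<lambda>m. \<integral>\<omega>. indicator (bad (p m) (k m)) \<omega> \<partial>M) \<longlonglongrightarrow> (\<integral>\<omega>. (0::real) \<partial>M)"
    proof (rule integral_dominated_convergence[where w="\<lambda>_. 1"])
      show "AE \<omega> in M. (\<lambda>m. indicator (bad (p m) (k m)) \<omega> :: real) \<longlonglongrightarrow> 0"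
        using ae[OF p mesh]
      proof eventually_elim
        case (elim \<omega>)
        from LIMSEQ_D[OF this e] obtain N where N: "\<And>m. m \<ge> N \<Longrightarrow> \<bar>(\<Sum>i<k m. (X (p m (Suc i)) \<omega> - X (p m i) \<omega>)\<^sup>2) - Q \<omega>\<bar> < e" by auto
        have "\<forall>\<^sub>F m in sequentially. (0 :: real) = indicator (bad (p m) (k m)) \<omega>"
          unfolding eventually_sequentially
        proof (intro exI[of _ N] allI impI)
          fix m assume "N \<le> m"
          then show "(0 :: real) = indicator (bad (p m) (k m)) \<omega>" using N[of m] by (auto simp: bad_def indicator_def)
        qed
        then show ?case by (rule tendsto_cong[THEN iffD1]) simp
      qed
    qed (use bm in \<open>auto simp: indicator_def\<close>)
    then have "(\<lambda>m. measure M (bad (p m) (k m))) \<longlonglongrightarrow> 0" using bm by (simp add: Int_absorb2 sets.sets_into_space)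
    then have "d \<le> 0" using bad by (intro LIMSEQ_le_const) auto
    then show False using d by simp
  qed
qed

lemma uniform_partition:
  assumes "s < t" "e > 0"
  shows "\<exists>p k. partition_of s t p k \<and> mesh p k < e"
proof -
  obtain N :: nat where N: "(t - s) / e < real N" using reals_Archimedean2 by blast
  have N0: "N > 0" using N assms by (cases N) (auto simp: divide_less_0_iff)
  define p where "p = (\<lambda>i. s + real i * (t - s) / real N)"
  have d: "p (Suc i) - p i = (t - s) / real N" for i using N0 by (simp add: p_def field_simps)
  have "partition_of s t p N"
    unfolding partition_of_def using N0 assms(1) d by (auto simp: p_def) (simp add: field_simps)
  moreover have "mesh p N < e"
    unfolding mesh_def d using N0 N assms by (simp add: image_constant_conv lessThan_empty_iff field_simps)
  ultimately show ?thesis by blast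
qed

text \<open>Borel-Cantelli, with error and exceptional probability both below 2^-m. A single
  sequence is enough to identify Q, because limits are unique and the squared increments can be
  computed along that same sequence.\<close>

lemma qv_limit_obtain_AE:
  assumes q: "qv_limit M X s t Q" and st: "s < t" and X: "\<And>u. u \<in> {s..t} \<Longrightarrow> X u \<in> borel_measurable M"
  obtains p k where "\<And>m. partition_of s t (p m) (k m)" "\<And>m. mesh (p m) (k m) < (1/2) ^ m"
    "AE \<omega> in M. (\<lambda>m. \<Sum>i<k m. (X (p m (Suc i)) \<omega> - X (p m i) \<omega>)\<^sup>2) \<longlonglongrightarrow> Q \<omega>"
proof -
  have Q[measurable]: "Q \<in> borel_measurable M" using q by (simp add: qv_limit_def)
  define bad where "bad = (\<lambda>m p k. {\<omega>\<in>space M. \<bar>(\<Sum>i<k. (X (p (Suc i)) \<omega> - X (p i) \<omega>)\<^sup>2) - Q \<omega>\<bar> > (1/2) ^ (m::nat)})"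
  have "\<exists>p k. partition_of s t p k \<and> mesh p k < (1/2) ^ m \<and> measure M (bad m p k) < (1/2) ^ m" for m
  proof -
    have "\<forall>\<epsilon>>0. \<forall>\<delta>>0. \<exists>\<eta>>0. \<forall>p k. partition_of s t p k \<and> mesh p k < \<eta> \<longrightarrow>
        measure M {\<omega>\<in>space M. \<bar>(\<Sum>i<k. (X (p (Suc i)) \<omega> - X (p i) \<omega>)\<^sup>2) - Q \<omega>\<bar> > \<epsilon>} < \<delta>"
      using q by (simp add: qv_limit_def)
    from this[rule_format, of "(1/2) ^ m" "(1/2) ^ m"]
    obtain \<eta> where \<eta>: "\<eta> > 0" "\<And>p k. partition_of s t p k \<Longrightarrow> mesh p k < \<eta> \<Longrightarrow> measure M (bad m p k) < (1/2) ^ m"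
      unfolding bad_def by auto
    obtain p k where "partition_of s t p k" "mesh p k < min \<eta> ((1/2) ^ m)"
      using uniform_partition[OF st, of "min \<eta> ((1/2) ^ m)"] \<eta>(1) by auto
    then show ?thesis using \<eta>(2)[of p k] by auto
  qed
  then obtain p k where p: "\<And>m. partition_of s t (p m) (k m)" and mesh: "\<And>m. mesh (p m) (k m) < (1/2) ^ m"
    and bad: "\<And>m. measure M (bad m (p m) (k m)) < (1/2) ^ m" by metis
  have Xm: "X (p m i) \<in> borel_measurable M" if "i \<le> k m" for m i
    using X[OF partition_of_range[OF p that]] .
  have Sm: "(\<lambda>\<omega>. \<Sum>i<k m. (X (p m (Suc i)) \<omega> - X (p m i) \<omega>)\<^sup>2) \<in> borel_measurable M" for m
    using Xm[of _ m] by (intro borel_measurable_sum borel_measurable_power borel_measurable_diff) auto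
  have bm: "bad m (p m) (k m) \<in> events" for m
    unfolding bad_def using Sm[of m] by measurable
  have "AE \<omega> in M. \<forall>\<^sub>F m in sequentially. \<omega> \<in> space M - bad m (p m) (k m)"
  proof (rule borel_cantelli_AE1[OF bm])
    show "emeasure M (bad m (p m) (k m)) < \<infinity>" for m by (simp add: emeasure_eq_measure)
    show "summable (\<lambda>m. measure M (bad m (p m) (k m)))"
    proof (rule summable_comparison_test)
      show "\<exists>N. \<forall>m\<ge>N. norm (measure M (bad m (p m) (k m))) \<le> (1/2) ^ m" using bad by (auto intro!: less_imp_le)
      show "summable (\<lambda>m. (1/2 :: real) ^ m)" by (intro summable_geometric) simp
    qed
  qed
  then have "AE \<omega> in M. (\<lambda>m. \<Sum>i<k m. (X (p m (Suc i)) \<omega> - X (p m i) \<omega>)\<^sup>2) \<longlonglongrightarrow> Q \<omega>"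
  proof eventually_elim
    case (elim \<omega>)
    have "(\<lambda>m. (\<Sum>i<k m. (X (p m (Suc i)) \<omega> - X (p m i) \<omega>)\<^sup>2) - Q \<omega>) \<longlonglongrightarrow> 0"
    proof (rule Lim_null_comparison)
      show "\<forall>\<^sub>F m in sequentially. norm ((\<Sum>i<k m. (X (p m (Suc i)) \<omega> - X (p m i) \<omega>)\<^sup>2) - Q \<omega>) \<le> (1/2) ^ m"
        using elim by eventually_elim (auto simp: bad_def)
      show "(\<lambda>m. (1/2 :: real) ^ m) \<longlonglongrightarrow> 0" by (intro LIMSEQ_realpow_zero) auto
    qed
    then show ?case by (simp add: LIM_zero_iff)
  qed
  then show ?thesis using that p mesh by blast
qed

text \<open>The deterministic part c cancels against the expectation. What is subtracted in the end
  is the mean of the heat sum, which is its value at the origin at time 0 by averaging, and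
  therefore does not depend on t.\<close>

theorem heat_sum_martingale:
  assumes c: "\<And>t x. t > 0 \<Longrightarrow> f t x = heat_sum a n t x + c t"
  defines "X \<equiv> \<lambda>t \<omega>. f t (W t \<omega>) - expectation (\<lambda>\<omega>. f t (W t \<omega>))"
  shows "martingale_on M (bm_filtration M W) {0<..} X"
    and "t > 0 \<Longrightarrow> X t \<omega> = heat_sum a n t (W t \<omega>) - heat_sum a n 0 0"
proof -
  have iH: "integrable M (\<lambda>\<omega>. heat_sum a n t (W t \<omega>))" if "t > 0" for t
    using W_integral(2)[OF that, of "heat_sum a n t"] integrable_heat_sum[OF that] by simp
  have eH: "expectation (\<lambda>\<omega>. heat_sum a n t (W t \<omega>)) = heat_sum a n 0 0" if "t > 0" for t
    using W_integral(1)[OF that, of "heat_sum a n t"] heat_sum_convolution[OF that, of a n 0 0] by simp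
  have X: "X t \<omega> = heat_sum a n t (W t \<omega>) - heat_sum a n 0 0" if "t > 0" for t \<omega>
    using iH[OF that] eH[OF that] prob_space by (simp add: X_def c[OF that])
  then show "t > 0 \<Longrightarrow> X t \<omega> = heat_sum a n t (W t \<omega>) - heat_sum a n 0 0" .
  have X': "X t = (\<lambda>\<omega>. heat_sum a n t (W t \<omega>) - heat_sum a n 0 0)" if "t > 0" for t using X[OF that] by auto
  have Xi: "integrable M (X t)" if "t > 0" for t unfolding X'[OF that] using iH[OF that] by simp
  have Xa: "X t \<in> borel_measurable (bm_filtration M W t)" if "t > 0" for t
    unfolding X'[OF that] using that
    by (intro borel_measurable_diff borel_measurable_const measurable_compose[OF W_adapted heat_sum_measurable]) auto
  show "martingale_on M (bm_filtration M W) {0<..} X"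
    unfolding martingale_on_def
  proof (intro conjI ballI impI)
    fix s t :: real assume "s \<in> {0<..}" "t \<in> {0<..}" "s \<le> t"
    then have st: "0 < s" "0 < t" by auto
    interpret F: finite_measure_subalgebra M "bm_filtration M W s"
      by unfold_locales (rule subalgebra_bm_filtration)
    show "AE \<omega> in M. real_cond_exp M (bm_filtration M W s) (X t) \<omega> = X s \<omega>"
    proof (cases "s = t")
      case True
      then show ?thesis using F.real_cond_exp_F_meas[OF Xi[OF st(1)] Xa[OF st(1)]] by simp
    next
      case False
      then have "s < t" using \<open>s \<le> t\<close> by simp
      define \<phi> where "\<phi> = (\<lambda>x. heat_sum a n t x - heat_sum a n 0 0)"
      have [measurable]: "\<phi> \<in> borel_measurable borel" unfolding \<phi>_def by measurable
      have Xt: "X t = (\<lambda>\<omega>. \<phi> (W t \<omega>))" unfolding X'[OF st(2)] \<phi>_def ..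
      have "AE \<omega> in M. real_cond_exp M (bm_filtration M W s) (X t) \<omega> = (LBINT y. \<phi> (W s \<omega> + y) * gauss (t - s) y)"
        unfolding Xt using cond_exp_markov[OF less_imp_le[OF st(1)] \<open>s < t\<close>, of \<phi>] Xi[OF st(2)] by (simp add: Xt)
      moreover have "(LBINT y. \<phi> (x + y) * gauss (t - s) y) = heat_sum a n s x - heat_sum a n 0 0" for x
      proof -
        have u: "t - s > 0" using \<open>s < t\<close> by simp
        have "integrable lborel (\<lambda>y. heat_sum a n t (x + y) * gauss (t - s) y)"
          using integrable_gauss_poly[OF u, of "pcompose (\<Sum>k\<le>n. smult (a k) (hpoly k t)) [:x, 1:]"]
          by (simp add: heat_sum_poly poly_pcompose)
        then show ?thesis using heat_sum_convolution[OF u, of a n s x] u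
          by (simp add: \<phi>_def left_diff_distrib)
      qed
      ultimately show ?thesis by (simp add: X[OF st(1)])
    qed
  qed (use Xi Xa in auto)
qed

text \<open>The bracket is the time integral of the squared x-derivative along the path. Its
  increments over [s, t] are integrals over [s, t], so the pointwise gradient bound integrates to
  condition (C) on every continuous path.\<close>

theorem heat_sum_quadratic_variation:
  assumes X: "\<And>t \<omega>. t > 0 \<Longrightarrow> X t \<omega> = heat_sum a n t (W t \<omega>) - b"
  shows "\<exists>C>0. \<exists>A. qv_process M X A \<and>
                variation_growth A C (n - 1)"
proof -
  define h' where "h' = heat_sum_dx a n"
  define \<phi> where "\<phi> = (\<lambda>u x. (h' u x)\<^sup>2)"
  obtain C where C: "C > 0" "\<And>t x. t \<ge> 0 \<Longrightarrow> \<phi> t x \<le> C * (1 + t + x\<^sup>2) ^ (n - 1)"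
    using heat_sum_dx_bound[of a n] unfolding \<phi>_def h'_def by blast
  have \<phi>c: "continuous_on UNIV (\<lambda>(t, x). \<phi> t x)"
    unfolding \<phi>_def h'_def heat_sum_dx_def case_prod_unfold
    using continuous_on_poly_hpoly[unfolded case_prod_unfold] by (intro continuous_intros)
  have \<phi>m: "\<phi> u \<in> borel_measurable borel" for u
  proof -
    have "continuous_on UNIV (\<lambda>x. (\<lambda>(t, x). \<phi> t x) (u, x))"
      by (rule continuous_on_compose2[OF \<phi>c]) (auto intro!: continuous_intros)
    then show ?thesis by (intro borel_measurable_continuous_onI) simp
  qed
  \<comment> \<open>The limit is measurable in \<open>\<omega>\<close> even on the null set of discontinuous paths, unlike the integral it equals elsewhere.\<close>
  define A where "A = (\<lambda>t \<omega>. lim (\<lambda>N. \<Sum>i<Suc N. \<phi> (real i * t / real (Suc N)) (W (real i * t / real (Suc N)) \<omega>) * (t / real (Suc N))))"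
  have Am: "A t \<in> borel_measurable M" if "t > 0" for t
    unfolding A_def
  proof (intro borel_measurable_lim_metric borel_measurable_sum borel_measurable_times borel_measurable_const)
    fix N i
    have "W (real i * t / real (Suc N)) \<in> borel_measurable M" using that by (intro W_measurable) auto
    then show "(\<lambda>\<omega>. \<phi> (real i * t / real (Suc N)) (W (real i * t / real (Suc N)) \<omega>)) \<in> borel_measurable M"
      using \<phi>m by (rule measurable_compose)
  qed
  have path: "continuous_on {0..} (\<lambda>u. \<phi> u (w u))" if "continuous_on {0..} w" for w
  proof -
    have "continuous_on {0..} (\<lambda>u. (\<lambda>(t, x). \<phi> t x) (u, w u))"
      by (rule continuous_on_compose2[OF \<phi>c]) (use that in \<open>auto intro!: continuous_intros\<close>)
    then show ?thesis by simp
  qed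
  have Aint: "A t \<omega> = integral {0..t} (\<lambda>u. \<phi> u (W u \<omega>))" if t: "t > 0" and w: "continuous_on {0..} (\<lambda>u. W u \<omega>)" for t \<omega>
  proof -
    define p where "p = (\<lambda>N i. real i * t / real (Suc N))"
    have d: "p N (Suc i) - p N i = t / real (Suc N)" for N i
      unfolding p_def diff_divide_distrib[symmetric] by (simp add: algebra_simps)
    have "continuous_on {0..t} (\<lambda>u. \<phi> u (W u \<omega>))" by (rule continuous_on_subset[OF path[OF w]]) auto
    moreover have "partition_of 0 t (p N) (Suc N)" for N
      unfolding partition_of_def using t d by (auto simp: p_def divide_strict_right_mono simp del: of_nat_Suc)
    moreover have "mesh (p N) (Suc N) = t / real (Suc N)" for N
      unfolding mesh_def d by (simp add: image_constant_conv lessThan_empty_iff)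
    moreover have "(\<lambda>N. t / real (Suc N)) \<longlonglongrightarrow> 0"
      using tendsto_mult_right_zero[OF LIMSEQ_inverse_real_of_nat, of t] by (simp add: divide_inverse)
    ultimately have "continuous_on {0..t} (\<lambda>u. \<phi> u (W u \<omega>))" "\<And>N. partition_of 0 t (p N) (Suc N)"
      "(\<lambda>N. mesh (p N) (Suc N)) \<longlonglongrightarrow> 0" by simp_all
    then have "(\<lambda>N. \<Sum>i<Suc N. \<phi> (p N i) (W (p N i) \<omega>) * (p N (Suc i) - p N i)) \<longlonglongrightarrow> integral {0..t} (\<lambda>u. \<phi> u (W u \<omega>))"
      by (rule riemann_sums_tendsto)
    then show ?thesis unfolding A_def d unfolding p_def by (rule limI)
  qed
  have Adiff: "A t \<omega> - A s \<omega> = integral {s..t} (\<lambda>u. \<phi> u (W u \<omega>))" if "0 < s" "s \<le> t" "continuous_on {0..} (\<lambda>u. W u \<omega>)" for s t \<omega>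
  proof -
    have "integral {0..s} (\<lambda>u. \<phi> u (W u \<omega>)) + integral {s..t} (\<lambda>u. \<phi> u (W u \<omega>)) = integral {0..t} (\<lambda>u. \<phi> u (W u \<omega>))"
      using that path[OF that(3)]
      by (intro Henstock_Kurzweil_Integration.integral_combine integrable_continuous_interval) (auto elim: continuous_on_subset)
    then show ?thesis using Aint that by simp
  qed
  have Xm: "X t \<in> borel_measurable M" if "t > 0" for t
  proof -
    have "X t = (\<lambda>\<omega>. heat_sum a n t (W t \<omega>) - b)" using X[OF that] by auto
    moreover have [measurable]: "W t \<in> borel_measurable M" using that by auto
    ultimately show ?thesis by simp
  qed
  have qv: "qv_process M X A"
    unfolding qv_process_def
  proof (intro conjI allI impI)
    fix s t :: real assume st: "0 < s \<and> s < t"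
    show "qv_limit M X s t (\<lambda>\<omega>. A t \<omega> - A s \<omega>)"
    proof (rule qv_limitI_AE)
      show "(\<lambda>\<omega>. A t \<omega> - A s \<omega>) \<in> borel_measurable M" using Am[of s] Am[of t] st by auto
      fix p k assume p: "\<And>m. partition_of s t (p m) (k m)" and mesh: "\<And>m. mesh (p m) (k m) < (1/2) ^ m"
      have "AE \<omega> in M. (\<lambda>m. \<Sum>i<k m. (heat_sum a n (p m (Suc i)) (W (p m (Suc i)) \<omega>) - heat_sum a n (p m i) (W (p m i) \<omega>))\<^sup>2)
         \<longlonglongrightarrow> integral {s..t} (\<lambda>u. (h' u (W u \<omega>))\<^sup>2)"
        unfolding h'_def using st by (intro quadratic_variation_AE x_expansion_heat_sum p mesh) auto
      with AE_path show "AE \<omega> in M. (\<lambda>m. \<Sum>i<k m. (X (p m (Suc i)) \<omega> - X (p m i) \<omega>)\<^sup>2) \<longlonglongrightarrow> A t \<omega> - A s \<omega>"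
      proof eventually_elim
        case (elim \<omega>)
        have pos: "p m i > 0" if "i \<le> k m" for m i using partition_of_range[OF p that] st by auto
        have "(\<Sum>i<k m. (X (p m (Suc i)) \<omega> - X (p m i) \<omega>)\<^sup>2) =
          (\<Sum>i<k m. (heat_sum a n (p m (Suc i)) (W (p m (Suc i)) \<omega>) - heat_sum a n (p m i) (W (p m i) \<omega>))\<^sup>2)" for m
          by (intro sum.cong) (auto simp: X pos)
        then show ?case using elim st by (simp add: Adiff \<phi>_def)
      qed
    qed (use st Xm in auto)
  qed (use Xm Am in auto)
  have "variation_growth A C (n - 1)"
    using AE_path
  proof eventually_elim
    case (elim \<omega>)
    then have w: "continuous_on {0..} (\<lambda>u. W u \<omega>)" by simp
    define \<rho> where "\<rho> = (\<lambda>u. (1 + u + (W u \<omega>)\<^sup>2) ^ (n - 1))"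
    have \<rho>c: "continuous_on {0..} \<rho>" unfolding \<rho>_def by (intro continuous_intros w)
    show ?case
    proof (intro allI impI)
      fix s t :: real assume st: "0 < s" "s \<le> t"
      have ic: "\<rho> integrable_on {a..b}" if "0 \<le> a" for a b
        by (intro integrable_continuous_interval continuous_on_subset[OF \<rho>c]) (use that in auto)
      have 1: "integral {0..s} \<rho> + integral {s..t} \<rho> = integral {0..t} \<rho>"
        using st ic by (intro Henstock_Kurzweil_Integration.integral_combine) auto
      have L: "(LBINT u:{0..b}. \<rho> u) = integral {0..b} \<rho>" for b
        by (intro lborel_integral_Icc_eq_integral continuous_on_subset[OF \<rho>c]) auto
      have "integral {s..t} (\<lambda>u. \<phi> u (W u \<omega>)) \<le> integral {s..t} (\<lambda>u. C * \<rho> u)"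
      proof (rule integral_le)
        show "(\<lambda>u. \<phi> u (W u \<omega>)) integrable_on {s..t}"
          by (intro integrable_continuous_interval continuous_on_subset[OF path[OF w]]) (use st in auto)
        show "(\<lambda>u. C * \<rho> u) integrable_on {s..t}" using ic[of s t] st by (intro integrable_on_mult_right) auto
        show "\<phi> u (W u \<omega>) \<le> C * \<rho> u" if "u \<in> {s..t}" for u using C(2)[of u "W u \<omega>"] that st by (simp add: \<rho>_def)
      qed
      also have "\<dots> = C * integral {s..t} \<rho>" by simp
      finally have "A t \<omega> - A s \<omega> \<le> C * (integral {0..t} \<rho> - integral {0..s} \<rho>)"
        using Adiff[OF st w] by (simp add: 1[symmetric])
      then show "A t \<omega> - C * (LBINT u:{0..t}. (1 + u + (W u \<omega>)\<^sup>2) ^ (n - 1))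
                   \<le> A s \<omega> - C * (LBINT u:{0..s}. (1 + u + (W u \<omega>)\<^sup>2) ^ (n - 1))"
        unfolding \<rho>_def[symmetric, THEN fun_cong] L by (simp add: algebra_simps)
    qed
  qed
  then show ?thesis using C(1) qv by blast
qed

end

section \<open>Caloric functions of polynomial growth\<close>

text \<open>A class closed under sums, products and Gaussian averaging, with every member integrable
  against every centred Gaussian. The degree is not tracked, since the class only serves
  integrability and Fubini; growth in t is estimated separately.\<close>

definition poly_growth :: "(real \<Rightarrow> real) \<Rightarrow> bool" where
  "poly_growth \<phi> \<longleftrightarrow> \<phi> \<in> borel_measurable borel \<and> (\<exists>L m. \<forall>x. \<bar>\<phi> x\<bar> \<le> L * (1 + \<bar>x\<bar>) ^ m)"

lemma poly_growthI: "\<phi> \<in> borel_measurable borel \<Longrightarrow> (\<And>x. \<bar>\<phi> x\<bar> \<le> L * (1 + \<bar>x\<bar>) ^ m) \<Longrightarrow> poly_growth \<phi>"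
  unfolding poly_growth_def by blast

lemma poly_growth_measurable: "poly_growth \<phi> \<Longrightarrow> \<phi> \<in> borel_measurable borel"
  by (simp add: poly_growth_def)

lemma poly_growthE:
  assumes "poly_growth \<phi>"
  obtains L m where "L \<ge> 0" "\<And>x. \<bar>\<phi> x\<bar> \<le> L * (1 + \<bar>x\<bar>) ^ m"
proof -
  obtain L m where L: "\<And>x. \<bar>\<phi> x\<bar> \<le> L * (1 + \<bar>x\<bar>) ^ m" using assms by (auto simp: poly_growth_def)
  have "L \<ge> 0" using L[of 0] by simp
  then show thesis using that L by blast
qed

text \<open>Submultiplicativity of the weight: in Gaussian integrals of a translated function, the
  dependence on the translation x comes out as a polynomial factor.\<close>

lemma one_plus_abs_add_power: "(1 + \<bar>x + y\<bar>) ^ m \<le> (1 + \<bar>x\<bar>) ^ m * (1 + \<bar>y :: real\<bar>) ^ m"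
proof -
  have "1 + \<bar>x + y\<bar> \<le> (1 + \<bar>x\<bar>) * (1 + \<bar>y\<bar>)"
  proof -
    have "(1 + \<bar>x\<bar>) * (1 + \<bar>y\<bar>) = 1 + \<bar>x\<bar> + \<bar>y\<bar> + \<bar>x\<bar> * \<bar>y\<bar>" by (simp add: algebra_simps)
    then show ?thesis
      using abs_triangle_ineq[of x y] mult_nonneg_nonneg[OF abs_ge_zero[of x] abs_ge_zero[of y]] by linarith
  qed
  then show ?thesis unfolding power_mult_distrib[symmetric] by (intro power_mono) auto
qed

lemma poly_growth_mult:
  assumes "poly_growth \<phi>" "poly_growth \<psi>"
  shows "poly_growth (\<lambda>x. \<phi> x * \<psi> x)"
proof -
  obtain L m where L: "L \<ge> 0" "\<And>x. \<bar>\<phi> x\<bar> \<le> L * (1 + \<bar>x\<bar>) ^ m" using poly_growthE[OF assms(1)] by blast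
  obtain K l where K: "K \<ge> 0" "\<And>x. \<bar>\<psi> x\<bar> \<le> K * (1 + \<bar>x\<bar>) ^ l" using poly_growthE[OF assms(2)] by blast
  show ?thesis
  proof (rule poly_growthI)
    fix x
    have "\<bar>\<phi> x * \<psi> x\<bar> \<le> (L * (1 + \<bar>x\<bar>) ^ m) * (K * (1 + \<bar>x\<bar>) ^ l)"
      unfolding abs_mult by (intro mult_mono L K) (use L in auto)
    then show "\<bar>\<phi> x * \<psi> x\<bar> \<le> (L * K) * (1 + \<bar>x\<bar>) ^ (m + l)" by (simp add: power_add mult_ac)
  qed (use assms in \<open>auto simp: poly_growth_def\<close>)
qed

lemma poly_growth_add:
  assumes "poly_growth \<phi>" "poly_growth \<psi>"
  shows "poly_growth (\<lambda>x. \<phi> x + \<psi> x)"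
proof -
  obtain L m where L: "L \<ge> 0" "\<And>x. \<bar>\<phi> x\<bar> \<le> L * (1 + \<bar>x\<bar>) ^ m" using poly_growthE[OF assms(1)] by blast
  obtain K l where K: "K \<ge> 0" "\<And>x. \<bar>\<psi> x\<bar> \<le> K * (1 + \<bar>x\<bar>) ^ l" using poly_growthE[OF assms(2)] by blast
  show ?thesis
  proof (rule poly_growthI)
    fix x
    have "\<bar>\<phi> x + \<psi> x\<bar> \<le> L * (1 + \<bar>x\<bar>) ^ m + K * (1 + \<bar>x\<bar>) ^ l" using L(2)[of x] K(2)[of x] by linarith
    also have "\<dots> \<le> L * (1 + \<bar>x\<bar>) ^ (m + l) + K * (1 + \<bar>x\<bar>) ^ (m + l)"
      using L K by (intro add_mono mult_left_mono power_increasing) auto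
    finally show "\<bar>\<phi> x + \<psi> x\<bar> \<le> (L + K) * (1 + \<bar>x\<bar>) ^ (m + l)" by (simp add: algebra_simps)
  qed (use assms in \<open>auto simp: poly_growth_def\<close>)
qed

lemma poly_growth_poly: "poly_growth (poly q)"
proof (rule poly_growthI)
  show "poly q \<in> borel_measurable borel" by (intro borel_measurable_continuous_onI continuous_intros)
  fix x :: real
  have "\<bar>poly q x\<bar> \<le> (\<Sum>i\<le>degree q. \<bar>coeff q i\<bar> * \<bar>x\<bar> ^ i)"
    unfolding poly_altdef by (rule order_trans[OF sum_abs]) (simp add: abs_mult power_abs)
  also have "\<dots> \<le> (\<Sum>i\<le>degree q. \<bar>coeff q i\<bar> * (1 + \<bar>x\<bar>) ^ degree q)"
  proof (intro sum_mono mult_left_mono)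
    fix i assume "i \<in> {..degree q}"
    then have "\<bar>x\<bar> ^ i \<le> (1 + \<bar>x\<bar>) ^ i" "(1 + \<bar>x\<bar>) ^ i \<le> (1 + \<bar>x\<bar>) ^ degree q"
      by (intro power_mono power_increasing; simp)+
    then show "\<bar>x\<bar> ^ i \<le> (1 + \<bar>x\<bar>) ^ degree q" by linarith
  qed auto
  finally show "\<bar>poly q x\<bar> \<le> (\<Sum>i\<le>degree q. \<bar>coeff q i\<bar>) * (1 + \<bar>x\<bar>) ^ degree q" by (simp add: sum_distrib_right)
qed

lemma poly_growth_abs: "poly_growth \<phi> \<Longrightarrow> poly_growth (\<lambda>x. \<bar>\<phi> x\<bar>)"
  unfolding poly_growth_def by auto

lemma integrable_gauss_one_plus_abs_power: "t > 0 \<Longrightarrow> integrable lborel (\<lambda>x. (1 + \<bar>x\<bar>) ^ m * gauss t x)"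
proof -
  assume t: "t > 0"
  have "(1 + \<bar>x\<bar>) ^ m * gauss t x = (\<Sum>k\<le>m. real (m choose k) * (\<bar>x\<bar> ^ k * gauss t x))" for x
    using binomial_ring[of "\<bar>x\<bar>" 1 m] by (simp add: add.commute sum_distrib_right mult.assoc)
  then show ?thesis using integrable_gauss_abs_power[OF t] by simp
qed

lemma integrable_poly_growth_gauss:
  assumes t: "t > 0" and "poly_growth \<phi>"
  shows "integrable lborel (\<lambda>x. \<phi> x * gauss t x)"
proof -
  obtain L m where L: "L \<ge> 0" "\<And>x. \<bar>\<phi> x\<bar> \<le> L * (1 + \<bar>x\<bar>) ^ m" using poly_growthE[OF assms(2)] by blast
  note [measurable] = poly_growth_measurable[OF assms(2)]
  show ?thesis
  proof (rule Bochner_Integration.integrable_bound)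
    show "integrable lborel (\<lambda>x. L * ((1 + \<bar>x\<bar>) ^ m * gauss t x))" using integrable_gauss_one_plus_abs_power[OF t] by simp
    show "AE x in lborel. norm (\<phi> x * gauss t x) \<le> norm (L * ((1 + \<bar>x\<bar>) ^ m * gauss t x))"
    proof (rule AE_I2)
      fix x
      show "norm (\<phi> x * gauss t x) \<le> norm (L * ((1 + \<bar>x\<bar>) ^ m * gauss t x))"
        using mult_right_mono[OF L(2)[of x], of "gauss t x"] L(1) by (simp add: abs_mult mult.assoc)
    qed
  qed measurable
qed

lemma integrable_poly_growth_gauss_shift:
  assumes t: "t > 0" and "poly_growth \<phi>"
  shows "integrable lborel (\<lambda>w. \<phi> w * gauss t (w - x))"
proof -
  obtain L m where L: "L \<ge> 0" "\<And>x. \<bar>\<phi> x\<bar> \<le> L * (1 + \<bar>x\<bar>) ^ m" using poly_growthE[OF assms(2)] by blast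
  note [measurable] = poly_growth_measurable[OF assms(2)]
  have "poly_growth (\<lambda>y. \<phi> (x + y))"
  proof (rule poly_growthI)
    fix y
    have "\<bar>\<phi> (x + y)\<bar> \<le> L * ((1 + \<bar>x\<bar>) ^ m * (1 + \<bar>y\<bar>) ^ m)"
      using L(2)[of "x + y"] mult_left_mono[OF one_plus_abs_add_power L(1)] by (rule order_trans)
    then show "\<bar>\<phi> (x + y)\<bar> \<le> (L * (1 + \<bar>x\<bar>) ^ m) * (1 + \<bar>y\<bar>) ^ m" by (simp add: mult.assoc)
  qed measurable
  from integrable_poly_growth_gauss[OF t this] show ?thesis
    using lborel_integrable_real_affine_iff[of 1 "\<lambda>w. \<phi> w * gauss t (w - x)" x] by simp
qed

lemma poly_growth_gauss_convolution:
  assumes t: "t > 0" and "poly_growth \<phi>"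
  shows "poly_growth (\<lambda>x. LBINT w. \<phi> w * gauss t (w - x))"
proof -
  obtain L m where L: "L \<ge> 0" "\<And>x. \<bar>\<phi> x\<bar> \<le> L * (1 + \<bar>x\<bar>) ^ m" using poly_growthE[OF assms(2)] by blast
  note [measurable] = poly_growth_measurable[OF assms(2)]
  show ?thesis
  proof (rule poly_growthI)
    fix x
    have "\<bar>LBINT w. \<phi> w * gauss t (w - x)\<bar> = \<bar>LBINT y. \<phi> (x + y) * gauss t y\<bar>"
      by (simp add: gauss_convolution_shift)
    also have "\<dots> \<le> (LBINT y. \<bar>\<phi> (x + y) * gauss t y\<bar>)" by (rule integral_abs_bound)
    also have "\<dots> \<le> (LBINT y. (L * (1 + \<bar>x\<bar>) ^ m) * ((1 + \<bar>y\<bar>) ^ m * gauss t y))"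
    proof (rule integral_mono')
      show "integrable lborel (\<lambda>y. (L * (1 + \<bar>x\<bar>) ^ m) * ((1 + \<bar>y\<bar>) ^ m * gauss t y))"
        using integrable_gauss_one_plus_abs_power[OF t] by simp
      fix y
      have "\<bar>\<phi> (x + y)\<bar> \<le> L * ((1 + \<bar>x\<bar>) ^ m * (1 + \<bar>y\<bar>) ^ m)"
        using L(2)[of "x + y"] mult_left_mono[OF one_plus_abs_add_power L(1)] by (rule order_trans)
      from mult_right_mono[OF this, of "gauss t y"]
      show "\<bar>\<phi> (x + y) * gauss t y\<bar> \<le> (L * (1 + \<bar>x\<bar>) ^ m) * ((1 + \<bar>y\<bar>) ^ m * gauss t y)"
        by (simp add: abs_mult mult_ac)
    qed (use L in auto)
    also have "\<dots> = (L * (LBINT y. (1 + \<bar>y\<bar>) ^ m * gauss t y)) * (1 + \<bar>x\<bar>) ^ m" by simp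
    finally show "\<bar>LBINT w. \<phi> w * gauss t (w - x)\<bar> \<le> (L * (LBINT y. (1 + \<bar>y\<bar>) ^ m * gauss t y)) * (1 + \<bar>x\<bar>) ^ m" .
  qed measurable
qed

text \<open>Writing h at time s as the average of h at time t and exchanging the integrals leaves
  the bridge average of a Hermite polynomial as inner integral. The coefficient at time s is thereby
  computed from the slice at time t.\<close>

lemma hermite_coefficient_scaling:
  assumes st: "0 < s" "s < t" and g: "poly_growth (h t)"
    and conv: "\<And>x. h s x = (LBINT w. h t w * gauss (t - s) (w - x))"
  shows "(LBINT x. h s x * poly (hpoly k s) x * gauss s x) = (s / t) ^ k * (LBINT x. h t x * poly (hpoly k t) x * gauss t x)"
proof -
  have u: "t - s > 0" using st by simp
  note [measurable] = poly_growth_measurable[OF g]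
  have [measurable]: "poly (hpoly k s) \<in> borel_measurable borel" by (rule poly_growth_measurable[OF poly_growth_poly])
  define F where "F = (\<lambda>x w. h t w * poly (hpoly k s) x * (gauss s x * gauss (t - s) (w - x)))"
  have Feq: "F x w = (poly (hpoly k s) x * gauss s x) * (h t w * gauss (t - s) (w - x))" for x w by (simp add: F_def)
  have "integrable (lborel \<Otimes>\<^sub>M lborel) (\<lambda>(x, w). F x w)"
  proof (rule lborel_pair.Fubini_integrable)
    show "(\<lambda>(x, w). F x w) \<in> borel_measurable (lborel \<Otimes>\<^sub>M lborel)" unfolding F_def by measurable
    have "(LBINT w. norm (F x w)) = \<bar>poly (hpoly k s) x\<bar> * (LBINT w. \<bar>h t w\<bar> * gauss (t - s) (w - x)) * gauss s x" for x
      by (simp add: Feq abs_mult)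
    moreover have "integrable lborel (\<lambda>x. \<bar>poly (hpoly k s) x\<bar> * (LBINT w. \<bar>h t w\<bar> * gauss (t - s) (w - x)) * gauss s x)"
      by (intro integrable_poly_growth_gauss st poly_growth_mult poly_growth_gauss_convolution poly_growth_abs poly_growth_poly g u)
    ultimately show "integrable lborel (\<lambda>x. LBINT w. norm (case (x, w) of (x, w) \<Rightarrow> F x w))" by simp
    show "AE x in lborel. integrable lborel (\<lambda>w. case (x, w) of (x, w) \<Rightarrow> F x w)"
      unfolding prod.case Feq by (intro AE_I2 integrable_mult_right integrable_poly_growth_gauss_shift u g)
  qed
  then have "(LBINT w. (LBINT x. F x w)) = (LBINT x. (LBINT w. F x w))"
    by (rule lborel_pair.Fubini_integral)
  moreover have "(LBINT w. F x w) = h s x * poly (hpoly k s) x * gauss s x" for x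
    by (simp add: Feq conv[symmetric])
  moreover have "(LBINT x. F x w) = (s / t) ^ k * (h t w * poly (hpoly k t) w * gauss t w)" for w
    using hpoly_bridge[OF st, of k w] by (simp add: F_def mult.assoc)
  ultimately show ?thesis by simp
qed

text \<open>Relative to the Gaussian weight of variance \<open>3 s\<close>, the kernel of variance \<open>2 s\<close> is the exponential of a
  quadratic \<open>q\<close>; the ratio \<open>3\<close> is large enough for \<open>exp \<bar>q\<bar>\<close> to stay integrable, which allows
  integrating the exponential series termwise.\<close>

lemma gauss_exp_quadratic:
  assumes s: "s > 0"
  shows "gauss (2 * s) (w - x) = sqrt (3 / 2) * (gauss (3 * s) w * exp (poly [:- x\<^sup>2 / (4 * s), x / (2 * s), - 1 / (12 * s):] w))"
proof -
  have pos: "2 * s > 0" "3 * s > 0" using s by auto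
  have "- (w - x)\<^sup>2 / (2 * (2 * s)) = - w\<^sup>2 / (2 * (3 * s)) + poly [:- x\<^sup>2 / (4 * s), x / (2 * s), - 1 / (12 * s):] w"
    using s by (simp add: field_simps power2_eq_square)
  moreover have "sqrt (2 * pi * (3 * s)) = sqrt (3 / 2) * sqrt (2 * pi * (2 * s))"
    unfolding real_sqrt_mult[symmetric] by simp
  moreover have "sqrt (2 * pi * (3 * s)) > 0" "sqrt (2 * pi * (2 * s)) > 0" using s by auto
  ultimately show ?thesis
    unfolding gauss_eq[OF pos(1)] gauss_eq[OF pos(2)] by (simp only: exp_add) (simp del: poly_pCons real_sqrt_mult)
qed

lemma zero_moments_zero_convolution:
  assumes s: "s > 0" and g: "poly_growth d" and zero: "\<And>q. (LBINT w. d w * poly q w * gauss (3 * s) w) = 0"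
  shows "(LBINT w. d w * gauss (2 * s) (w - x)) = 0"
proof -
  note [measurable] = poly_growth_measurable[OF g]
  define q where "q = [:- x\<^sup>2 / (4 * s), x / (2 * s), - 1 / (12 * s):]"
  have [measurable]: "poly q \<in> borel_measurable borel" by (rule poly_growth_measurable[OF poly_growth_poly])
  define S where "S = (\<lambda>m. \<Sum>k<m. smult (1 / fact k) (q ^ k))"
  have S: "poly (S m) w = (\<Sum>k<m. poly q w ^ k /\<^sub>R fact k)" for m w
    by (simp add: S_def poly_sum divide_inverse)
  have qb: "\<bar>poly q w\<bar> \<le> w\<^sup>2 / (8 * s) + 7 * x\<^sup>2 / (4 * s)" for w
  proof -
    \<comment> \<open>The weight 6 in this inequality is chosen for its effect on w^2: the mixed
      term contributes 1 / (24 s), which with 1 / (12 s) makes 1 / (8 s), below the rate 1 / (6 s)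
      of \<open>gauss (3 * s)\<close>.\<close>
    have "2 * (\<bar>w\<bar> * (6 * \<bar>x\<bar>)) \<le> \<bar>w\<bar>\<^sup>2 + (6 * \<bar>x\<bar>)\<^sup>2" using sum_squares_bound[of "\<bar>w\<bar>" "6 * \<bar>x\<bar>"] by simp
    then have a: "\<bar>x\<bar> * \<bar>w\<bar> / (2 * s) \<le> (w\<^sup>2 + 36 * x\<^sup>2) / (24 * s)"
      using s by (simp add: field_simps power_mult_distrib)
    have "\<bar>poly q w\<bar> \<le> x\<^sup>2 / (4 * s) + \<bar>x\<bar> * \<bar>w\<bar> / (2 * s) + w\<^sup>2 / (12 * s)"
    proof -
      have "poly q w = - (x\<^sup>2 / (4 * s)) + x * w / (2 * s) - w\<^sup>2 / (12 * s)"
        using s by (simp add: q_def field_simps power2_eq_square)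
      moreover have "\<bar>x * w / (2 * s)\<bar> = \<bar>x\<bar> * \<bar>w\<bar> / (2 * s)" using s by (simp add: abs_mult)
      moreover have "0 \<le> x\<^sup>2 / (4 * s)" "0 \<le> w\<^sup>2 / (12 * s)" using s by auto
      ultimately show ?thesis by linarith
    qed
    also have "\<dots> \<le> x\<^sup>2 / (4 * s) + (w\<^sup>2 + 36 * x\<^sup>2) / (24 * s) + w\<^sup>2 / (12 * s)" using a by simp
    also have "\<dots> = w\<^sup>2 / (8 * s) + 7 * x\<^sup>2 / (4 * s)" using s by (simp add: field_simps)
    finally show ?thesis .
  qed
  \<comment> \<open>The remaining rate 1 / (6 s) - 1 / (8 s) = 1 / (24 s) belongs to variance 12 s.
    The factor 2 is the ratio of the normalising constants, sqrt (12 / 3).\<close>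
  define c where "c = exp (7 * x\<^sup>2 / (4 * s)) * 2"
  have gb: "gauss (3 * s) w * exp \<bar>poly q w\<bar> \<le> c * gauss (12 * s) w" for w
  proof -
    have p3: "3 * s > 0" using s by simp
    have sq: "sqrt (2 * pi * (12 * s)) = 2 * sqrt (2 * pi * (3 * s))"
      using real_sqrt_mult[of 4 "2 * pi * (3 * s)"] by simp
    have "gauss (3 * s) w * exp \<bar>poly q w\<bar> \<le> gauss (3 * s) w * exp (w\<^sup>2 / (8 * s) + 7 * x\<^sup>2 / (4 * s))"
      using qb by (intro mult_left_mono) auto
    also have "\<dots> = exp (7 * x\<^sup>2 / (4 * s)) * (exp (- w\<^sup>2 / (2 * (3 * s)) + w\<^sup>2 / (8 * s)) / sqrt (2 * pi * (3 * s)))"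
      unfolding gauss_eq[OF p3] by (simp only: exp_add) (simp add: mult_ac)
    also have "- w\<^sup>2 / (2 * (3 * s)) + w\<^sup>2 / (8 * s) = - w\<^sup>2 / (2 * (12 * s))" using s by (simp add: field_simps)
    also have "exp (7 * x\<^sup>2 / (4 * s)) * (exp (- w\<^sup>2 / (2 * (12 * s))) / sqrt (2 * pi * (3 * s))) = c * gauss (12 * s) w"
    proof -
      have "12 * s > 0" using s by simp
      show ?thesis unfolding gauss_eq[OF \<open>12 * s > 0\<close>] sq by (simp add: c_def)
    qed
    finally show ?thesis .
  qed
  have "(\<lambda>m. LBINT w. d w * poly (S m) w * gauss (3 * s) w) \<longlonglongrightarrow> (LBINT w. d w * exp (poly q w) * gauss (3 * s) w)"
  proof (rule integral_dominated_convergence[where w="\<lambda>w. c * (\<bar>d w\<bar> * gauss (12 * s) w)"])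
    have [measurable]: "poly (S m) \<in> borel_measurable borel" for m by (rule poly_growth_measurable[OF poly_growth_poly])
    show "(\<lambda>w. d w * exp (poly q w) * gauss (3 * s) w) \<in> borel_measurable lborel"
      "\<And>m. (\<lambda>w. d w * poly (S m) w * gauss (3 * s) w) \<in> borel_measurable lborel" by measurable
    show "integrable lborel (\<lambda>w. c * (\<bar>d w\<bar> * gauss (12 * s) w))"
      using integrable_poly_growth_gauss[of "12 * s", OF _ poly_growth_abs[OF g]] s by simp
    show "AE w in lborel. (\<lambda>m. d w * poly (S m) w * gauss (3 * s) w) \<longlonglongrightarrow> d w * exp (poly q w) * gauss (3 * s) w"
      using exp_converges[where 'a=real] unfolding S sums_def by (intro AE_I2 tendsto_intros) auto
    show "AE w in lborel. norm (d w * poly (S m) w * gauss (3 * s) w) \<le> c * (\<bar>d w\<bar> * gauss (12 * s) w)" for m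
    proof (rule AE_I2)
      fix w
      have "\<bar>poly (S m) w\<bar> \<le> (\<Sum>k<m. \<bar>poly q w\<bar> ^ k /\<^sub>R fact k)"
        unfolding S by (rule order_trans[OF sum_abs]) (simp add: abs_mult power_abs)
      also have "\<dots> \<le> exp \<bar>poly q w\<bar>"
        unfolding exp_def by (rule sum_le_suminf) (auto intro: summable_exp)
      finally have "\<bar>poly (S m) w\<bar> * gauss (3 * s) w \<le> exp \<bar>poly q w\<bar> * gauss (3 * s) w" by (intro mult_right_mono) auto
      also have "\<dots> \<le> c * gauss (12 * s) w" using gb[of w] by (simp add: mult.commute)
      finally have "\<bar>d w\<bar> * (\<bar>poly (S m) w\<bar> * gauss (3 * s) w) \<le> \<bar>d w\<bar> * (c * gauss (12 * s) w)" by (intro mult_left_mono) auto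
      then show "norm (d w * poly (S m) w * gauss (3 * s) w) \<le> c * (\<bar>d w\<bar> * gauss (12 * s) w)" by (simp add: abs_mult mult_ac)
    qed
  qed
  \<comment> \<open>Every partial sum of the exponential series is a polynomial in w, so its
    integral vanishes by hypothesis.\<close>
  then have "(\<lambda>_::nat. 0) \<longlonglongrightarrow> (LBINT w. d w * exp (poly q w) * gauss (3 * s) w)" by (simp add: zero)
  then have "(LBINT w. d w * exp (poly q w) * gauss (3 * s) w) = 0" by (simp add: LIMSEQ_const_iff)
  moreover have "(LBINT w. d w * gauss (2 * s) (w - x)) = (LBINT w. sqrt (3 / 2) * (d w * exp (poly q w) * gauss (3 * s) w))"
    unfolding gauss_exp_quadratic[OF s] q_def[symmetric] by (rule Bochner_Integration.integral_cong) (auto simp: mult_ac)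
  ultimately show ?thesis by simp
qed

text \<open>No basis expansion of q is needed: the claim is strengthened by a Hermite factor, and in
  the induction on q the identity x H_k = H_(k+1) + k t H_(k-1) trades each factor x for a change of
  index. The case k = 0 is the assertion.\<close>

lemma zero_hermite_coefficients_zero_moments:
  assumes t: "t > 0" and g: "poly_growth d"
    and zero: "\<And>k. (LBINT w. d w * poly (hpoly k t) w * gauss t w) = 0"
  shows "(LBINT w. d w * poly q w * gauss t w) = 0"
proof -
  have i: "integrable lborel (\<lambda>w. d w * poly p w * gauss t w)" for p
    by (intro integrable_poly_growth_gauss t poly_growth_mult g poly_growth_poly)
  have "(LBINT w. d w * poly (hpoly k t * q) w * gauss t w) = 0" for k
  proof (induction q arbitrary: k rule: pCons_induct)
    case 0
    then show ?case by simp
  next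
    case (pCons a p)
    \<comment> \<open>For k = 0 the truncated index \<open>k - 1\<close> is harmless, since its
      coefficient is 0.\<close>
    have x: "[:0, 1:] * hpoly k t = hpoly (Suc k) t + smult (real k * t) (hpoly (k - 1) t)"
      by (cases k) (auto simp: one_pCons)
    have "hpoly k t * pCons a p = smult a (hpoly k t) + ([:0, 1:] * hpoly k t) * p"
      by (simp add: mult_pCons_right mult_pCons_left)
    also have "\<dots> = smult a (hpoly k t) + hpoly (Suc k) t * p + smult (real k * t) (hpoly (k - 1) t * p)"
      unfolding x by (simp add: algebra_simps)
    finally have "d w * poly (hpoly k t * pCons a p) w * gauss t w = a * (d w * poly (hpoly k t) w * gauss t w)
       + d w * poly (hpoly (Suc k) t * p) w * gauss t w + (real k * t) * (d w * poly (hpoly (k - 1) t * p) w * gauss t w)" for w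
      by (simp only: poly_add poly_smult) (simp add: algebra_simps del: poly_mult hpoly.simps)
    then have "(LBINT w. d w * poly (hpoly k t * pCons a p) w * gauss t w) = 
        (LBINT w. a * (d w * poly (hpoly k t) w * gauss t w)
       + d w * poly (hpoly (Suc k) t * p) w * gauss t w + (real k * t) * (d w * poly (hpoly (k - 1) t * p) w * gauss t w))"
      by (simp only:)
    also have "\<dots> = a * (LBINT w. d w * poly (hpoly k t) w * gauss t w) + (LBINT w. d w * poly (hpoly (Suc k) t * p) w * gauss t w)
       + (real k * t) * (LBINT w. d w * poly (hpoly (k - 1) t * p) w * gauss t w)"
      using i[of "hpoly k t"] i[of "hpoly (Suc k) t * p"] i[of "hpoly (k - 1) t * p"] by (simp del: poly_mult hpoly.simps)
    finally show ?case unfolding zero pCons.IH by simp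
  qed
  from this[of 0] show ?thesis by simp
qed

text \<open>The growth bound is used at all large times at once: at a fixed time, polynomial growth
  would not limit the degree of the Hermite expansion. After the sum up to n is subtracted, the rest
  d has no Hermite coefficients at any time, and averaging it from time 3 s to time s shows that it
  is zero.\<close>

theorem caloric_growth_imp_heat_sum:
  assumes meas: "\<And>t. t > 0 \<Longrightarrow> h t \<in> borel_measurable borel"
    and conv: "\<And>s t x. 0 < s \<Longrightarrow> s < t \<Longrightarrow> h s x = (LBINT w. h t w * gauss (t - s) (w - x))"
    and growth: "\<And>t x. t > 0 \<Longrightarrow> \<bar>h t x\<bar> \<le> K * (sqrt (1 + t) + \<bar>x\<bar>) ^ n"
  shows "\<exists>a. \<forall>t>0. \<forall>x. h t x = heat_sum a n t x"
proof -
  have K0: "K \<ge> 0"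
  proof -
    have "0 \<le> K * (sqrt (1 + 1) + \<bar>0\<bar>) ^ n" by (rule order_trans[OF abs_ge_zero growth]) simp
    moreover have "(sqrt (1 + 1) + \<bar>0 :: real\<bar>) ^ n > 0" by simp
    ultimately show ?thesis using mult_neg_pos[of K "(sqrt (1 + 1) + \<bar>0 :: real\<bar>) ^ n"] by linarith
  qed
  have pull: "(sqrt (1 + t) + \<bar>x\<bar>) ^ n \<le> sqrt (1 + t) ^ n * (1 + \<bar>x\<bar>) ^ n" if "t > 0" for t x :: real
  proof -
    have "1 * \<bar>x\<bar> \<le> sqrt (1 + t) * \<bar>x\<bar>" using that by (intro mult_right_mono) auto
    then show ?thesis unfolding power_mult_distrib[symmetric] using that by (intro power_mono) (auto simp: algebra_simps)
  qed
  have pg: "poly_growth (h t)" if "t > 0" for t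
  proof (rule poly_growthI[OF meas[OF that]])
    fix x
    show "\<bar>h t x\<bar> \<le> (K * sqrt (1 + t) ^ n) * (1 + \<bar>x\<bar>) ^ n"
      using growth[OF that, of x] mult_left_mono[OF pull[OF that, of x] K0] by (simp add: mult.assoc)
  qed
  define c where "c = (\<lambda>k t. LBINT x. h t x * poly (hpoly k t) x * gauss t x)"
  have scale: "c k s = (s / t) ^ k * c k t" if "0 < s" "s < t" for k s t
    unfolding c_def by (rule hermite_coefficient_scaling[OF that pg conv]) (use that in auto)
  have c1: "c k t = t ^ k * c k 1" if "t > 0" for k t
  proof -
    consider "t < 1" | "t = 1" | "t > 1" by linarith
    then show ?thesis
    proof cases
      case 1 then show ?thesis using scale[of t 1 k] that by simp
    next
      case 3 then show ?thesis using scale[of 1 t k] by (simp add: power_divide)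
    qed simp
  qed
  have vanish: "c k 1 = 0" if k: "k > n" for k
  proof -
    define B where "B = (LBINT z. (1 + \<bar>z\<bar>) ^ n * \<bar>poly (hpoly k 1) z\<bar> * gauss 1 z)"
    have iB: "integrable lborel (\<lambda>z. (1 + \<bar>z\<bar>) ^ n * \<bar>poly (hpoly k 1) z\<bar> * gauss 1 z)"
    proof (intro integrable_poly_growth_gauss poly_growth_mult poly_growth_abs poly_growth_poly)
      show "poly_growth (\<lambda>z. (1 + \<bar>z\<bar>) ^ n)" by (rule poly_growthI[of _ 1 n]) auto
    qed simp
    have bound: "\<bar>c k t\<bar> \<le> K * (sqrt (1 + t) ^ n * (sqrt t ^ k * B))" if t: "t > 0" for t
    proof -
      \<comment> \<open>In the variable z = x / sqrt t the Gaussian is standard, the Hermite factor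
        contributes sqrt t ^ k, and the growth bound contributes sqrt (1 + t) ^ n.\<close>
      have "c k t = (LBINT z. h t (sqrt t * z) * poly (hpoly k t) (sqrt t * z) * gauss 1 z)"
        unfolding c_def by (rule integral_gauss_scale[OF t])
      then have "\<bar>c k t\<bar> \<le> (LBINT z. \<bar>h t (sqrt t * z) * poly (hpoly k t) (sqrt t * z) * gauss 1 z\<bar>)"
        using integral_abs_bound by simp
      also have "\<dots> \<le> (LBINT z. K * (sqrt (1 + t) ^ n * (sqrt t ^ k * ((1 + \<bar>z\<bar>) ^ n * \<bar>poly (hpoly k 1) z\<bar> * gauss 1 z))))"
      proof (rule integral_mono')
        show "integrable lborel (\<lambda>z. K * (sqrt (1 + t) ^ n * (sqrt t ^ k * ((1 + \<bar>z\<bar>) ^ n * \<bar>poly (hpoly k 1) z\<bar> * gauss 1 z))))"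
          using iB by (intro integrable_mult_right)
        fix z
        have "\<bar>h t (sqrt t * z)\<bar> \<le> K * (sqrt (1 + t) + \<bar>sqrt t * z\<bar>) ^ n" by (rule growth[OF t])
        also have "\<dots> \<le> K * (sqrt (1 + t) ^ n * (1 + \<bar>z\<bar>) ^ n)"
        proof -
          have "\<bar>sqrt t * z\<bar> \<le> sqrt (1 + t) * \<bar>z\<bar>" unfolding abs_mult using t by (intro mult_right_mono) auto
          then show ?thesis unfolding power_mult_distrib[symmetric] using K0 t
            by (intro mult_left_mono power_mono) (auto simp: algebra_simps)
        qed
        finally have 1: "\<bar>h t (sqrt t * z)\<bar> \<le> K * (sqrt (1 + t) ^ n * (1 + \<bar>z\<bar>) ^ n)" .
        have 2: "poly (hpoly k t) (sqrt t * z) = sqrt t ^ k * poly (hpoly k 1) z"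
          using hpoly_scale[of k "sqrt t" 1 z] t by simp
        have "\<bar>h t (sqrt t * z) * poly (hpoly k t) (sqrt t * z) * gauss 1 z\<bar> = \<bar>h t (sqrt t * z)\<bar> * (sqrt t ^ k * \<bar>poly (hpoly k 1) z\<bar> * gauss 1 z)"
          unfolding 2 using t by (simp add: abs_mult)
        also have "\<dots> \<le> K * (sqrt (1 + t) ^ n * (1 + \<bar>z\<bar>) ^ n) * (sqrt t ^ k * \<bar>poly (hpoly k 1) z\<bar> * gauss 1 z)"
          using 1 t by (intro mult_right_mono) auto
        finally show "\<bar>h t (sqrt t * z) * poly (hpoly k t) (sqrt t * z) * gauss 1 z\<bar>
           \<le> K * (sqrt (1 + t) ^ n * (sqrt t ^ k * ((1 + \<bar>z\<bar>) ^ n * \<bar>poly (hpoly k 1) z\<bar> * gauss 1 z)))"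
          by (simp add: mult_ac)
      qed (use K0 t in auto)
      also have "\<dots> = K * (sqrt (1 + t) ^ n * (sqrt t ^ k * B))" by (simp add: B_def)
      finally show ?thesis .
    qed
    have B0: "B \<ge> 0" unfolding B_def by (rule Bochner_Integration.integral_nonneg) simp
    \<comment> \<open>The bound is tested at t = m^2, where sqrt (1 + m^2) is at most 2 m. Dividing
      m^(2k) |c_k(1)| and its bound by m^(k+n) leaves at least one factor m on the left, because k >
      n.\<close>
    have "real m * \<bar>c k 1\<bar> \<le> K * 2 ^ n * B" if m: "m \<ge> 1" for m :: nat
    proof -
      define r where "r = real m"
      have r: "r \<ge> 1" using m by (simp add: r_def)
      have "sqrt (1 + r\<^sup>2) \<le> 2 * r"
      proof -
        have "1 \<le> r\<^sup>2" using r by (simp add: one_le_power)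
        then have "1 + r\<^sup>2 \<le> (2 * r)\<^sup>2" by (simp add: power_mult_distrib)
        then show ?thesis using r by (intro real_le_lsqrt) auto
      qed
      then have "sqrt (1 + r\<^sup>2) ^ n \<le> (2 * r) ^ n" by (intro power_mono) auto
      then have "K * (sqrt (1 + r\<^sup>2) ^ n * (r ^ k * B)) \<le> K * ((2 * r) ^ n * (r ^ k * B))"
        using K0 B0 r by (intro mult_left_mono mult_right_mono) auto
      then have "(r\<^sup>2) ^ k * \<bar>c k 1\<bar> \<le> K * ((2 * r) ^ n * (r ^ k * B))"
      proof (rule order_trans[rotated])
        have "r\<^sup>2 > 0" "sqrt (r\<^sup>2) = r" using r by auto
        then show "(r\<^sup>2) ^ k * \<bar>c k 1\<bar> \<le> K * (sqrt (1 + r\<^sup>2) ^ n * (r ^ k * B))"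
          using bound[of "r\<^sup>2"] c1[of "r\<^sup>2" k] by (simp add: abs_mult)
      qed
      then have "r ^ k * (r ^ k * \<bar>c k 1\<bar>) \<le> r ^ k * (K * (2 ^ n * r ^ n * B))"
        unfolding power2_eq_square power_mult_distrib by (simp only: mult_ac)
      then have "r ^ k * \<bar>c k 1\<bar> \<le> K * (2 ^ n * r ^ n * B)" using r by (subst (asm) mult_le_cancel_left_pos) auto
      moreover have "r ^ n * (r * \<bar>c k 1\<bar>) \<le> r ^ k * \<bar>c k 1\<bar>"
      proof -
        have "r ^ Suc n * \<bar>c k 1\<bar> \<le> r ^ k * \<bar>c k 1\<bar>"
          using k r by (intro mult_right_mono power_increasing) auto
        then show ?thesis by (simp add: mult_ac)
      qed
      ultimately have "r ^ n * (r * \<bar>c k 1\<bar>) \<le> r ^ n * (K * 2 ^ n * B)" by (simp add: mult_ac)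
      then show ?thesis using r unfolding r_def[symmetric] by (subst (asm) mult_le_cancel_left_pos) auto
    qed
    note mb = this
    show ?thesis
    proof (rule ccontr)
      assume "c k 1 \<noteq> 0"
      then obtain m :: nat where m: "K * 2 ^ n * B < real m * \<bar>c k 1\<bar>" using reals_Archimedean3[of "\<bar>c k 1\<bar>"] by auto
      moreover have "0 \<le> K * 2 ^ n * B" using K0 B0 by simp
      ultimately have "m \<noteq> 0" by (intro notI) simp
      then show False using mb[of m] m by simp
    qed
  qed
  \<comment> \<open>The squared norm of H_k at time t is k! t^k and \<open>c k t\<close> equals t^k
    times \<open>c k 1\<close>, so these projection coefficients do not depend on t.\<close>
  define a where "a = (\<lambda>k. c k 1 / fact k)"
  define d where "d = (\<lambda>t x. h t x - heat_sum a n t x)"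
  have hsp: "poly_growth (heat_sum a n t)" for t unfolding heat_sum_poly[abs_def] by (rule poly_growth_poly)
  have dg: "poly_growth (d t)" if "t > 0" for t
  proof -
    have eq: "d t = (\<lambda>x. h t x + poly (- (\<Sum>k\<le>n. smult (a k) (hpoly k t))) x)" by (simp add: d_def heat_sum_poly fun_eq_iff)
    show ?thesis unfolding eq by (rule poly_growth_add[OF pg[OF that] poly_growth_poly])
  qed
  have dz: "(LBINT w. d t w * poly (hpoly k t) w * gauss t w) = 0" if t: "t > 0" for t k
  proof -
    have i1: "integrable lborel (\<lambda>w. h t w * poly (hpoly k t) w * gauss t w)"
      by (intro integrable_poly_growth_gauss t poly_growth_mult pg poly_growth_poly)
    have i2: "integrable lborel (\<lambda>w. poly (hpoly j t) w * poly (hpoly k t) w * gauss t w)" for j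
      by (intro integrable_poly_growth_gauss t poly_growth_mult poly_growth_poly)
    have "d t w * poly (hpoly k t) w * gauss t w = h t w * poly (hpoly k t) w * gauss t w - (\<Sum>j\<le>n. a j * (poly (hpoly j t) w * poly (hpoly k t) w * gauss t w))" for w
      unfolding d_def heat_sum_def left_diff_distrib sum_distrib_right by (simp add: mult.assoc)
    then have "(LBINT w. d t w * poly (hpoly k t) w * gauss t w) = (LBINT w. h t w * poly (hpoly k t) w * gauss t w - (\<Sum>j\<le>n. a j * (poly (hpoly j t) w * poly (hpoly k t) w * gauss t w)))"
      by (simp only:)
    also have "\<dots> = c k t - (\<Sum>j\<le>n. a j * (LBINT w. poly (hpoly j t) w * poly (hpoly k t) w * gauss t w))"
      using i1 i2 by (simp add: c_def)
    also have "\<dots> = c k t - (\<Sum>j\<le>n. if j = k then a k * (fact k * t ^ k) else 0)"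
      unfolding hpoly_orthogonal[OF t] by (intro arg_cong2[where f=minus] sum.cong) auto
    also have "\<dots> = 0" using vanish[of k] c1[OF t, of k] by (simp add: a_def not_le)
    finally show ?thesis .
  qed
  have "d s x = 0" if s: "s > 0" for s x
  proof -
    \<comment> \<open>The slice at time 3 s is averaged back to s with variance 2 s, the pair of
      variances for which the kernel expansion was prepared.\<close>
    have st: "s < 3 * s" "3 * s > 0" "3 * s - s = 2 * s" "2 * s > 0" using s by auto
    have "h s x = (LBINT w. h (3 * s) w * gauss (2 * s) (w - x))" using conv[OF s st(1), of x] st by simp
    moreover have "heat_sum a n s x = (LBINT w. heat_sum a n (3 * s) w * gauss (2 * s) (w - x))"
      using heat_sum_caloric[OF st(1), of a n x] st by simp
    ultimately have "d s x = (LBINT w. d (3 * s) w * gauss (2 * s) (w - x))"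
      using integrable_poly_growth_gauss_shift[OF st(4) pg[OF st(2)], of x] integrable_poly_growth_gauss_shift[OF st(4) hsp, of "3 * s" x]
      by (simp add: d_def left_diff_distrib)
    also have "\<dots> = 0"
      by (rule zero_moments_zero_convolution[OF s dg[OF st(2)] zero_hermite_coefficients_zero_moments[OF st(2) dg[OF st(2)] dz[OF st(2)]]])
    finally show ?thesis .
  qed
  then show ?thesis unfolding d_def by (intro exI[of _ a]) auto
qed

section \<open>Heat sums as polynomials in two variables of bounded total degree\<close>

definition bivariate_poly :: "nat \<Rightarrow> (real \<Rightarrow> real \<Rightarrow> real) \<Rightarrow> bool" where
  "bivariate_poly n P \<longleftrightarrow> (\<exists>a. \<forall>t x. P t x = (\<Sum>i\<le>n. \<Sum>j\<le>n - i. a i j * t ^ i * x ^ j))"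

lemma bivariate_poly_monom:
  assumes "i + j \<le> n"
  shows "bivariate_poly n (\<lambda>t x. t ^ i * x ^ j)"
proof -
  define a :: "nat \<Rightarrow> nat \<Rightarrow> real" where "a = (\<lambda>k l. if l = j then if k = i then 1 else 0 else 0)"
  have "(\<Sum>l\<le>n - k. a k l * t ^ k * x ^ l) = (if k = i then t ^ i * x ^ j else 0)" for k and t x :: real
  proof -
    have "(\<Sum>l\<le>n - k. a k l * t ^ k * x ^ l) = (\<Sum>l\<le>n - k. if l = j then if k = i then t ^ i * x ^ j else 0 else 0)"
      by (intro sum.cong) (auto simp: a_def)
    then show ?thesis using assms by auto
  qed
  then have "t ^ i * x ^ j = (\<Sum>k\<le>n. \<Sum>l\<le>n - k. a k l * t ^ k * x ^ l)" for t x :: real using assms by simp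
  then show ?thesis unfolding bivariate_poly_def by blast
qed

lemma bivariate_poly_scale:
  assumes "bivariate_poly n P"
  shows "bivariate_poly n (\<lambda>t x. c * P t x)"
proof -
  obtain a where "\<And>t x. P t x = (\<Sum>i\<le>n. \<Sum>j\<le>n - i. a i j * t ^ i * x ^ j)" using assms unfolding bivariate_poly_def by blast
  then show ?thesis unfolding bivariate_poly_def by (intro exI[of _ "\<lambda>i j. c * a i j"]) (simp add: sum_distrib_left mult.assoc)
qed

lemma bivariate_poly_add:
  assumes "bivariate_poly n P" "bivariate_poly n Q"
  shows "bivariate_poly n (\<lambda>t x. P t x + Q t x)"
proof -
  obtain a where "\<And>t x. P t x = (\<Sum>i\<le>n. \<Sum>j\<le>n - i. a i j * t ^ i * x ^ j)" using assms(1) unfolding bivariate_poly_def by blast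
  moreover obtain b where "\<And>t x. Q t x = (\<Sum>i\<le>n. \<Sum>j\<le>n - i. b i j * t ^ i * x ^ j)" using assms(2) unfolding bivariate_poly_def by blast
  ultimately show ?thesis unfolding bivariate_poly_def
    by (intro exI[of _ "\<lambda>i j. a i j + b i j"]) (simp add: sum.distrib distrib_right)
qed

lemma bivariate_poly_sum:
  assumes "finite I" "\<And>i. i \<in> I \<Longrightarrow> bivariate_poly n (P i)"
  shows "bivariate_poly n (\<lambda>t x. \<Sum>i\<in>I. P i t x)"
  using assms
proof (induction I rule: finite_induct)
  case empty
  then show ?case using bivariate_poly_scale[OF bivariate_poly_monom[of 0 0 n], of 0] by simp
next
  case (insert i I)
  then show ?case using bivariate_poly_add[of n "P i"] by simp
qed

lemma bivariate_poly_mult_monom: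
  assumes P: "bivariate_poly n P" and m: "n + k + l \<le> m"
  shows "bivariate_poly m (\<lambda>t x. t ^ k * x ^ l * P t x)"
proof -
  obtain a where a: "\<And>t x. P t x = (\<Sum>i\<le>n. \<Sum>j\<le>n - i. a i j * t ^ i * x ^ j)" using P unfolding bivariate_poly_def by blast
  have "bivariate_poly m (\<lambda>t x. \<Sum>i\<le>n. \<Sum>j\<le>n - i. a i j * (t ^ (k + i) * x ^ (l + j)))"
    using m by (intro bivariate_poly_sum bivariate_poly_scale bivariate_poly_monom) auto
  then show ?thesis by (simp add: a sum_distrib_left power_add mult_ac)
qed

text \<open>Total degree counts t once although its parabolic weight is two. In the recursion x
  H_(k+1) uses the full degree k + 2, while t H_k needs only k + 1.\<close>

lemma bivariate_poly_hpoly: "k \<le> n \<Longrightarrow> bivariate_poly n (\<lambda>t x. poly (hpoly k t) x)"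
proof (induction k arbitrary: n rule: induct_nat_012)
  case 0
  then show ?case using bivariate_poly_monom[of 0 0 n] by simp
next
  case 1
  then show ?case using bivariate_poly_monom[of 0 1 n] by simp
next
  case (ge2 k)
  have "bivariate_poly n (\<lambda>t x. t ^ 0 * x ^ 1 * poly (hpoly (Suc k) t) x)"
    by (rule bivariate_poly_mult_monom[OF ge2(2)[OF order_refl]]) (use ge2(3) in simp)
  moreover have "bivariate_poly n (\<lambda>t x. - real (Suc k) * (t ^ 1 * x ^ 0 * poly (hpoly k t) x))"
    by (rule bivariate_poly_scale, rule bivariate_poly_mult_monom[OF ge2(1)[OF order_refl]]) (use ge2(3) in simp)
  ultimately have "bivariate_poly n (\<lambda>t x. t ^ 0 * x ^ 1 * poly (hpoly (Suc k) t) x + - real (Suc k) * (t ^ 1 * x ^ 0 * poly (hpoly k t) x))"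
    by (rule bivariate_poly_add)
  moreover have "(\<lambda>t x. t ^ 0 * x ^ 1 * poly (hpoly (Suc k) t) x + - real (Suc k) * (t ^ 1 * x ^ 0 * poly (hpoly k t) x)) = (\<lambda>t x. poly (hpoly (Suc (Suc k)) t) x)"
    unfolding poly_hpoly_Suc_Suc by (simp del: hpoly.simps add: algebra_simps)
  ultimately show ?case by (simp only:)
qed

lemma heat_polynomial_deg_heat_sum: "heat_polynomial_deg (heat_sum a n) n"
  unfolding heat_polynomial_deg_def bivariate_poly_def[symmetric]
proof (intro conjI allI)
  show "bivariate_poly n (heat_sum a n)"
    unfolding heat_sum_def[abs_def] by (intro bivariate_poly_sum bivariate_poly_scale bivariate_poly_hpoly) auto
  fix t x
  have d1: "deriv (\<lambda>z. heat_sum a n t z) = (\<lambda>y. poly (pderiv (\<Sum>k\<le>n. smult (a k) (hpoly k t))) y)"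
    unfolding heat_sum_poly by (rule ext) (rule DERIV_imp_deriv[OF poly_DERIV])
  have d2: "deriv (\<lambda>y. deriv (\<lambda>z. heat_sum a n t z) y) x = poly (pderiv (pderiv (\<Sum>k\<le>n. smult (a k) (hpoly k t)))) x"
    unfolding d1 by (rule DERIV_imp_deriv[OF poly_DERIV])
  have d3: "deriv (\<lambda>s. heat_sum a n s x) t = - (1/2) * poly (pderiv (pderiv (\<Sum>k\<le>n. smult (a k) (hpoly k t)))) x"
    unfolding heat_sum_poly by (rule DERIV_imp_deriv[OF hpoly_sum_heat_equation])
  show "deriv (\<lambda>s. heat_sum a n s x) t + 1/2 * deriv (\<lambda>y. deriv (\<lambda>z. heat_sum a n t z) y) x = 0"
    unfolding d2 d3 by simp
qed

section \<open>The gradient bound\<close>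

text \<open>Only the endpoints s + 1 / (m + 1) are involved because identities holding almost surely
  for each pair of times can be combined for countably many of them. Continuity at the left endpoint
  is enough for the conclusion.\<close>

lemma nonpos_of_integral_nonpos:
  fixes \<psi> :: "real \<Rightarrow> real"
  assumes c: "continuous_on {s..s + 1} \<psi>" and i: "\<And>m. integral {s..s + 1 / real (Suc m)} \<psi> \<le> 0"
  shows "\<psi> s \<le> 0"
proof (rule ccontr)
  assume "\<not> \<psi> s \<le> 0"
  then have pos: "\<psi> s > 0" by simp
  obtain d where d: "d > 0" "\<And>u. u \<in> {s..s + 1} \<Longrightarrow> dist u s < d \<Longrightarrow> dist (\<psi> u) (\<psi> s) < \<psi> s / 2"
    using c pos unfolding continuous_on_iff by (metis add_le_same_cancel1 atLeastAtMost_iff half_gt_zero le_add_same_cancel1 order_refl zero_le_one)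
  obtain m :: nat where m: "1 / real (Suc m) < d" using d(1) reals_Archimedean[of d] by (auto simp: inverse_eq_divide)
  define r where "r = s + 1 / real (Suc m)"
  have r: "s < r" "r \<le> s + 1" by (auto simp: r_def field_simps)
  have sub: "{s..r} \<subseteq> {s..s + 1}" using r by auto
  have "integral {s..r} (\<lambda>_. \<psi> s / 2) \<le> integral {s..r} \<psi>"
  proof (rule integral_le)
    show "\<psi> integrable_on {s..r}" by (intro integrable_continuous_interval continuous_on_subset[OF c sub])
    show "\<psi> s / 2 \<le> \<psi> u" if u: "u \<in> {s..r}" for u
    proof -
      have "dist u s < d" using u m by (auto simp: dist_real_def r_def)
      then have "dist (\<psi> u) (\<psi> s) < \<psi> s / 2" using d(2)[of u] u sub by blast
      then show ?thesis unfolding dist_real_def by linarith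
    qed
  qed (simp add: integrable_const_ivl)
  moreover have "integral {s..r} (\<lambda>_. \<psi> s / 2) > 0" using r pos by simp
  ultimately show False using i[of m] by (simp add: r_def)
qed

context brownian
begin

text \<open>A is an arbitrary process with the prescribed bracket increments, so it agrees with the
  integral of the squared gradient only almost surely for each fixed pair of times. Countably many
  times decreasing to s suffice to differentiate at s; this gives the bound at x = W_s, and
  closedness in x extends it to every x.\<close>

lemma quadratic_variation_gradient_bound:
  assumes e: "x_expansion h h'" and s: "s > 0"
    and X: "\<And>t. t > 0 \<Longrightarrow> X t = (\<lambda>\<omega>. h t (W t \<omega>))"
    and qv: "qv_process M X A"
    and mono: "variation_growth A C n"
  shows "(h' s x)\<^sup>2 \<le> C * (1 + s + x\<^sup>2) ^ n"
proof -
  define r where "r = (\<lambda>m. s + 1 / real (Suc m))"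
  have r: "s < r m" "r m \<le> s + 1" for m by (auto simp: r_def field_simps)
  have "AE \<omega> in M. A (r m) \<omega> - A s \<omega> = integral {s..r m} (\<lambda>u. (h' u (W u \<omega>))\<^sup>2)" for m
  proof -
    have "qv_limit M X s (r m) (\<lambda>\<omega>. A (r m) \<omega> - A s \<omega>)" using qv s r unfolding qv_process_def by auto
    moreover have "X u \<in> borel_measurable M" if "u \<in> {s..r m}" for u using qv s that unfolding qv_process_def by auto
    ultimately obtain p k where p: "\<And>j. partition_of s (r m) (p j) (k j)" and mesh: "\<And>j. mesh (p j) (k j) < (1/2) ^ j"
      and lim: "AE \<omega> in M. (\<lambda>j. \<Sum>i<k j. (X (p j (Suc i)) \<omega> - X (p j i) \<omega>)\<^sup>2) \<longlonglongrightarrow> A (r m) \<omega> - A s \<omega>"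
      using qv_limit_obtain_AE[OF _ r(1)[of m]] by blast
    from lim quadratic_variation_AE[OF s r(1) e p mesh] show ?thesis
    proof eventually_elim
      case (elim \<omega>)
      have pos: "p j i > 0" if "i \<le> k j" for j i using partition_of_range[OF p that] s by auto
      have "(\<Sum>i<k j. (X (p j (Suc i)) \<omega> - X (p j i) \<omega>)\<^sup>2) = (\<Sum>i<k j. (h (p j (Suc i)) (W (p j (Suc i)) \<omega>) - h (p j i) (W (p j i) \<omega>))\<^sup>2)" for j
        by (intro sum.cong) (auto simp: X pos)
      then show ?case using elim LIMSEQ_unique by auto
    qed
  qed
  then have "AE \<omega> in M. \<forall>m. A (r m) \<omega> - A s \<omega> = integral {s..r m} (\<lambda>u. (h' u (W u \<omega>))\<^sup>2)"
    by (simp add: AE_all_countable)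
  with mono AE_path have "AE \<omega> in M. W s \<omega> \<in> {x. (h' s x)\<^sup>2 \<le> C * (1 + s + x\<^sup>2) ^ n}"
  proof eventually_elim
    case (elim \<omega>)
    define \<rho> where "\<rho> = (\<lambda>u. (1 + u + (W u \<omega>)\<^sup>2) ^ n)"
    have w: "continuous_on {0..} (\<lambda>u. W u \<omega>)" using elim by simp
    have \<rho>c: "continuous_on {0..} \<rho>" unfolding \<rho>_def by (intro continuous_intros w)
    have hc: "continuous_on {s..s + 1} (\<lambda>u. h' u (W u \<omega>))"
    proof -
      have "continuous_on {s..s + 1} (\<lambda>u. (\<lambda>(t, x). h' t x) (u, W u \<omega>))"
        by (rule continuous_on_compose2[of "{0<..} \<times> UNIV"])
           (use e s continuous_on_subset[OF w, of "{s..s + 1}"] in \<open>auto simp: x_expansion_def intro!: continuous_intros\<close>)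
      then show ?thesis by simp
    qed
    have h2: "continuous_on {s..s + 1} (\<lambda>u. (h' u (W u \<omega>))\<^sup>2)" using hc by (intro continuous_intros)
    have \<rho>s: "continuous_on {s..s + 1} \<rho>" by (rule continuous_on_subset[OF \<rho>c]) (use s in auto)
    have "(h' s (W s \<omega>))\<^sup>2 - C * \<rho> s \<le> 0"
    proof (rule nonpos_of_integral_nonpos[where \<psi>="\<lambda>u. (h' u (W u \<omega>))\<^sup>2 - C * \<rho> u"])
      show "continuous_on {s..s + 1} (\<lambda>u. (h' u (W u \<omega>))\<^sup>2 - C * \<rho> u)"
        by (intro continuous_intros h2 \<rho>s)
      fix m
      have sub: "{s..r m} \<subseteq> {s..s + 1}" using r[of m] by auto
      have L: "(LBINT u:{0..b}. \<rho> u) = integral {0..b} \<rho>" for b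
        by (intro lborel_integral_Icc_eq_integral continuous_on_subset[OF \<rho>c]) auto
      have "\<rho> integrable_on {a..b}" if "0 \<le> a" for a b
        by (intro integrable_continuous_interval continuous_on_subset[OF \<rho>c]) (use that in auto)
      then have split: "integral {0..s} \<rho> + integral {s..r m} \<rho> = integral {0..r m} \<rho>"
        using s r(1)[of m] by (intro Henstock_Kurzweil_Integration.integral_combine) auto
      have "A (r m) \<omega> - C * (LBINT u:{0..r m}. (1 + u + (W u \<omega>)\<^sup>2) ^ n)
                   \<le> A s \<omega> - C * (LBINT u:{0..s}. (1 + u + (W u \<omega>)\<^sup>2) ^ n)"
        using elim(1) s less_imp_le[OF r(1)[of m]] by blast
      then have "integral {s..r m} (\<lambda>u. (h' u (W u \<omega>))\<^sup>2) \<le> C * integral {s..r m} \<rho>"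
        using elim(3) unfolding \<rho>_def[symmetric, THEN fun_cong] L split[symmetric] by (simp add: algebra_simps)
      moreover have "integral {s..r m} (\<lambda>u. (h' u (W u \<omega>))\<^sup>2 - C * \<rho> u) = integral {s..r m} (\<lambda>u. (h' u (W u \<omega>))\<^sup>2) - integral {s..r m} (\<lambda>u. C * \<rho> u)"
        by (intro Henstock_Kurzweil_Integration.integral_diff integrable_continuous_interval continuous_intros
            continuous_on_subset[OF h2 sub] continuous_on_subset[OF \<rho>s sub])
      ultimately show "integral {s..s + 1 / real (Suc m)} (\<lambda>u. (h' u (W u \<omega>))\<^sup>2 - C * \<rho> u) \<le> 0"
        by (simp add: r_def)
    qed
    then show ?case by (simp add: \<rho>_def)
  qed
  moreover have "closed {x. (h' s x)\<^sup>2 \<le> C * (1 + s + x\<^sup>2) ^ n}"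
  proof -
    have "continuous_on UNIV (\<lambda>x. (\<lambda>(t, x). h' t x) (s, x))"
      by (rule continuous_on_compose2[of "{0<..} \<times> UNIV"])
         (use e s in \<open>auto simp: x_expansion_def intro!: continuous_intros\<close>)
    then have "continuous_on UNIV (h' s)" by simp
    then show ?thesis by (intro closed_Collect_le continuous_intros)
  qed
  ultimately have "{x. (h' s x)\<^sup>2 \<le> C * (1 + s + x\<^sup>2) ^ n} = UNIV"
    using closed_AE_W_UNIV[OF s] by blast
  then show ?thesis by blast
qed

end

text \<open>The gradient controls only differences h(t, x) - h(t, 0). The missing value h(t, 0) is
  recovered from the mean zero condition, being minus the Gaussian average of these
  differences.\<close>

lemma gradient_bound_imp_growth:
  assumes n: "n \<ge> 1" and C: "C > 0"
    and int: "\<And>t. t > 0 \<Longrightarrow> integrable lborel (\<lambda>x. h t x * gauss t x)"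
    and mean: "\<And>t. t > 0 \<Longrightarrow> (LBINT x. h t x * gauss t x) = 0"
    and deriv: "\<And>t x. t > 0 \<Longrightarrow> (h t has_real_derivative h' t x) (at x)"
    and bound: "\<And>t x. t > 0 \<Longrightarrow> (h' t x)\<^sup>2 \<le> C * (1 + t + x\<^sup>2) ^ (n - 1)"
  shows "\<exists>K. \<forall>t>0. \<forall>x. \<bar>h t x\<bar> \<le> K * (sqrt (1 + t) + \<bar>x\<bar>) ^ n"
proof -
  define B where "B = (LBINT z. (1 + \<bar>z\<bar>) ^ n * gauss 1 z)"
  have iB: "integrable lborel (\<lambda>z. (1 + \<bar>z\<bar>) ^ n * gauss 1 z)" by (rule integrable_gauss_one_plus_abs_power) simp
  have B0: "B \<ge> 0" unfolding B_def by (rule Bochner_Integration.integral_nonneg) simp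
  have "\<bar>h t x\<bar> \<le> (sqrt C * B + sqrt C) * (sqrt (1 + t) + \<bar>x\<bar>) ^ n" if t: "t > 0" for t x
  proof -
    define r where "r = sqrt (1 + t)"
    have r: "r \<ge> 1" "r\<^sup>2 = 1 + t" "sqrt t \<le> r" using t by (auto simp: r_def)
    have d: "\<bar>h' t y\<bar> \<le> sqrt C * (r + \<bar>y\<bar>) ^ (n - 1)" for y
    proof -
      have "1 + t + y\<^sup>2 \<le> (r + \<bar>y\<bar>)\<^sup>2" using r by (simp add: power2_sum)
      then have "(1 + t + y\<^sup>2) ^ (n - 1) \<le> ((r + \<bar>y\<bar>)\<^sup>2) ^ (n - 1)" using t by (intro power_mono) auto
      then have "(h' t y)\<^sup>2 \<le> C * ((r + \<bar>y\<bar>)\<^sup>2) ^ (n - 1)"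
        using bound[OF t, of y] C by (meson mult_left_mono less_imp_le order_trans)
      also have "\<dots> = (sqrt C * (r + \<bar>y\<bar>) ^ (n - 1))\<^sup>2"
        using C by (simp add: power_mult_distrib power_mult[symmetric] mult.commute)
      finally have "\<bar>h' t y\<bar>\<^sup>2 \<le> (sqrt C * (r + \<bar>y\<bar>) ^ (n - 1))\<^sup>2" by simp
      then show ?thesis by (rule power2_le_imp_le) (use C r in auto)
    qed
    have incr: "\<bar>h t y - h t 0\<bar> \<le> sqrt C * (r + \<bar>y\<bar>) ^ n" for y
    proof -
      have "norm (h t y - h t 0) \<le> (sqrt C * (r + \<bar>y\<bar>) ^ (n - 1)) * norm (y - 0)"
      proof (rule field_differentiable_bound[of "closed_segment 0 y"])
        fix z assume z: "z \<in> closed_segment 0 y"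
        show "(h t has_real_derivative h' t z) (at z within closed_segment 0 y)"
          by (rule has_field_derivative_at_within[OF deriv[OF t]])
        have "\<bar>z\<bar> \<le> \<bar>y\<bar>" using z by (auto simp: closed_segment_eq_real_ivl split: if_splits)
        then have "(r + \<bar>z\<bar>) ^ (n - 1) \<le> (r + \<bar>y\<bar>) ^ (n - 1)" using r by (intro power_mono) auto
        then show "norm (h' t z) \<le> sqrt C * (r + \<bar>y\<bar>) ^ (n - 1)"
          using d[of z] C by (auto intro: order_trans mult_left_mono)
      qed auto
      also have "\<dots> \<le> (sqrt C * (r + \<bar>y\<bar>) ^ (n - 1)) * (r + \<bar>y\<bar>)" using r C by (intro mult_left_mono) auto
      \<comment> \<open>The power \<open>n - 1\<close> gains one factor from the length of the
        segment; as the subtraction truncates, this needs n at least 1.\<close>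
      also have "\<dots> = sqrt C * (r + \<bar>y\<bar>) ^ n" using n by (cases n) auto
      finally show ?thesis by simp
    qed
    have h0: "\<bar>h t 0\<bar> \<le> sqrt C * (r ^ n * B)"
    proof -
      \<comment> \<open>The mean of h vanishes and the Gaussian has total mass 1, so only the
        subtracted constant remains.\<close>
      have "(LBINT y. (h t y - h t 0) * gauss t y) = - h t 0"
        using int[OF t] mean[OF t] t by (simp add: left_diff_distrib)
      then have "\<bar>h t 0\<bar> = \<bar>LBINT y. (h t y - h t 0) * gauss t y\<bar>" by simp
      also have "\<dots> = \<bar>LBINT z. (h t (sqrt t * z) - h t 0) * gauss 1 z\<bar>"
        using integral_gauss_scale[OF t, of "\<lambda>y. h t y - h t 0"] by simp
      also have "\<dots> \<le> (LBINT z. \<bar>(h t (sqrt t * z) - h t 0) * gauss 1 z\<bar>)" by (rule integral_abs_bound)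
      also have "\<dots> \<le> (LBINT z. sqrt C * (r ^ n * ((1 + \<bar>z\<bar>) ^ n * gauss 1 z)))"
      proof (rule integral_mono')
        show "integrable lborel (\<lambda>z. sqrt C * (r ^ n * ((1 + \<bar>z\<bar>) ^ n * gauss 1 z)))" using iB by (intro integrable_mult_right)
        fix z
        have "\<bar>sqrt t * z\<bar> \<le> r * \<bar>z\<bar>" unfolding abs_mult using t r by (intro mult_right_mono) auto
        then have "(r + \<bar>sqrt t * z\<bar>) ^ n \<le> r ^ n * (1 + \<bar>z\<bar>) ^ n"
          unfolding power_mult_distrib[symmetric] using r by (intro power_mono) (auto simp: algebra_simps)
        then have "\<bar>h t (sqrt t * z) - h t 0\<bar> \<le> sqrt C * (r ^ n * (1 + \<bar>z\<bar>) ^ n)"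
          using incr[of "sqrt t * z"] C by (meson mult_left_mono real_sqrt_ge_zero less_imp_le order_trans)
        then have "\<bar>h t (sqrt t * z) - h t 0\<bar> * gauss 1 z \<le> sqrt C * (r ^ n * (1 + \<bar>z\<bar>) ^ n) * gauss 1 z" by (intro mult_right_mono) auto
        then show "\<bar>(h t (sqrt t * z) - h t 0) * gauss 1 z\<bar> \<le> sqrt C * (r ^ n * ((1 + \<bar>z\<bar>) ^ n * gauss 1 z))"
          by (simp add: abs_mult mult_ac)
      qed (use C r in auto)
      also have "\<dots> = sqrt C * (r ^ n * B)" by (simp add: B_def)
      finally show ?thesis .
    qed
    have "r ^ n \<le> (r + \<bar>x\<bar>) ^ n" using r by (intro power_mono) auto
    then have "sqrt C * (r ^ n * B) \<le> sqrt C * ((r + \<bar>x\<bar>) ^ n * B)" using C B0 by (intro mult_left_mono mult_right_mono) auto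
    then have "\<bar>h t x\<bar> \<le> sqrt C * ((r + \<bar>x\<bar>) ^ n * B) + sqrt C * (r + \<bar>x\<bar>) ^ n" using incr[of x] h0 by linarith
    then show ?thesis unfolding r_def by (simp add: algebra_simps)
  qed
  then show ?thesis by blast
qed

section \<open>From the martingale property to the heat sum\<close>

context brownian
begin

text \<open>The Markov property turns the martingale identity into the averaging identity at x =
  W_s, almost surely. Both sides are continuous in x, so the set where they agree is closed, and it
  carries the full law of W_s.\<close>

theorem martingale_imp_caloric:
  fixes h :: "real \<Rightarrow> real \<Rightarrow> real"
  assumes cont: "\<And>t. t > 0 \<Longrightarrow> continuous_on UNIV (h t)"
    and X: "\<And>t. t > 0 \<Longrightarrow> X t = (\<lambda>\<omega>. h t (W t \<omega>))"
    and mart: "martingale_on M (bm_filtration M W) {0<..} X"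
    and st: "0 < s" "s < t"
  shows "h s x = (LBINT w. h t w * gauss (t - s) (w - x))"
proof -
  have t: "t > 0" using st by simp
  have m[measurable]: "h t \<in> borel_measurable borel" by (rule borel_measurable_continuous_onI[OF cont[OF t]])
  have "integrable M (X t)" using mart t unfolding martingale_on_def by auto
  then have int: "integrable M (\<lambda>\<omega>. h t (W t \<omega>))" by (simp only: X[OF t])
  have "AE \<omega> in M. real_cond_exp M (bm_filtration M W s) (X t) \<omega> = X s \<omega>"
    using mart st unfolding martingale_on_def by auto
  moreover have "AE \<omega> in M. real_cond_exp M (bm_filtration M W s) (X t) \<omega> = (LBINT y. h t (W s \<omega> + y) * gauss (t - s) y)"
    unfolding X[OF t] by (rule cond_exp_markov[OF less_imp_le[OF st(1)] st(2) m int])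
  ultimately have "AE \<omega> in M. W s \<omega> \<in> {x. h s x = (LBINT w. h t w * gauss (t - s) (w - x))}"
    by eventually_elim (simp add: X[OF st(1)] gauss_convolution_shift)
  moreover have "closed {x. h s x = (LBINT w. h t w * gauss (t - s) (w - x))}"
    using int W_integral(2)[OF t m] st
    by (intro closed_Collect_eq cont gauss_convolution_continuous m) auto
  ultimately show ?thesis using closed_AE_W_UNIV[OF st(1)] by blast
qed

theorem martingale_growth_imp_heat_sum:
  fixes h :: "real \<Rightarrow> real \<Rightarrow> real"
  assumes n: "n \<ge> 1" and C: "C > 0"
    and cont: "\<And>t. t > 0 \<Longrightarrow> continuous_on UNIV (h t)"
    and X: "\<And>t. t > 0 \<Longrightarrow> X t = (\<lambda>\<omega>. h t (W t \<omega>))"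
    and mean: "\<And>t. t > 0 \<Longrightarrow> expectation (X t) = 0"
    and mart: "martingale_on M (bm_filtration M W) {0<..} X"
    and qv: "qv_process M X A"
    and mono: "variation_growth A C (n - 1)"
  shows "\<exists>a. \<forall>t>0. \<forall>x. h t x = heat_sum a n t x"
proof -
  have m[measurable]: "h t \<in> borel_measurable borel" if "t > 0" for t
    by (rule borel_measurable_continuous_onI[OF cont[OF that]])
  have int: "integrable lborel (\<lambda>x. h t x * gauss t x)" if "t > 0" for t
  proof -
    have "integrable M (X t)" using mart that unfolding martingale_on_def by auto
    then have "integrable M (\<lambda>\<omega>. h t (W t \<omega>))" by (simp only: X[OF that])
    then show ?thesis using W_integral(2)[OF that m[OF that]] by simp
  qed
  have mean': "(LBINT x. h t x * gauss t x) = 0" if "t > 0" for t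
    using mean[OF that] W_integral(1)[OF that m[OF that]] by (simp add: X[OF that])
  have conv: "h s x = (LBINT w. h t w * gauss (t - s) (w - x))" if "0 < s" "s < t" for s t x
    using martingale_imp_caloric[of h, OF cont X mart that] by blast
  define h' where "h' = (\<lambda>s x. deriv (h s) x)"
  \<comment> \<open>Smoothness is a consequence of the averaging identity \<open>conv\<close>; of h
    itself only continuity in x was assumed.\<close>
  have e: "x_expansion h h'" unfolding h'_def by (rule caloric_x_expansion[OF m int conv])
  have "(h' t x)\<^sup>2 \<le> C * (1 + t + x\<^sup>2) ^ (n - 1)" if "t > 0" for t x
    by (rule quadratic_variation_gradient_bound[OF e that X qv mono])
  then obtain K where K: "\<forall>t>0. \<forall>x. \<bar>h t x\<bar> \<le> K * (sqrt (1 + t) + \<bar>x\<bar>) ^ n"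
    using gradient_bound_imp_growth[OF n C int mean' x_expansion_has_derivative[OF e]] by blast
  show ?thesis
    by (rule caloric_growth_imp_heat_sum[OF m conv]) (use K in auto)
qed

end

theorem theorem5:
  fixes M :: "'a measure" and W :: "real \<Rightarrow> 'a \<Rightarrow> real"
    and f :: "real \<Rightarrow> real \<Rightarrow> real" and n :: nat
  assumes bm: "brownian_motion M W"
    and complete: "complete_measure M"
    and n: "n \<ge> 1"
    and f_cont: "continuous_on ({0<..} \<times> UNIV) (\<lambda>(t, x). f t x)"
    and f_int: "\<forall>t>0. integrable M (\<lambda>\<omega>. f t (W t \<omega>))"
  shows "(let g = (\<lambda>t. integral\<^sup>L M (\<lambda>\<omega>. f t (W t \<omega>)));
              X = (\<lambda>t \<omega>. f t (W t \<omega>) - g t)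
          in martingale_on M (bm_filtration M W) {0<..} X \<and>
             (\<exists>C>0. \<exists>A. qv_process M X A \<and>
                (AE \<omega> in M. \<forall>s t. 0 < s \<longrightarrow> s \<le> t \<longrightarrow>
                   A t \<omega> - C * (LBINT u:{0..t}. (1 + u + (W u \<omega>)\<^sup>2) ^ (n - 1))
                   \<le> A s \<omega> - C * (LBINT u:{0..s}. (1 + u + (W u \<omega>)\<^sup>2) ^ (n - 1)))))
         \<longleftrightarrow> (\<exists>P c. heat_polynomial_deg P n \<and> (\<forall>t>0. \<forall>x. f t x = P t x + c t))"
proof -
  interpret brownian M W
  proof -
    have "prob_space M" using bm by (simp add: brownian_motion_def)
    then interpret prob_space M .
    show "brownian M W" by unfold_locales (rule bm)
  qed
  define g where "g = (\<lambda>t. integral\<^sup>L M (\<lambda>\<omega>. f t (W t \<omega>)))"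
  define X where "X = (\<lambda>t \<omega>. f t (W t \<omega>) - g t)"
  show ?thesis
    unfolding Let_def g_def[symmetric, THEN fun_cong] X_def[symmetric, THEN fun_cong] X_def[symmetric]
  proof
    assume a: "martingale_on M (bm_filtration M W) {0<..} X \<and>
             (\<exists>C>0. \<exists>A. qv_process M X A \<and>
                variation_growth A C (n - 1))"
    define h where "h = (\<lambda>t x. f t x - g t)"
    have cont: "continuous_on UNIV (h t)" if "t > 0" for t
    proof -
      have "continuous_on UNIV (\<lambda>x. (\<lambda>(t, x). f t x) (t, x))"
        by (rule continuous_on_compose2[OF f_cont]) (use that in \<open>auto intro!: continuous_intros\<close>)
      then show ?thesis unfolding h_def by (intro continuous_intros) simp
    qed
    have Xh: "X t = (\<lambda>\<omega>. h t (W t \<omega>))" for t by (simp add: X_def h_def)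
    have mean: "expectation (X t) = 0" if "t > 0" for t
      using f_int that prob_space by (simp add: X_def g_def)
    obtain b where b: "\<forall>t>0. \<forall>x. h t x = heat_sum b n t x"
      using martingale_growth_imp_heat_sum[OF n _ cont Xh mean] a by blast
    \<comment> \<open>Since h = f - g, the deterministic function c can be taken to be g
      itself.\<close>
    show "\<exists>P c. heat_polynomial_deg P n \<and> (\<forall>t>0. \<forall>x. f t x = P t x + c t)"
      using b by (intro exI[of _ "heat_sum b n"] exI[of _ g] conjI heat_polynomial_deg_heat_sum) (auto simp: h_def algebra_simps)
  next
    assume "\<exists>P c. heat_polynomial_deg P n \<and> (\<forall>t>0. \<forall>x. f t x = P t x + c t)"
    then obtain P c where P: "heat_polynomial_deg P n" and f: "\<And>t x. t > 0 \<Longrightarrow> f t x = P t x + c t" by blast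
    obtain b where b: "P = heat_sum b n" using heat_polynomial_eq_heat_sum[OF P] by blast
    have f': "f t x = heat_sum b n t x + c t" if "t > 0" for t x using f[OF that] by (simp add: b)
    \<comment> \<open>Here c need not be g: it cancels when the mean is subtracted, and X depends on
      the heat sum alone.\<close>
    have H: "martingale_on M (bm_filtration M W) {0<..} X"
      "\<And>t \<omega>. t > 0 \<Longrightarrow> X t \<omega> = heat_sum b n t (W t \<omega>) - heat_sum b n 0 0"
      using heat_sum_martingale[of f b n c, OF f'] unfolding X_def g_def by blast+
    show "martingale_on M (bm_filtration M W) {0<..} X \<and>
             (\<exists>C>0. \<exists>A. qv_process M X A \<and>
                variation_growth A C (n - 1))"
      using H(1) heat_sum_quadratic_variation[of X b n, OF H(2)] by blast
  qed
qed

end
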